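(* Let $u\in S_n$ and $\mu=\max\{i:c_i(u)>0\}$. Then the encoding map $\varphi_u$ described below is a bijection $\mathrm{PD}(u)\to\Phi_u$ which is weight-preserving: $\mathrm{wt}_u(\varphi_u(D))=\mathrm{wt}(D)$ for all $D\in\mathrm{PD}(u)$.
   Context: Pipe dreams: $\Delta_n=\{(i,j)\in[n]^2:i+j\le n+1\}$ (row $i$, column $j$). For $D\subseteq\Delta_n$, put crosses at positions of $D$ and elbows elsewhere. Label the pipes entering the top $1,\dots,n$ from left to right. $D$ is a pipe dream for $u\in S_n$ if no two pipes cross twice and the labels of pipes exiting the left edge, read top to bottom, give $u$. $\mathrm{PD}(u)$ is the set of such $D$, and $\mathrm{wt}(D)$ is the sequence of numbers of crosses in rows $1,2,\dots$. The code of $u$ is $(c_1(u),c_2(u),\dots)$ with $c_i(u)=|\{j>i:u(j)<u(i)\}|$. Inverse ladder move $L^{-1}_{r,s}$: defined on $D$ when $(r,s)\in D$, $(r,s-1)\notin D$, and for some $m\ge1$ we have $(r+k',s-1),(r+k',s)\in D$ for $1\le k'<m$ and $(r+m,s-1),(r+m,s)\notin D$. Then $L^{-1}_{r,s}(D)=(D\setminus\{(r,s)\})\cup\{(r+m,s-1)\}$. Encoding $\varphi_u$. Repeat the following round. Choose $i$ maximal such that some $j$ has $(i,j)\notin D$, $(i,j+1)\in D$; if none exists, stop. Choose $j$ maximal with this property, and $k>j$ minimal with $(i,k+1)\notin D$. Apply $L^{-1}_{i,j+1},\dots,L^{-1}_{i,k}$ in order; this moves the patch of crosses in columns $j+1,\dots,k$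 of row $i$ down by a common number of rows. A moved patch is moved again in later rounds until left-aligned. Let $\mathcal L_\mu=\{(i,k_1,\dots,k_\ell)\in\mathbb N_{\ge1}^{\ell+1}:\ell\ge1,\ |\mathbf i|:=i+k_1+\dots+k_\ell\le\mu\}$ and $\Phi_\mu=\mathbb N^{\mathcal L_\mu}$. Define $\varphi_u(D)=x$, where $x_{(i,k_1,\dots,k_\ell)}$ is the number of crosses in the patch starting in row $i$ of $D$ that is moved down successively $k_1,\dots,k_\ell$ rows until left-aligned; all other entries are $0$. $u$-weight of $x\in\Phi_\mu$: $\mathrm{wt}_u(x)_j=c_j(u)-\sum_{|\mathbf i|=j}x_{\mathbf i}+\sum_{\mathbf i=(j,\dots)}x_{\mathbf i}$. Ladder order: $(i,k_1,\dots,k_\ell)\prec(i',k'_1,\dots,k'_{\ell'})$ if (a) $i>i'$; or (b) $i=i'$ and for some $0\le t<\min(\ell,\ell')$, $k_s=k'_s$ for $s\le t$ and $k_{t+1}<k'_{t+1}$; or (c) $i=i'$, $\ell>\ell'$ and $k_s=k'_s$ for $s\le\ell'$. Compatible sequences. Fix $\varkappa\subseteq\mathcal L_\mu$. For $\mathbf i\in\varkappa$, $x\in\Phi_\mu$ and $i<j\le|\mathbf i|$, set $c^{\mathbf i}_j(x)=c_j(u)-\sum_{\mathbf i'\in\varkappa,\ \mathbf i\prec\mathbf i',\ |\mathbf i'|=j}x_{\mathbf i'}$. Let $\varkappa^{\mathbf i}=\{\mathbf i'\in\varkappa:\mathbf i\prec\mathbf i',\ i'=i\}$. If $\varkappa^{\mathbf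 i}=\varnothing$, set $c^{\mathbf i}_i(x)=c_i(u)-\sum_{\mathbf i'\in\varkappa,\ \mathbf i\prec\mathbf i',\ |\mathbf i'|=i}x_{\mathbf i'}$. Otherwise, let $\mathbf i'=(i,k'_1,\dots,k'_{\ell'})$ be the $\prec$-minimal element of $\varkappa^{\mathbf i}$ and set $c^{\mathbf i}_i(x)=c^{\mathbf i}_{|\mathbf i'|}(x)+x_{\mathbf i'}+\ell'$. $\Phi_{\varkappa,u}$ is the set of $x\in\Phi_\mu$ such that: (1) $\mathbf i\in\varkappa$ iff $x_{\mathbf i}\ne0$; (2) $\sum_{\mathbf i\in\varkappa,\ |\mathbf i|=j}x_{\mathbf i}\le c_j(u)$ for all $j\in[\mu]$; (3) for all $\mathbf i=(i,k_1,\dots,k_\ell)\in\varkappa$, $p\in[\ell]$, $q\in[k_p]$: if $q=k_p$, then $c^{\mathbf i}_{i+k_1+\dots+k_{p-1}}(x)\le c^{\mathbf i}_{|\mathbf i|}(x)-x_{\mathbf i}+\ell-p$; if $q\ne k_p$, then $c^{\mathbf i}_{i+k_1+\dots+k_{p-1}+q}(x)\ge c^{\mathbf i}_{|\mathbf i|}(x)+\ell-p+1$. $\Phi_u=\bigcup_{\varkappa\subseteq\mathcal L_\mu}\Phi_{\varkappa,u}$. *)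

theory Defs
  imports "HOL-Combinatorics.Permutations"
begin

section \<open>Pipe dreams\<close>

type_synonym cell = "nat \<times> nat"  \<comment> \<open>(row, column), both counted from 1\<close>

definition staircase :: "nat \<Rightarrow> cell set" where
  "staircase n = {(i, j). i \<in> {1..n} \<and> j \<in> {1..n} \<and> i + j \<le> n + 1}"

datatype side = Top | Right

text \<open>
  \<open>pipe_enters n D p d c\<close>: the pipe with label \<open>p\<close> enters the cell \<open>c\<close> through its side \<open>d\<close>.
  Pipes start at the top edge. In a cross they go straight; an elbow joins the top side to the
  left side and the right side to the bottom side, so pipes only ever travel down and left.
  A pipe is followed as long as it stays in the staircase.
\<close>

inductive pipe_enters :: "nat \<Rightarrow> cell set \<Rightarrow> nat \<Rightarrow> side \<Rightarrow> cell \<Rightarrow> bool"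
  for n :: nat and D :: "cell set" and p :: nat where
  start: "p \<in> {1..n} \<Longrightarrow> pipe_enters n D p Top (1, p)"
| cross_down: "pipe_enters n D p Top (i, j) \<Longrightarrow> (i, j) \<in> D \<Longrightarrow> (i + 1, j) \<in> staircase n
    \<Longrightarrow> pipe_enters n D p Top (i + 1, j)"
| elbow_left: "pipe_enters n D p Top (i, j) \<Longrightarrow> (i, j) \<notin> D \<Longrightarrow> (i, j - 1) \<in> staircase n
    \<Longrightarrow> pipe_enters n D p Right (i, j - 1)"
| cross_left: "pipe_enters n D p Right (i, j) \<Longrightarrow> (i, j) \<in> D \<Longrightarrow> (i, j - 1) \<in> staircase n
    \<Longrightarrow> pipe_enters n D p Right (i, j - 1)"
| elbow_down: "pipe_enters n D p Right (i, j) \<Longrightarrow> (i, j) \<notin> D \<Longrightarrow> (i + 1, j) \<in> staircase n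
    \<Longrightarrow> pipe_enters n D p Top (i + 1, j)"

definition pipe_exits_left :: "nat \<Rightarrow> cell set \<Rightarrow> nat \<Rightarrow> nat \<Rightarrow> bool" where
  "pipe_exits_left n D p i \<longleftrightarrow>
     (pipe_enters n D p Top (i, 1) \<and> (i, 1) \<notin> D) \<or>
     (pipe_enters n D p Right (i, 1) \<and> (i, 1) \<in> D)"

definition pipes_cross_at :: "nat \<Rightarrow> cell set \<Rightarrow> nat \<Rightarrow> nat \<Rightarrow> cell \<Rightarrow> bool" where
  "pipes_cross_at n D p q c \<longleftrightarrow> c \<in> D \<and>
     (pipe_enters n D p Top c \<and> pipe_enters n D q Right c \<or>
      pipe_enters n D q Top c \<and> pipe_enters n D p Right c)"

definition PD :: "nat \<Rightarrow> (nat \<Rightarrow> nat) \<Rightarrow> cell set set" where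
  "PD n u = {D. D \<subseteq> staircase n \<and>
     (\<forall>p q c c'. p \<noteq> q \<and> pipes_cross_at n D p q c \<and> pipes_cross_at n D p q c' \<longrightarrow> c = c') \<and>
     (\<forall>i\<in>{1..n}. pipe_exits_left n D (u i) i)}"

definition wt :: "cell set \<Rightarrow> nat \<Rightarrow> nat" where
  "wt D i = card {j. (i, j) \<in> D}"

definition code :: "(nat \<Rightarrow> nat) \<Rightarrow> nat \<Rightarrow> nat" where
  "code u i = card {j. j > i \<and> u j < u i}"

text \<open>The largest \<open>i\<close> with nonzero code entry; for the identity, whose code is zero, this is 0.\<close>

definition code_length :: "(nat \<Rightarrow> nat) \<Rightarrow> nat" where
  "code_length u = Max (insert 0 {i. code u i > 0})"


section \<open>The index set\<close>

text \<open>The index $(i,k_1,\dots,k_\ell)$ is encoded as \<open>(i, ks)\<close>; thus $k_p$ is \<open>ks ! (p - 1)\<close>.\<close>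

type_synonym index = "nat \<times> nat list"

definition index_size :: "index \<Rightarrow> nat" where
  "index_size I = fst I + sum_list (snd I)"

definition indices :: "nat \<Rightarrow> index set" where
  "indices \<mu> = {(i, ks). i \<ge> 1 \<and> ks \<noteq> [] \<and> (\<forall>k\<in>set ks. k \<ge> 1) \<and> index_size (i, ks) \<le> \<mu>}"

text \<open>Families indexed by \<open>indices \<mu>\<close> are represented by functions vanishing elsewhere.\<close>

definition Phi_all :: "nat \<Rightarrow> (index \<Rightarrow> nat) set" where
  "Phi_all \<mu> = {x. \<forall>I. I \<notin> indices \<mu> \<longrightarrow> x I = 0}"

definition weight :: "(nat \<Rightarrow> nat) \<Rightarrow> nat \<Rightarrow> (index \<Rightarrow> nat) \<Rightarrow> nat \<Rightarrow> int" where
  "weight u \<mu> x j = int (code u j)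
     - (\<Sum>I\<in>{I \<in> indices \<mu>. index_size I = j}. int (x I))
     + (\<Sum>I\<in>{I \<in> indices \<mu>. fst I = j}. int (x I))"

fun ladder_less :: "index \<Rightarrow> index \<Rightarrow> bool" where
  "ladder_less (i, ks) (i', ks') \<longleftrightarrow>
     i > i' \<or>
     (i = i' \<and> (\<exists>t < min (length ks) (length ks').
        (\<forall>s<t. ks ! s = ks' ! s) \<and> ks ! t < ks' ! t)) \<or>
     (i = i' \<and> length ks > length ks' \<and> (\<forall>s < length ks'. ks ! s = ks' ! s))"


section \<open>The encoding\<close>

text \<open>
  The inverse ladder move at \<open>(r, s)\<close> is defined on \<open>D\<close> iff \<open>inv_ladder_depth D r s m\<close> holds for
  some \<open>m\<close>, which is then unique. Since columns are counted from 1, the cell \<open>(r, s - 1)\<close> exists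
  only for \<open>s \<ge> 2\<close>.
\<close>

definition inv_ladder_depth :: "cell set \<Rightarrow> nat \<Rightarrow> nat \<Rightarrow> nat \<Rightarrow> bool" where
  "inv_ladder_depth D r s m \<longleftrightarrow> s \<ge> 2 \<and> m \<ge> 1 \<and> (r, s) \<in> D \<and> (r, s - 1) \<notin> D \<and>
     (\<forall>k'. 1 \<le> k' \<and> k' < m \<longrightarrow> (r + k', s - 1) \<in> D \<and> (r + k', s) \<in> D) \<and>
     (r + m, s - 1) \<notin> D \<and> (r + m, s) \<notin> D"

text \<open>
  A state consists of the current set of crosses together with the history of each cross:
  \<open>h c = (i, ks)\<close> says that the cross now at \<open>c\<close> started in row \<open>i\<close> and has been moved down
  successively by the entries of \<open>ks\<close> rows. (Values of \<open>h\<close> outside the current set of crosses are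
  irrelevant.)
\<close>

type_synonym state = "cell set \<times> (cell \<Rightarrow> index)"

definition inv_ladder_move :: "nat \<Rightarrow> nat \<Rightarrow> state \<Rightarrow> state \<Rightarrow> bool" where
  "inv_ladder_move r s S S' \<longleftrightarrow> (case S of (D, h) \<Rightarrow>
     \<exists>m. inv_ladder_depth D r s m \<and>
       S' = (D - {(r, s)} \<union> {(r + m, s - 1)},
             h((r + m, s - 1) := (fst (h (r, s)), snd (h (r, s)) @ [m]))))"

primrec inv_ladder_moves :: "nat \<Rightarrow> nat list \<Rightarrow> state \<Rightarrow> state \<Rightarrow> bool" where
  "inv_ladder_moves r [] S S' \<longleftrightarrow> S' = S"
| "inv_ladder_moves r (s # ss) S S' \<longleftrightarrow>
     (\<exists>T. inv_ladder_move r s S T \<and> inv_ladder_moves r ss T S')"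

definition gap :: "cell set \<Rightarrow> nat \<Rightarrow> nat \<Rightarrow> bool" where
  "gap D i j \<longleftrightarrow> j \<ge> 1 \<and> (i, j) \<notin> D \<and> (i, j + 1) \<in> D"

definition encoding_round :: "state \<Rightarrow> state \<Rightarrow> bool" where
  "encoding_round S S' \<longleftrightarrow> (\<exists>i j k.
     gap (fst S) i j \<and>
     (\<forall>i' j'. gap (fst S) i' j' \<longrightarrow> i' \<le> i) \<and>
     (\<forall>j'. gap (fst S) i j' \<longrightarrow> j' \<le> j) \<and>
     k = (LEAST k. k > j \<and> (i, k + 1) \<notin> fst S) \<and>
     inv_ladder_moves i [j + 1..<k + 1] S S')"

text \<open>
  Distinct patches of a row have distinct histories, so counting the crosses with history
  \<open>(i, ks)\<close> gives the size of the patch in question. Crosses that are never moved (\<open>ks = []\<close>) are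
  not recorded.
\<close>

definition count_histories :: "state \<Rightarrow> index \<Rightarrow> nat" where
  "count_histories S I = (if snd I = [] then 0 else card {c \<in> fst S. snd S c = I})"

definition encoding :: "cell set \<Rightarrow> index \<Rightarrow> nat" where
  "encoding D = (THE x. \<exists>S. encoding_round\<^sup>*\<^sup>* (D, \<lambda>(r, s). (r, [])) S \<and>
     (\<nexists>i j. gap (fst S) i j) \<and> x = count_histories S)"


section \<open>Compatible sequences\<close>

definition later_in_row :: "index set \<Rightarrow> index \<Rightarrow> index set" where
  "later_in_row K I = {I' \<in> K. ladder_less I I' \<and> fst I' = fst I}"

definition ladder_minimal :: "index set \<Rightarrow> index" where
  "ladder_minimal A = (THE I. I \<in> A \<and> (\<forall>I'\<in>A. \<not> ladder_less I' I))"

text \<open>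
  The formula $c_j(u) - \sum_{\mathbf i'} x_{\mathbf i'}$ over all $\mathbf i' \in K$ with
  $\mathbf i \prec \mathbf i'$ and $|\mathbf i'| = j$. It is needed for arbitrary \<open>j\<close>, because the
  definition of $c^{\mathbf i}_i$ below uses it at $j = |\mathbf i'|$, which may exceed
  $|\mathbf i|$. The values may be negative, so they are integers.
\<close>

definition c_generic :: "(nat \<Rightarrow> nat) \<Rightarrow> index set \<Rightarrow> (index \<Rightarrow> nat) \<Rightarrow> index \<Rightarrow> nat \<Rightarrow> int" where
  "c_generic u K x I j = int (code u j)
     - (\<Sum>I'\<in>{I' \<in> K. ladder_less I I' \<and> index_size I' = j}. int (x I'))"

definition c_seq :: "(nat \<Rightarrow> nat) \<Rightarrow> index set \<Rightarrow> (index \<Rightarrow> nat) \<Rightarrow> index \<Rightarrow> nat \<Rightarrow> int" where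
  "c_seq u K x I j =
     (if j = fst I \<and> later_in_row K I \<noteq> {}
      then let I' = ladder_minimal (later_in_row K I)
           in c_generic u K x I (index_size I') + int (x I') + int (length (snd I'))
      else c_generic u K x I j)"

definition Phi_supp :: "nat \<Rightarrow> index set \<Rightarrow> (nat \<Rightarrow> nat) \<Rightarrow> (index \<Rightarrow> nat) set" where
  "Phi_supp \<mu> K u = {x \<in> Phi_all \<mu>.
     (\<forall>I\<in>indices \<mu>. I \<in> K \<longleftrightarrow> x I \<noteq> 0) \<and>
     (\<forall>j\<in>{1..\<mu>}. (\<Sum>I\<in>{I \<in> K. index_size I = j}. x I) \<le> code u j) \<and>
     (\<forall>(i, ks)\<in>K. \<forall>p\<in>{1..length ks}. \<forall>q\<in>{1..ks ! (p - 1)}.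
        let I = (i, ks);
            c = c_seq u K x I;
            r = i + sum_list (take (p - 1) ks)
        in (q = ks ! (p - 1) \<longrightarrow>
              c r \<le> c (index_size I) - int (x I) + int (length ks) - int p) \<and>
           (q \<noteq> ks ! (p - 1) \<longrightarrow>
              c (r + q) \<ge> c (index_size I) + int (length ks) - int p + 1))}"

definition Phi :: "nat \<Rightarrow> (nat \<Rightarrow> nat) \<Rightarrow> (index \<Rightarrow> nat) set" where
  "Phi \<mu> u = (\<Union>K\<in>Pow (indices \<mu>). Phi_supp \<mu> K u)"

end

theory Submission
  imports Defs
begin

text \<open>
  Inverse ladder moves preserve the set of pipe dreams of \<open>u\<close>, and the only left-aligned pipe dream
  of \<open>u\<close> has the code of \<open>u\<close> as its row lengths. In a round the rows below the moved patch are
  left-aligned, and reducedness forbids the patch to overlap the end of one of them only in part;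
  so the whole patch moves down, and every pipe dream is taken to the left-aligned one.

  Backwards, a patch is recovered from its index and its size alone: the patch with index
  \<open>(i, ks)\<close> is the end of row \<open>i + sum_list ks\<close>, shifted to the right by \<open>length ks\<close> columns and
  lifted to row \<open>i\<close>. The inequalities of a compatible sequence say precisely that the lifted patch
  is separated from the rest of row \<open>i\<close> and that the intermediate rows make it stop where \<open>ks\<close>
  says. They also force the patches to be processed in ladder order.
\<close>


subsection \<open>Pipe labels\<close>

text \<open>Pipe dreams and compatible sequences are both parametrised by valid runs, lists of pairs
  of an index and a size: \<open>diagram\<close> and \<open>width\<close> are the two bijections,
  and \<open>encoding (diagram u L) = width L\<close>. A run has one entry per patch, while pipe
  dreams are reached one move at a time; the two fit because a patch moved without becoming
  left-aligned is the one that the next round moves.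

  The numbers of a compatible sequence are positions in the diagram just after patch
  \<open>I\<close> has landed. The patches after \<open>I\<close> in ladder order are still to land,
  so \<open>code u j\<close> minus their sizes is the length of a left-aligned row \<open>j\<close>.
  The row where \<open>I\<close> started need not be left-aligned; its last cross is the end of its
  next patch \<open>I'\<close>, which stands \<open>length (snd I')\<close> columns to the right of
  the end of its landing row. This is the exceptional clause of \<open>c_seq\<close>. The term
  \<open>length ks - p\<close> counts the moves left after the \<open>p\<close>-th.

  Pipes are treated as functions from columns to labels, because a ladder move then composes them
  with a transposition that cancels below the ladder.\<close>

definition row :: "cell set \<Rightarrow> nat \<Rightarrow> nat set" where
  "row D i = {j. (i, j) \<in> D}"

lemma mem_row [simp]: "j \<in> row D i \<longleftrightarrow> (i, j) \<in> D"
  by (simp add: row_def)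

text \<open>With \<open>A\<close> the crosses of a row: a pipe entering column \<open>j\<close> from
  the right has come straight through crosses from this elbow, which it entered from the
  top.\<close>

definition next_elbow :: "nat set \<Rightarrow> nat \<Rightarrow> nat" where
  "next_elbow A j = (LEAST c. j < c \<and> c \<notin> A)"

text \<open>The column in which the pipe leaving column \<open>j\<close> at the bottom entered the
  row from the top. At \<open>j = 0\<close>, where no cross lies, it is the column of the pipe that
  leaves the row on the left.\<close>

definition column_above :: "nat set \<Rightarrow> nat \<Rightarrow> nat" where
  "column_above A j = (if j \<in> A then j else next_elbow A j)"

lemma next_elbow_props:
  assumes "finite A"
  shows "j < next_elbow A j" "next_elbow A j \<notin> A" "j < d \<Longrightarrow> d < next_elbow A j \<Longrightarrow> d \<in> A"
proof -
  have "infinite ({j<..} - A)"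
    using assms infinite_Ioi[of j] by (metis Diff_infinite_finite)
  then obtain c where "c \<in> {j<..} - A"
    by (metis finite.emptyI ex_in_conv)
  then have ex: "j < c \<and> c \<notin> A" by auto
  have "j < next_elbow A j \<and> next_elbow A j \<notin> A"
    unfolding next_elbow_def by (rule LeastI[where P = "\<lambda>c. j < c \<and> c \<notin> A", OF ex])
  then show "j < next_elbow A j" "next_elbow A j \<notin> A" by auto
  show "j < d \<Longrightarrow> d < next_elbow A j \<Longrightarrow> d \<in> A"
    unfolding next_elbow_def using not_less_Least by blast
qed

lemma next_elbow_eq_iff:
  assumes "finite A"
  shows "next_elbow A j = c \<longleftrightarrow> j < c \<and> c \<notin> A \<and> (\<forall>d. j < d \<and> d < c \<longrightarrow> d \<in> A)"
proof
  assume "next_elbow A j = c"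
  then show "j < c \<and> c \<notin> A \<and> (\<forall>d. j < d \<and> d < c \<longrightarrow> d \<in> A)"
    using next_elbow_props[OF assms, of j] by blast
next
  assume c: "j < c \<and> c \<notin> A \<and> (\<forall>d. j < d \<and> d < c \<longrightarrow> d \<in> A)"
  show "next_elbow A j = c"
  proof (rule linorder_cases)
    assume "next_elbow A j < c"
    then show ?thesis using next_elbow_props(1,2)[OF assms, of j] c by blast
  next
    assume "c < next_elbow A j"
    then show ?thesis using next_elbow_props(3)[OF assms, of j c] c by blast
  qed
qed

lemma next_elbow_pred:
  assumes "finite A" "1 \<le> j"
  shows "next_elbow A (j - 1) = (if j \<in> A then next_elbow A j else j)"
proof (cases "j \<in> A")
  case True
  have "d \<in> A" if "j - 1 < d" "d < next_elbow A j" for d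
    using that True next_elbow_props(3)[OF assms(1), of j d] by (cases "d = j") auto
  then have "next_elbow A (j - 1) = next_elbow A j" using next_elbow_props(1,2)[OF assms(1), of j]
    unfolding next_elbow_eq_iff[OF assms(1)] by auto
  then show ?thesis using True by simp
next
  case False
  then show ?thesis using assms by (auto simp: next_elbow_eq_iff)
qed

lemma column_above_pos: "finite A \<Longrightarrow> 0 \<notin> A \<Longrightarrow> 0 < column_above A j"
  using next_elbow_props(1)[of A j] by (auto simp: column_above_def intro: gr0I)

lemma inj_column_above:
  assumes "finite A"
  shows "inj (column_above A)"
proof (rule linorder_injI)
  fix x y :: nat
  assume "x < y"
  then show "column_above A x \<noteq> column_above A y"
    using next_elbow_props[OF assms, of x] next_elbow_props[OF assms, of y]
    by (auto simp: column_above_def)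
qed

text \<open>Every pipe entering a row from the top leaves it at the bottom of some column or at the
  left end, which is encoded as column 0.\<close>

lemma range_column_above:
  assumes "finite A" "0 \<notin> A"
  shows "range (column_above A) = {1..}"
proof
  show "range (column_above A) \<subseteq> {1..}" using column_above_pos[OF assms] by (auto simp: Suc_le_eq)
  show "{1..} \<subseteq> range (column_above A)"
  proof
    fix c :: nat
    assume c: "c \<in> {1..}"
    show "c \<in> range (column_above A)"
    proof (cases "c \<in> A")
      case True
      then show ?thesis by (metis column_above_def rangeI)
    next
      case False
      \<comment> \<open>A pipe entering the elbow \<open>c\<close> from the top turns left and runs
        to the last elbow before \<open>c\<close>; column 0 serves as that elbow if there is no
        other.\<close>
      let ?B = "{d. d < c \<and> d \<notin> A}"
      have B: "finite ?B" "0 \<in> ?B" using c assms(2) by auto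
      define d where "d = Max ?B"
      have d: "d \<in> ?B" using B Max_in unfolding d_def by blast
      have "next_elbow A d = c"
        unfolding next_elbow_eq_iff[OF assms(1)]
      proof (intro conjI allI impI)
        fix e assume e: "d < e \<and> e < c"
        show "e \<in> A"
        proof (rule ccontr)
          assume "e \<notin> A"
          then have "e \<le> d" unfolding d_def using B e by (intro Max_ge) auto
          then show False using e by simp
        qed
      qed (use d False in auto)
      then show ?thesis using d by (metis (mono_tags, lifting) mem_Collect_eq rangeI column_above_def)
    qed
  qed
qed

text \<open>
  The label of the pipe entering \<open>(i, j)\<close> from the top. The board is unbounded here, all cells off
  the staircase being elbows; the junk column 0 holds the pipe that has left the previous row.
\<close>

fun top_label :: "cell set \<Rightarrow> nat \<Rightarrow> nat \<Rightarrow> nat" where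
  "top_label D 0 j = j"
| "top_label D (Suc i) j = (if i = 0 then j else top_label D i (column_above (row D i) j))"

lemma top_label_1 [simp]: "top_label D 1 = id" "top_label D (Suc 0) = id"
  by (auto simp: fun_eq_iff)

lemma top_label_step: "1 \<le> i \<Longrightarrow> top_label D (Suc i) = top_label D i \<circ> column_above (row D i)"
  by (auto simp: fun_eq_iff)

declare top_label.simps(2) [simp del]

text \<open>At \<open>j = 0\<close> this is the label of the pipe that exits row \<open>i\<close> on
  the left.\<close>

definition right_label :: "cell set \<Rightarrow> nat \<Rightarrow> nat \<Rightarrow> nat" where
  "right_label D i j = top_label D i (next_elbow (row D i) j)"

definition positive_cells :: "cell set \<Rightarrow> bool" where
  "positive_cells D \<longleftrightarrow> finite D \<and> (\<forall>(i, j)\<in>D. 1 \<le> i \<and> 1 \<le> j)"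

lemma positive_cells_row: "positive_cells D \<Longrightarrow> finite (row D i)" "positive_cells D \<Longrightarrow> 0 \<notin> row D i"
proof -
  assume "positive_cells D"
  then have "finite (snd ` D)" by (simp add: positive_cells_def)
  moreover have "row D i \<subseteq> snd ` D" by force
  ultimately show "finite (row D i)" using finite_subset by blast
qed (auto simp: positive_cells_def)

lemma inj_top_label:
  assumes "positive_cells D" "1 \<le> i"
  shows "inj (top_label D i)"
  using assms(2)
proof (induction i rule: dec_induct)
  case base
  then show ?case by simp
next
  case (step i)
  then show ?case
    using inj_column_above[OF positive_cells_row(1)[OF assms(1)]] by (simp only: top_label_step inj_compose)
qed

lemma top_label_eq_iff: "positive_cells D \<Longrightarrow> 1 \<le> i \<Longrightarrow> top_label D i j = top_label D i j' \<longleftrightarrow> j = j'"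
  by (rule inj_eq[OF inj_top_label])

text \<open>Each row loses exactly one label, that of its junk column 0, and redistributes the
  others over the columns from 1 on.\<close>

lemma top_label_image:
  assumes "positive_cells D" "1 \<le> i"
  shows "top_label D i ` {1..} = {1..} - (\<lambda>r. right_label D r 0) ` {1..<i}"
  using assms(2)
proof (induction i rule: dec_induct)
  case base
  then show ?case by simp
next
  case (step i)
  have fr: "finite (row D i)" "0 \<notin> row D i" using positive_cells_row[OF assms(1)] by auto
  have UN: "(UNIV :: nat set) = insert 0 {1..}" by auto
  have 1: "column_above (row D i) ` {1..} = {1..} - {column_above (row D i) 0}"
  proof -
    have "column_above (row D i) ` ({1..} :: nat set) = column_above (row D i) ` (UNIV - {0})"
      by (rule arg_cong[where f = "image (column_above (row D i))"]) auto
    also have "\<dots> = range (column_above (row D i)) - {column_above (row D i) 0}"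
      using inj_column_above[OF fr(1)] by (simp add: image_set_diff)
    finally show ?thesis using range_column_above[OF fr] by simp
  qed
  have "top_label D (Suc i) ` {1..} = top_label D i ` (column_above (row D i) ` {1..})"
    using step.hyps by (simp add: top_label_step image_comp)
  also have "\<dots> = top_label D i ` {1..} - {top_label D i (column_above (row D i) 0)}"
    unfolding 1 using inj_top_label[OF assms(1) step.hyps(1)] by (simp add: image_set_diff)
  also have "top_label D i (column_above (row D i) 0) = right_label D i 0"
    using fr by (simp add: column_above_def right_label_def)
  finally show ?case using step by (auto simp: atLeastLessThanSuc)
qed

lemma top_label_not_exit:
  assumes "positive_cells D" "1 \<le> r" "r < i" "1 \<le> j"
  shows "top_label D i j \<noteq> right_label D r 0"
proof -
  have "top_label D i j \<in> top_label D i ` {1..}" using assms by auto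
  moreover have "right_label D r 0 \<in> (\<lambda>r. right_label D r 0) ` {1..<i}" using assms by auto
  ultimately show ?thesis using top_label_image[OF assms(1), of i] assms by (metis DiffD2 order.strict_implies_order order.trans)
qed

lemma top_ne_right:
  assumes "positive_cells D" "1 \<le> i"
  shows "top_label D i j \<noteq> right_label D i j"
  using next_elbow_props(1)[OF positive_cells_row(1)[OF assms(1)], of j i]
  by (simp add: right_label_def top_label_eq_iff[OF assms])

text \<open>An unordered pair, because \<open>pipes_cross_at\<close> does not record which pipe
  comes from the top. That no two pipes cross twice thus becomes injectivity on
  \<open>D\<close>.\<close>

definition crossing :: "cell set \<Rightarrow> cell \<Rightarrow> nat set" where
  "crossing D c = {top_label D (fst c) (snd c), right_label D (fst c) (snd c)}"

text \<open>The bound is \<open>n\<close> and not the \<open>n + 1\<close> of the staircase: a cross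
  on the antidiagonal would lead a pipe out of the board, see
  \<open>PD_no_antidiagonal\<close>.\<close>

definition pipe_dream :: "nat \<Rightarrow> (nat \<Rightarrow> nat) \<Rightarrow> cell set \<Rightarrow> bool" where
  "pipe_dream n u D \<longleftrightarrow> (\<forall>(i, j)\<in>D. 1 \<le> i \<and> 1 \<le> j \<and> i + j \<le> n) \<and>
     (\<forall>i\<in>{1..n}. right_label D i 0 = u i) \<and> inj_on (crossing D) D"

section \<open>Equivalence with the inductive definition of pipes\<close>

lemma staircase_finite: "finite (staircase n)"
proof -
  have "staircase n \<subseteq> {1..n} \<times> {1..n}" by (auto simp: staircase_def)
  then show ?thesis by (rule finite_subset) simp
qed

lemma positive_cells_staircase:
  assumes "D \<subseteq> staircase n"
  shows "positive_cells D"
proof -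
  have "finite D" using assms staircase_finite by (rule finite_subset)
  then show ?thesis using assms by (auto simp: positive_cells_def staircase_def)
qed

lemma pipe_enters_sound:
  assumes "positive_cells D" "pipe_enters n D p d c"
  shows "c \<in> staircase n \<and>
    p = (case d of Top \<Rightarrow> top_label D (fst c) (snd c) | Right \<Rightarrow> right_label D (fst c) (snd c))"
  using assms(2)
proof induction
  case start
  then show ?case by (auto simp: staircase_def)
next
  case (cross_down i j)
  then have "1 \<le> i" by (auto simp: staircase_def)
  then show ?case using cross_down by (simp add: top_label_step column_above_def)
next
  case (elbow_left i j)
  then have "1 \<le> j" by (auto simp: staircase_def)
  then show ?case using elbow_left next_elbow_pred[OF positive_cells_row(1)[OF assms(1)]] by (simp add: right_label_def)
next
  case (cross_left i j)
  then have "1 \<le> j" by (auto simp: staircase_def)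
  then show ?case using cross_left next_elbow_pred[OF positive_cells_row(1)[OF assms(1)]] by (simp add: right_label_def)
next
  case (elbow_down i j)
  then have "1 \<le> i" by (auto simp: staircase_def)
  then show ?case using elbow_down by (simp add: top_label_step column_above_def right_label_def)
qed

text \<open>A pipe changes rows only downwards and through a top side, so it has entered every row
  on its way from the top.\<close>

lemma pipe_enters_Top_above:
  assumes "pipe_enters n D p d c" "1 \<le> r" "r \<le> fst c"
  shows "\<exists>j. pipe_enters n D p Top (r, j)"
  using assms
proof induction
  case start
  then show ?case using pipe_enters.start[of p n D] by (auto simp: le_Suc_eq)
next
  case (cross_down i j)
  then show ?case using pipe_enters.cross_down[of n D p i j] by (auto simp: le_Suc_eq)
next
  case (elbow_down i j)
  then show ?case using pipe_enters.elbow_down[of n D p i j] by (auto simp: le_Suc_eq)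
qed auto

lemma pipe_exits_left_sound:
  assumes "positive_cells D" "pipe_exits_left n D p i"
  shows "p = right_label D i 0"
proof -
  have "next_elbow (row D i) 0 = (if (i, 1) \<in> D then next_elbow (row D i) 1 else 1)"
    using next_elbow_pred[OF positive_cells_row(1)[OF assms(1)], of 1 i] by simp
  then show ?thesis using assms pipe_enters_sound[OF assms(1)]
    unfolding pipe_exits_left_def by (fastforce simp: right_label_def)
qed

text \<open>The \<open>n + 1 - i\<close> pipes exiting in rows \<open>i\<close> to \<open>n\<close>
  all enter row \<open>i\<close> from the top inside the staircase, so they occupy every column
  there. The one above an antidiagonal cross goes straight down out of the staircase; hence it can
  exit neither in row \<open>i\<close> nor below.\<close>

lemma PD_no_antidiagonal:
  assumes D: "D \<in> PD n u" and u: "u permutes {1..n}" and c: "(i, j) \<in> D"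
  shows "i + j \<le> n"
proof (rule ccontr)
  assume "\<not> i + j \<le> n"
  have st: "D \<subseteq> staircase n" using D by (simp add: PD_def)
  have ex: "pipe_exits_left n D (u i) i" if "i \<in> {1..n}" for i
    using D that unfolding PD_def mem_Collect_eq by (elim conjE bspec)
  have ij: "1 \<le> i" "1 \<le> j" "i + j = n + 1"
    using c st \<open>\<not> i + j \<le> n\<close> by (auto simp: staircase_def)
  have pos: "positive_cells D" using positive_cells_staircase[OF st] .
  have above: "\<exists>j \<in> {1..n + 1 - r}. u i' = top_label D r j" if "1 \<le> r" "r \<le> i'" "i' \<le> n" for r i'
  proof -
    have "i' \<in> {1..n}" using that by simp
    then obtain d where "pipe_enters n D (u i') d (i', 1)"
      using ex[of i'] unfolding pipe_exits_left_def by blast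
    from pipe_enters_Top_above[OF this that(1)] that(2)
    obtain j where "pipe_enters n D (u i') Top (r, j)" by auto
    from pipe_enters_sound[OF pos this] show ?thesis
      by (auto simp: staircase_def)
  qed
  have inj_u: "inj_on u A" for A using permutes_inj[OF u] by (rule inj_on_subset) simp
  have "u ` {i..n} \<subseteq> top_label D i ` {1..n + 1 - i}"
    using above[OF ij(1)] by fastforce
  moreover have "card (u ` {i..n}) = n + 1 - i" using inj_u by (simp add: card_image)
  moreover have "card (top_label D i ` {1..n + 1 - i}) = n + 1 - i"
    using inj_on_subset[OF inj_top_label[OF pos ij(1)] subset_UNIV] by (simp add: card_image)
  ultimately have "u ` {i..n} = top_label D i ` {1..n + 1 - i}"
    by (intro card_subset_eq) auto
  moreover have "j \<in> {1..n + 1 - i}" using ij by auto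
  ultimately obtain i' where i': "i' \<in> {i..n}" "u i' = top_label D i j"
    by (metis imageE imageI)
  show False
  proof (cases "i' = i")
    case True
    then have "u i = right_label D i 0" using pipe_exits_left_sound[OF pos ex[of i]] ij by auto
    then have "j = next_elbow (row D i) 0" using i' True top_label_eq_iff[OF pos ij(1)]
      by (simp add: right_label_def)
    then show False using c next_elbow_props(2)[OF positive_cells_row(1)[OF pos], of i 0] by simp
  next
    case False
    then obtain j' where j': "j' \<in> {1..n + 1 - Suc i}" "u i' = top_label D (Suc i) j'"
      using above[of "Suc i" i'] i' by auto
    then have "column_above (row D i) j' = j" using i' top_label_eq_iff[OF pos ij(1)] ij by (simp add: top_label_step)
    then show False using c next_elbow_props(2)[OF positive_cells_row(1)[OF pos], of i j'] j' ij
      by (auto simp: column_above_def split: if_splits)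
  qed
qed

lemma pipe_enters_complete:
  assumes small: "\<forall>(i, j)\<in>D. 1 \<le> i \<and> 1 \<le> j \<and> i + j \<le> n" and fin: "finite D"
  shows "1 \<le> i \<Longrightarrow> (\<forall>j. 1 \<le> j \<and> i + j \<le> n + 1 \<longrightarrow> pipe_enters n D (top_label D i j) Top (i, j)) \<and>
      (\<forall>j. 1 \<le> j \<and> i + j \<le> n \<longrightarrow> pipe_enters n D (right_label D i j) Right (i, j))"
proof (induction i rule: dec_induct)
  have pos: "positive_cells D" using small fin by (auto simp: positive_cells_def)
  have right: "pipe_enters n D (right_label D i j) Right (i, j)"
    if top: "\<forall>j. 1 \<le> j \<and> i + j \<le> n + 1 \<longrightarrow> pipe_enters n D (top_label D i j) Top (i, j)"
      and "1 \<le> i" "1 \<le> j" "i + j \<le> n" for i j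
    using that(3-)
  \<comment> \<open>Columns are treated from right to left. The antidiagonal cell is an elbow by
    \<open>small\<close>, so the crosses to the right of \<open>(i, j)\<close> end at an elbow
    inside the staircase.\<close>
  proof (induction "n - j" arbitrary: j rule: less_induct)
    case less
    have st: "(i, Suc j - 1) \<in> staircase n" using less that(2) by (auto simp: staircase_def)
    have nx: "next_elbow (row D i) j = (if (i, Suc j) \<in> D then next_elbow (row D i) (Suc j) else Suc j)"
      using next_elbow_pred[OF positive_cells_row(1)[OF pos], of "Suc j"] by simp
    show ?case
    proof (cases "(i, Suc j) \<in> D")
      case True
      then have "i + Suc j \<le> n" using small by auto
      then have "pipe_enters n D (right_label D i (Suc j)) Right (i, Suc j)"
        using less that(2) by auto
      from pipe_enters.cross_left[OF this True st] nx True show ?thesis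
        by (simp add: right_label_def)
    next
      case False
      have "pipe_enters n D (top_label D i (Suc j)) Top (i, Suc j)" using top less by auto
      from pipe_enters.elbow_left[OF this False st] nx False show ?thesis
        by (simp add: right_label_def)
    qed
  qed
  {
    case base
    have "pipe_enters n D (top_label D 1 j) Top (1, j)" if "1 \<le> j" "1 + j \<le> n + 1" for j
      using that pipe_enters.start[of j n D] by simp
    then show ?case using right[of 1] by blast
  next
    case (step i)
    have "pipe_enters n D (top_label D (Suc i) j) Top (Suc i, j)" if "1 \<le> j" "Suc i + j \<le> n + 1" for j
    proof -
      have st: "(i + 1, j) \<in> staircase n" using that by (auto simp: staircase_def)
      show ?thesis
      proof (cases "(i, j) \<in> D")
        case True
        then have "pipe_enters n D (top_label D i j) Top (i, j)" using step that by auto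
        from pipe_enters.cross_down[OF this True st] show ?thesis
          using True step by (simp add: top_label_step column_above_def)
      next
        case False
        then have "pipe_enters n D (right_label D i j) Right (i, j)" using step that by auto
        from pipe_enters.elbow_down[OF this False st] show ?thesis
          using False step by (simp add: top_label_step column_above_def right_label_def)
      qed
    qed
    then show ?case using right[of "Suc i"] by simp
  }
qed

lemma PD_iff_pipe_dream:
  assumes u: "u permutes {1..n}"
  shows "D \<in> PD n u \<longleftrightarrow> pipe_dream n u D"
proof -
  have main: "D \<in> PD n u \<longleftrightarrow> pipe_dream n u D"
    if st: "D \<subseteq> staircase n" and small: "\<forall>(i, j)\<in>D. 1 \<le> i \<and> 1 \<le> j \<and> i + j \<le> n"
  proof -
    have pos: "positive_cells D" using positive_cells_staircase[OF st] .
    then have fin: "finite D" by (simp add: positive_cells_def)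
    note compl = pipe_enters_complete[OF small fin]
    have cross: "pipes_cross_at n D p q c \<longleftrightarrow> c \<in> D \<and> crossing D c = {p, q}" if "p \<noteq> q" for p q c
    proof (cases "c \<in> D")
      case True
      obtain i j where c: "c = (i, j)" by fastforce
      have "1 \<le> i" "1 \<le> j" "i + j \<le> n" using True c small by auto
      then have en: "pipe_enters n D p Top c \<longleftrightarrow> p = top_label D i j"
        "pipe_enters n D p Right c \<longleftrightarrow> p = right_label D i j" for p
        using compl[of i] pipe_enters_sound[OF pos, of n p Top c]
          pipe_enters_sound[OF pos, of n p Right c] c by auto
      show ?thesis using True that c
        unfolding pipes_cross_at_def en crossing_def by (auto simp: doubleton_eq_iff)
    qed (simp add: pipes_cross_at_def)
    have crossing_two: "\<exists>p q. p \<noteq> q \<and> crossing D c = {p, q}" if "c \<in> D" for c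
    proof -
      have "1 \<le> fst c" using that small by auto
      then show ?thesis using top_ne_right[OF pos] unfolding crossing_def by blast
    qed
    have inj: "(\<forall>p q c c'. p \<noteq> q \<and> pipes_cross_at n D p q c \<and> pipes_cross_at n D p q c' \<longrightarrow> c = c')
        \<longleftrightarrow> inj_on (crossing D) D" (is "?l \<longleftrightarrow> ?r")
    proof
      assume l: ?l
      show ?r
      proof (rule inj_onI)
        fix c c' assume c: "c \<in> D" "c' \<in> D" "crossing D c = crossing D c'"
        obtain p q where "p \<noteq> q" "crossing D c = {p, q}" using crossing_two[OF c(1)] by blast
        then have "pipes_cross_at n D p q c" "pipes_cross_at n D p q c'" using c cross by auto
        then show "c = c'" using l \<open>p \<noteq> q\<close> by blast
      qed
    next
      assume r: ?r
      show ?l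
      proof (intro allI impI)
        fix p q c c'
        assume "p \<noteq> q \<and> pipes_cross_at n D p q c \<and> pipes_cross_at n D p q c'"
        then have "c \<in> D" "c' \<in> D" "crossing D c = crossing D c'" using cross[of p q] by auto
        then show "c = c'" using r by (meson inj_onD)
      qed
    qed
    have "pipe_exits_left n D (u i) i \<longleftrightarrow> right_label D i 0 = u i" if i: "i \<in> {1..n}" for i
    proof
      assume "pipe_exits_left n D (u i) i"
      then show "right_label D i 0 = u i" using pipe_exits_left_sound[OF pos] by simp
    next
      assume e: "right_label D i 0 = u i"
      have nx: "next_elbow (row D i) 0 = (if (i, 1) \<in> D then next_elbow (row D i) 1 else 1)"
        using next_elbow_pred[OF positive_cells_row(1)[OF pos], of 1 i] by simp
      show "pipe_exits_left n D (u i) i"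
      proof (cases "(i, 1) \<in> D")
        case True
        then have "i + 1 \<le> n" using small by auto
        then have "pipe_enters n D (right_label D i 1) Right (i, 1)" using compl[of i] i by auto
        then show ?thesis using True e nx by (simp add: pipe_exits_left_def right_label_def)
      next
        case False
        have "pipe_enters n D (top_label D i 1) Top (i, 1)" using compl[of i] i by auto
        then show ?thesis using False e nx by (simp add: pipe_exits_left_def right_label_def)
      qed
    qed
    then have exits: "(\<forall>i\<in>{1..n}. pipe_exits_left n D (u i) i) \<longleftrightarrow> (\<forall>i\<in>{1..n}. right_label D i 0 = u i)"
      by (rule ball_cong[OF refl])
    show ?thesis unfolding PD_def pipe_dream_def mem_Collect_eq inj exits using st small by argo
  qed
  show ?thesis
  proof
    assume D: "D \<in> PD n u"
    then have st: "D \<subseteq> staircase n" by (simp add: PD_def)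
    then have "\<forall>(i, j)\<in>D. 1 \<le> i \<and> 1 \<le> j \<and> i + j \<le> n"
      using PD_no_antidiagonal[OF D u] by (auto simp: staircase_def)
    then show "pipe_dream n u D" using main st D by simp
  next
    assume D: "pipe_dream n u D"
    then have "\<forall>(i, j)\<in>D. 1 \<le> i \<and> 1 \<le> j \<and> i + j \<le> n" by (simp add: pipe_dream_def)
    moreover from this have "D \<subseteq> staircase n" by (force simp: staircase_def)
    ultimately show "D \<in> PD n u" using main D by simp
  qed
qed


subsection \<open>Ladder moves preserve pipe dreams\<close>

lemma positive_cells_pipe_dream: "pipe_dream n u D \<Longrightarrow> positive_cells D"
proof -
  assume D: "pipe_dream n u D"
  then have "D \<subseteq> {1..n} \<times> {1..n}" by (auto simp: pipe_dream_def)
  then have "finite D" by (rule finite_subset) simp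
  then show "positive_cells D" using D by (auto simp: pipe_dream_def positive_cells_def)
qed

text \<open>Here \<open>a\<close> is \<open>s - 1\<close> for the move at \<open>(r, s)\<close>. The
  two pipes of the moved cross descend through columns \<open>a\<close> and \<open>Suc a\<close> to
  row \<open>r + m\<close>, where they touch in \<open>D\<close>. The move makes them cross there
  instead of in row \<open>r\<close>, which exchanges them in between.\<close>

locale ladder_pair =
  fixes D D' :: "cell set" and r a m :: nat
  assumes posD: "positive_cells D" and depth: "inv_ladder_depth D r (Suc a) m"
    and D'_def: "D' = D - {(r, Suc a)} \<union> {(r + m, a)}"
begin

definition \<tau> :: "nat \<Rightarrow> nat" where
  "\<tau> j = (if j = Suc a then a else if j = a then (Suc a) else j)"

lemma dep: "1 \<le> a" "1 \<le> m" "(r, Suc a) \<in> D" "(r, a) \<notin> D"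
  "\<And>i. r < i \<Longrightarrow> i < r + m \<Longrightarrow> (i, a) \<in> D" "\<And>i. r < i \<Longrightarrow> i < r + m \<Longrightarrow> (i, Suc a) \<in> D"
  "(r + m, a) \<notin> D" "(r + m, Suc a) \<notin> D"
proof -
  note d = depth[unfolded inv_ladder_depth_def]
  show "1 \<le> a" "1 \<le> m" "(r, Suc a) \<in> D" "(r, a) \<notin> D" "(r + m, a) \<notin> D" "(r + m, Suc a) \<notin> D"
    using d by auto
  fix i assume "r < i" "i < r + m"
  then have "1 \<le> i - r \<and> i - r < m" "r + (i - r) = i" by auto
  then show "(i, a) \<in> D" "(i, Suc a) \<in> D" using d[THEN conjunct2, THEN conjunct2, THEN conjunct2, THEN conjunct2, THEN conjunct1] by fastforce+
qed

lemma r1: "1 \<le> r"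
  using posD dep(3) by (auto simp: positive_cells_def)

lemma posD': "positive_cells D'"
  using posD dep(1) r1 by (auto simp: positive_cells_def D'_def)

lemma fin: "finite (row D i)" "finite (row D' i)" "0 \<notin> row D i" "0 \<notin> row D' i"
  using positive_cells_row[OF posD] positive_cells_row[OF posD'] by auto

lemma row_other: "i \<noteq> r \<Longrightarrow> i \<noteq> r + m \<Longrightarrow> row D' i = row D i"
  by (auto simp: row_def D'_def)

lemma row_first: "row D' r = row D r - {Suc a}"
  using dep(2) by (auto simp: row_def D'_def)

lemma row_last: "row D' (r + m) = insert a (row D (r + m))"
  using dep(2) by (auto simp: row_def D'_def)

lemma \<tau>_simps [simp]: "\<tau> (Suc a) = a" "\<tau> a = Suc a" "j \<noteq> Suc a \<Longrightarrow> j \<noteq> a \<Longrightarrow> \<tau> j = j"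
  using dep(1) by (auto simp: \<tau>_def)

text \<open>The elbow at \<open>a\<close> hides the new elbow at \<open>Suc a\<close> from all
  columns left of \<open>a\<close>.\<close>

lemma next_elbow_first:
  "next_elbow (row D' r) j = (if j = a then (Suc a) else next_elbow (row D r) j)"
proof (cases "j = a")
  case True
  then have "next_elbow (row D' r) j = Suc a" unfolding next_elbow_eq_iff[OF fin(2)] by (auto simp: row_first)
  then show ?thesis using True by simp
next
  case False
  have "next_elbow (row D r) j \<noteq> Suc a" using next_elbow_props(2)[OF fin(1), of r j] dep(3) by auto
  moreover have "d \<noteq> Suc a" if "j < d" "d < next_elbow (row D r) j" for d
    using that next_elbow_props(3)[OF fin(1), of j "a" r] dep(4) False by auto
  ultimately show ?thesis
    using next_elbow_props(1)[OF fin(1), of j r] next_elbow_props(2)[OF fin(1), of r j]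
      next_elbow_props(3)[OF fin(1), of j _ r] False dep(2)
    by (simp add: next_elbow_eq_iff[OF fin(2)]) (simp add: D'_def)
qed

lemma next_elbow_middle:
  assumes "r < i" "i < r + m"
  shows "next_elbow (row D' i) j = next_elbow (row D i) j" "next_elbow (row D i) j \<noteq> Suc a" "next_elbow (row D i) j \<noteq> a"
  using next_elbow_props(2)[OF fin(1), of i j] dep(5,6) assms by (auto simp: row_other)

lemma next_elbow_middle_eq:
  assumes "r < i" "i < r + m"
  shows "next_elbow (row D i) a = next_elbow (row D i) (Suc a)"
  using next_elbow_pred[OF fin(1), of "Suc a" i] dep(1,6) assms by auto

lemma next_elbow_last:
  "next_elbow (row D' (r + m)) j =
    (if j = a then (Suc a) else if next_elbow (row D (r + m)) j = a then (Suc a) else next_elbow (row D (r + m)) j)"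
proof -
  consider "j = a" | "j \<noteq> a" "next_elbow (row D (r + m)) j = a"
    | "j \<noteq> a" "next_elbow (row D (r + m)) j \<noteq> a"
    by blast
  then show ?thesis
  proof cases
    case 1
    then have "next_elbow (row D' (r + m)) j = Suc a" unfolding next_elbow_eq_iff[OF fin(2)]
      using dep by (auto simp: row_last)
    then show ?thesis using 1 by simp
  next
    case 2
    have *: "d = a \<or> (r + m, d) \<in> D" if "j < d" "d < Suc a" for d
      using that 2(2) next_elbow_props(3)[OF fin(1), of j d "r + m"] by (cases "d = a") auto
    have "next_elbow (row D' (r + m)) j = Suc a" unfolding next_elbow_eq_iff[OF fin(2)]
      using 2(2) dep(7,8) next_elbow_props(1)[OF fin(1), of j "r + m"] * by (auto simp: row_last)
    then show ?thesis using 2 by simp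
  next
    case 3
    then have "next_elbow (row D' (r + m)) j = next_elbow (row D (r + m)) j" unfolding next_elbow_eq_iff[OF fin(2)]
      using next_elbow_props(1)[OF fin(1), of j "r + m"] next_elbow_props(2)[OF fin(1), of "r + m" j]
        next_elbow_props(3)[OF fin(1), of j _ "r + m"] 3 by (auto simp: row_last)
    then show ?thesis using 3 by simp
  qed
qed

lemma next_elbow_last_ne: "j \<noteq> a \<Longrightarrow> next_elbow (row D (r + m)) j \<noteq> Suc a"
  using next_elbow_props(1)[OF fin(1), of j "r + m"] next_elbow_props(3)[OF fin(1), of j a "r + m"] dep(7)
  by auto

text \<open>The factor \<tau> arises in row \<open>r\<close>, conjugates the middle rows and is
  absorbed in row \<open>r + m\<close>. In the composition that defines \<open>top_label\<close>
  these factors cancel in pairs, so labels change only between the two rows.\<close>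

lemma column_above_first: "column_above (row D' r) = column_above (row D r) \<circ> \<tau>"
proof
  fix j
  consider "j = Suc a" | "j = a" | "j \<noteq> Suc a" "j \<noteq> a" by blast
  then show "column_above (row D' r) j = (column_above (row D r) \<circ> \<tau>) j"
  proof cases
    case 1
    have "next_elbow (row D r) a = next_elbow (row D r) (Suc a)" using next_elbow_pred[OF fin(1), of "Suc a" r] dep by auto
    then show ?thesis using 1 dep next_elbow_first[of "Suc a"] by (auto simp: column_above_def row_first)
  qed (use dep next_elbow_first[of j] in \<open>auto simp: column_above_def row_first\<close>)
qed

lemma column_above_middle:
  assumes "r < i" "i < r + m"
  shows "column_above (row D' i) = \<tau> \<circ> column_above (row D i) \<circ> \<tau>"
proof
  fix j
  consider "j = Suc a" | "j = a" | "j \<noteq> Suc a" "j \<noteq> a" by blast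
  then show "column_above (row D' i) j = (\<tau> \<circ> column_above (row D i) \<circ> \<tau>) j"
    by cases (use dep(5,6) next_elbow_middle[of i] assms in \<open>auto simp: column_above_def row_other\<close>)
qed

lemma column_above_last: "column_above (row D' (r + m)) = \<tau> \<circ> column_above (row D (r + m))"
proof
  fix j
  consider "j = Suc a" | "j = a" | "j \<noteq> Suc a" "j \<noteq> a" by blast
  then show "column_above (row D' (r + m)) j = (\<tau> \<circ> column_above (row D (r + m))) j"
  proof cases
    case 1
    have "Suc a < next_elbow (row D (r + m)) (Suc a)" using next_elbow_props(1)[OF fin(1)] .
    then show ?thesis using 1 dep next_elbow_last[of "Suc a"] by (auto simp: column_above_def row_last)
  next
    case 2
    have "next_elbow (row D (r + m)) a = Suc a"
      using next_elbow_pred[OF fin(1), of "Suc a" "r + m"] dep by auto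
    then show ?thesis using 2 dep by (auto simp: column_above_def row_last)
  next
    case 3
    then show ?thesis using dep next_elbow_last[of j] next_elbow_last_ne[of j] by (auto simp: column_above_def row_last)
  qed
qed

lemma \<tau>_invol: "\<tau> \<circ> \<tau> = id"
  using dep(1) by (auto simp: \<tau>_def fun_eq_iff)

lemma top_label_before: "1 \<le> i \<Longrightarrow> i \<le> r \<Longrightarrow> top_label D' i = top_label D i"
proof (induction i rule: dec_induct)
  case (step i)
  then show ?case using row_other[of i] dep(2) by (simp add: top_label_step)
qed simp

lemma top_label_between: "Suc r \<le> i \<Longrightarrow> i \<le> r + m \<Longrightarrow> top_label D' i = top_label D i \<circ> \<tau>"
proof (induction i rule: dec_induct)
  case base
  then show ?case using top_label_before[OF r1] column_above_first r1 by (simp add: top_label_step comp_assoc)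
next
  case (step i)
  then have "top_label D' (Suc i) = (top_label D i \<circ> \<tau>) \<circ> (\<tau> \<circ> column_above (row D i) \<circ> \<tau>)"
    using column_above_middle[of i] r1 by (simp add: top_label_step fun_eq_iff)
  also have "\<dots> = top_label D i \<circ> (\<tau> \<circ> \<tau>) \<circ> column_above (row D i) \<circ> \<tau>" by (simp only: comp_assoc)
  finally show ?case using step r1 by (simp add: \<tau>_invol top_label_step)
qed

lemma top_label_after: "r + m < i \<Longrightarrow> top_label D' i = top_label D i"
proof -
  have "Suc (r + m) \<le> i \<Longrightarrow> top_label D' i = top_label D i"
  proof (induction i rule: dec_induct)
    case base
    have "top_label D' (Suc (r + m)) = (top_label D (r + m) \<circ> \<tau>) \<circ> (\<tau> \<circ> column_above (row D (r + m)))"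
      using column_above_last r1 top_label_between[of "r + m"] dep(2) by (simp add: top_label_step)
    also have "\<dots> = top_label D (r + m) \<circ> (\<tau> \<circ> \<tau>) \<circ> column_above (row D (r + m))" by (simp only: comp_assoc)
    finally show ?case using r1 by (simp add: \<tau>_invol top_label_step)
  next
    case (step i)
    then show ?case using row_other[of i] dep(2) by (simp add: top_label_step)
  qed
  then show "r + m < i \<Longrightarrow> top_label D' i = top_label D i" by simp
qed

text \<open>Matches each cross of \<open>D\<close> with the cross of \<open>D'\<close> where the
  same two pipes meet. In the middle rows the crosses in columns \<open>a\<close> and
  \<open>Suc a\<close> trade places, since their vertical pipes do.\<close>

definition \<sigma> :: "cell \<Rightarrow> cell" where
  "\<sigma> c = (if c = (r, Suc a) then (r + m, a)
     else if r < fst c \<and> fst c < r + m then (fst c, \<tau> (snd c)) else c)"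

text \<open>The two pipes of the cross \<open>(r, Suc a)\<close> run straight down the ladder, one
  directly, the other after turning at the elbow \<open>(r, a)\<close>. So they are the pair that
  the new cross joins.\<close>

lemma column_s: "Suc r \<le> i \<Longrightarrow> i \<le> r + m \<Longrightarrow>
    top_label D i (Suc a) = top_label D r (Suc a) \<and> top_label D i a = right_label D r (Suc a)"
proof (induction i rule: dec_induct)
  case base
  have "next_elbow (row D r) a = next_elbow (row D r) (Suc a)" using next_elbow_pred[OF fin(1), of "Suc a" r] dep by auto
  then show ?case using r1 dep by (simp add: top_label_step column_above_def right_label_def)
next
  case (step i)
  then show ?case using r1 dep(5,6)[of i] by (simp add: top_label_step column_above_def)
qed

text \<open>In a middle row no next elbow lies in column \<open>a\<close> or \<open>Suc a\<close>,
  so \<tau> does not reach the horizontal pipes. In row \<open>r + m\<close> the shift of a next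
  elbow from \<open>a\<close> to \<open>Suc a\<close> is undone by \<tau>.\<close>

lemma right_label_eq:
  assumes "1 \<le> i" "(i, j) \<noteq> (r, a)" "(i, j) \<noteq> (r + m, a)"
  shows "right_label D' i j = right_label D i j"
proof -
  consider "i < r" | "i = r" | "r < i" "i < r + m" | "i = r + m" | "r + m < i" by linarith
  then show ?thesis
  proof cases
    case 1
    then show ?thesis using assms top_label_before[of i] row_other[of i] by (simp add: right_label_def)
  next
    case 2
    then show ?thesis using assms top_label_before[of i] next_elbow_first[of j] by (simp add: right_label_def)
  next
    case 3
    then show ?thesis using top_label_between[of i] next_elbow_middle[of i j] by (simp add: right_label_def)
  next
    case 4
    then show ?thesis using assms top_label_between[of i] dep(2) next_elbow_last[of j] next_elbow_last_ne[of j]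
      by (simp add: right_label_def)
  next
    case 5
    then show ?thesis using top_label_after[of i] row_other[of i] by (simp add: right_label_def)
  qed
qed

lemma crossing_\<sigma>:
  assumes "c \<in> D"
  shows "crossing D' (\<sigma> c) = crossing D c"
proof -
  obtain i j where c: "c = (i, j)" by fastforce
  have i: "1 \<le> i" using assms c posD by (auto simp: positive_cells_def)
  have ne: "(i, j) \<noteq> (r, a)" "(i, j) \<noteq> (r + m, a)" "(i, j) \<noteq> (r + m, Suc a)"
    using assms c dep by auto
  consider "c = (r, Suc a)" | "c \<noteq> (r, Suc a)" "i \<le> r" | "r < i" "i < r + m" | "i = r + m" | "r + m < i"
    by linarith
  then show ?thesis
  proof cases
    case 1
    have "right_label D' (r + m) a = top_label D (r + m) a"
      using next_elbow_last[of "a"] top_label_between[of "r + m"] dep(2) by (simp add: right_label_def)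
    then show ?thesis using 1 column_s[of "r + m"] top_label_between[of "r + m"] dep(2)
      by (simp add: crossing_def \<sigma>_def)
  next
    case 2
    then show ?thesis using c i right_label_eq[OF i ne(1,2)] top_label_before[OF i]
      by (auto simp: crossing_def \<sigma>_def)
  next
    case 3
    have "right_label D' i (\<tau> j) = right_label D i (\<tau> j)" using 3 right_label_eq[OF i, of "\<tau> j"] by simp
    \<comment> \<open>Columns \<open>a\<close> and \<open>Suc a\<close> both hold crosses in this
      row, so the same pipe enters both from the right.\<close>
    also have "\<dots> = right_label D i j"
      using next_elbow_middle_eq[of i] 3 by (cases "j = Suc a \<or> j = a") (auto simp: right_label_def)
    finally show ?thesis using c 3 top_label_between[of i] \<tau>_invol
      by (auto simp: crossing_def \<sigma>_def fun_eq_iff)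
  next
    case 4
    then have "j \<noteq> Suc a" "j \<noteq> a" using ne by auto
    then show ?thesis using c 4 right_label_eq[OF i ne(1,2)] top_label_between[of i] dep(2)
      by (auto simp: crossing_def \<sigma>_def)
  next
    case 5
    then show ?thesis using c right_label_eq[OF i ne(1,2)] top_label_after[of i]
      by (auto simp: crossing_def \<sigma>_def)
  qed
qed

lemma \<tau>_mem_middle: "r < i \<Longrightarrow> i < r + m \<Longrightarrow> (i, \<tau> j) \<in> D \<longleftrightarrow> (i, j) \<in> D"
  using dep(5,6)[of i] by (auto simp: \<tau>_def)

lemma \<sigma>_image: "\<sigma> ` D = D'"
proof
  show "\<sigma> ` D \<subseteq> D'"
    using \<tau>_mem_middle dep(2) by (auto simp: \<sigma>_def D'_def)
  show "D' \<subseteq> \<sigma> ` D"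
  proof
    fix c assume c: "c \<in> D'"
    show "c \<in> \<sigma> ` D"
    proof (cases "c = (r + m, a)")
      case True
      then show ?thesis using dep(3) by (force simp: \<sigma>_def)
    next
      case False
      then have cD: "c \<in> D" "c \<noteq> (r, Suc a)" using c by (auto simp: D'_def)
      show ?thesis
      proof (cases "r < fst c \<and> fst c < r + m")
        case True
        then have "(fst c, \<tau> (snd c)) \<in> D" using cD \<tau>_mem_middle[of "fst c" "snd c"] by simp
        moreover have "\<sigma> (fst c, \<tau> (snd c)) = c" using True \<tau>_invol
          by (auto simp: \<sigma>_def fun_eq_iff)
        ultimately show ?thesis by (metis imageI)
      next
        case False
        then have "\<sigma> c = c" using cD by (auto simp: \<sigma>_def)
        then show ?thesis using cD by (metis imageI)
      qed
    qed
  qed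
qed

lemma card_eq: "card D' = card D"
proof -
  have "(r + m, a) \<notin> D" "(r, Suc a) \<in> D" "finite D" using dep posD by (auto simp: positive_cells_def)
  then have "card (insert (r + m, a) (D - {(r, Suc a)})) = card D"
    by (metis DiffD1 card.remove card_insert_disjoint finite_Diff)
  then show ?thesis by (simp add: D'_def)
qed

lemma \<sigma>_inj: "inj_on \<sigma> D"
  using card_eq \<sigma>_image posD by (metis eq_card_imp_inj_on positive_cells_def)

lemma inj_crossing_iff: "inj_on (crossing D') D' \<longleftrightarrow> inj_on (crossing D) D"
proof -
  have "inj_on (crossing D') D' \<longleftrightarrow> inj_on (crossing D' \<circ> \<sigma>) D"
    using \<sigma>_inj \<sigma>_image comp_inj_on_iff by metis
  also have "\<dots> \<longleftrightarrow> inj_on (crossing D) D"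
    using crossing_\<sigma> by (intro inj_on_cong) simp
  finally show ?thesis .
qed

lemma exit_eq: "1 \<le> i \<Longrightarrow> right_label D' i 0 = right_label D i 0"
  using right_label_eq[of i 0] dep(1) by simp

text \<open>The new cross lies on the antidiagonal of \<open>(r + m - 1, Suc a)\<close>, a cross of
  \<open>D\<close> that for \<open>m = 1\<close> is the removed one.\<close>

lemma bound_iff: "(\<forall>(i, j)\<in>D'. 1 \<le> i \<and> 1 \<le> j \<and> i + j \<le> n) \<longleftrightarrow> (\<forall>(i, j)\<in>D. 1 \<le> i \<and> 1 \<le> j \<and> i + j \<le> n)"
proof -
  have 1: "(\<forall>(i, j)\<in>X. 1 \<le> i \<and> 1 \<le> j \<and> i + j \<le> n) \<longleftrightarrow> (\<forall>(i, j)\<in>X. i + j \<le> n)" if "positive_cells X" for X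
    using that by (auto simp: positive_cells_def)
  have "r + m + a \<le> n" if "\<forall>(i, j)\<in>D. i + j \<le> n"
  proof (cases "m = 1")
    case True
    then show ?thesis using that dep(1,3) by auto
  next
    case False
    then show ?thesis using that dep(1,2) dep(6)[of "r + m - 1"] by fastforce
  qed
  moreover have "r + (Suc a) \<le> n" if "\<forall>(i, j)\<in>D'. i + j \<le> n"
    using that dep(1,2) by (auto simp: D'_def)
  ultimately have "(\<forall>(i, j)\<in>D'. i + j \<le> n) \<longleftrightarrow> (\<forall>(i, j)\<in>D. i + j \<le> n)"
    unfolding D'_def by fastforce
  then show ?thesis unfolding 1[OF posD] 1[OF posD'] .
qed

lemma pipe_dream_iff: "pipe_dream n u D' \<longleftrightarrow> pipe_dream n u D"
  unfolding pipe_dream_def bound_iff inj_crossing_iff using exit_eq by simp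

end


subsection \<open>The left-aligned pipe dream\<close>

definition bottom :: "(nat \<Rightarrow> nat) \<Rightarrow> cell set" where
  "bottom u = {(i, j). 1 \<le> j \<and> j \<le> code u i}"

lemma row_bottom: "row (bottom u) i = {1..code u i}"
  by (auto simp: bottom_def row_def)

text \<open>Counts values instead of positions: the labels below \<open>u i\<close> that have not
  exited before row \<open>i\<close>. They sit at later positions because \<open>u\<close> is a
  permutation fixing 0.\<close>

lemma code_eq_card:
  assumes u: "u permutes {1..n}" and i: "1 \<le> i"
  shows "code u i = card ({1..<u i} - u ` {1..<i})"
proof -
  have "{1..<u i} - u ` {1..<i} = u ` {j. i < j \<and> u j < u i}"
  proof
    show "{1..<u i} - u ` {1..<i} \<subseteq> u ` {j. i < j \<and> u j < u i}"
    proof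
      fix v assume v: "v \<in> {1..<u i} - u ` {1..<i}"
      obtain j where j: "v = u j" using permutes_surj[OF u] by (meson surjD)
      have "j \<noteq> 0" using v j permutes_not_in[OF u, of 0] by (cases "j = 0") auto
      then have "\<not> j < i" using v j by auto
      moreover have "j \<noteq> i" using v j by auto
      ultimately show "v \<in> u ` {j. i < j \<and> u j < u i}" using v j by auto
    qed
    show "u ` {j. i < j \<and> u j < u i} \<subseteq> {1..<u i} - u ` {1..<i}"
    proof
      fix v assume "v \<in> u ` {j. i < j \<and> u j < u i}"
      then obtain j where j: "v = u j" "i < j" "u j < u i" by auto
      have "u j \<noteq> u 0" using j by (simp add: inj_eq[OF permutes_inj[OF u]])
      then have "1 \<le> u j" using permutes_not_in[OF u, of 0] by auto
      moreover have "u j \<notin> u ` {1..<i}" using j inj_image_mem_iff[OF permutes_inj[OF u]] by auto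
      ultimately show "v \<in> {1..<u i} - u ` {1..<i}" using j by auto
    qed
  qed
  moreover have "card (u ` {j. i < j \<and> u j < u i}) = card {j. i < j \<and> u j < u i}"
    using inj_on_subset[OF permutes_inj[OF u] subset_UNIV] by (rule card_image)
  ultimately show ?thesis by (simp add: code_def)
qed

lemma code_outside: "u permutes {1..n} \<Longrightarrow> i = 0 \<or> n < i \<Longrightarrow> code u i = 0"
proof -
  assume u: "u permutes {1..n}" and "i = 0 \<or> n < i"
  then consider "i = 0" | "n < i" by blast
  then have "{j. i < j \<and> u j < u i} = {}"
  proof cases
    case 1
    then show ?thesis using permutes_not_in[OF u, of 0] by auto
  next
    case 2
    then show ?thesis using permutes_not_in[OF u] by auto
  qed
  then show "code u i = 0" by (simp only: code_def card.empty)
qed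

lemma code_bound: 
  assumes u: "u permutes {1..n}" and i: "1 \<le> i" "i \<le> n"
  shows "i + code u i \<le> n"
proof -
  have "{j. i < j \<and> u j < u i} \<subseteq> {i<..n}"
  proof
    fix j assume j: "j \<in> {j. i < j \<and> u j < u i}"
    have "u i \<in> {1..n}" using permutes_in_image[OF u, of i] i by simp
    then show "j \<in> {i<..n}" using j permutes_not_in[OF u, of j] by (cases "j \<le> n") auto
  qed
  then have "card {j. i < j \<and> u j < u i} \<le> card {i<..n}" by (rule card_mono[rotated]) simp
  then show ?thesis using i by (simp add: code_def)
qed

locale left_aligned =
  fixes D :: "cell set" and b :: "nat \<Rightarrow> nat"
  assumes posD: "positive_cells D" and row_eq: "\<And>i. row D i = {1..b i}"
begin

lemma next_elbow_row: "next_elbow (row D i) 0 = Suc (b i)" "j \<in> row D i \<Longrightarrow> next_elbow (row D i) j = Suc (b i)"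
  "j > b i \<Longrightarrow> next_elbow (row D i) j = Suc j"
  unfolding next_elbow_eq_iff[OF positive_cells_row(1)[OF posD]] by (auto simp: row_eq simp del: mem_row)

lemma column_above_row: "1 \<le> j \<Longrightarrow> column_above (row D i) j = (if j \<le> b i then j else Suc j)"
proof -
  assume j: "1 \<le> j"
  then have "j \<in> row D i \<longleftrightarrow> j \<le> b i" unfolding row_eq by simp
  then show ?thesis using next_elbow_row(3)[of i j] by (auto simp: column_above_def)
qed

text \<open>A left-aligned row only takes out the pipe just after its crosses and closes the hole,
  so the remaining labels stay in increasing order.\<close>

lemma top_label_mono:
  assumes "1 \<le> i" "1 \<le> j" "j < j'"
  shows "top_label D i j < top_label D i j'"
  using assms
proof (induction i arbitrary: j j' rule: dec_induct)
  case base
  then show ?case by simp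
next
  case (step i)
  then show ?case by (simp add: top_label_step column_above_row)
qed

text \<open>The columns list the remaining labels in increasing order, so \<open>u i\<close> stands
  right after the \<open>code u i\<close> smaller ones.\<close>

lemma exit_label:
  assumes u: "u permutes {1..n}" and i: "1 \<le> i" "i \<le> n"
    and ex: "\<And>r. 1 \<le> r \<Longrightarrow> r < i \<Longrightarrow> right_label D r 0 = u r"
  shows "top_label D i (Suc (code u i)) = u i"
proof -
  have "(\<lambda>r. right_label D r 0) ` {1..<i} = u ` {1..<i}" using ex by (intro image_cong) auto
  then have im: "top_label D i ` {1..} = {1..} - u ` {1..<i}" using top_label_image[OF posD i(1)] by simp
  have "u i \<notin> u ` {1..<i}" using inj_image_mem_iff[OF permutes_inj[OF u]] by simp
  moreover have "1 \<le> u i" using permutes_in_image[OF u, of i] i by simp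
  ultimately have "u i \<in> top_label D i ` {1..}" unfolding im by simp
  then obtain j where j: "1 \<le> j" "u i = top_label D i j" by auto
  have "{1..<u i} - u ` {1..<i} = top_label D i ` {1..<j}"
  proof -
    have "{1..<u i} - u ` {1..<i} = {v \<in> top_label D i ` {1..}. v < u i}" unfolding im by auto
    also have "\<dots> = top_label D i ` {1..<j}"
    proof
      show "{v \<in> top_label D i ` {1..}. v < u i} \<subseteq> top_label D i ` {1..<j}"
      proof
        fix v assume "v \<in> {v \<in> top_label D i ` {1..}. v < u i}"
        then obtain c where c: "1 \<le> c" "v = top_label D i c" "v < top_label D i j" using j by auto
        have "c < j" using c j top_label_mono[OF i(1) j(1), of c] by (cases "c < j \<or> c = j") auto
        then show "v \<in> top_label D i ` {1..<j}" using c by auto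
      qed
    qed (use j top_label_mono[OF i(1)] in auto)
    finally show ?thesis .
  qed
  then have "code u i = card (top_label D i ` {1..<j})" using code_eq_card[OF u i(1)] by simp
  also have "\<dots> = j - 1" using inj_on_subset[OF inj_top_label[OF posD i(1)] subset_UNIV] by (simp add: card_image)
  finally show ?thesis using j by simp
qed

lemma exit_eq: "right_label D i 0 = top_label D i (Suc (b i))"
  by (simp add: right_label_def next_elbow_row)

text \<open>All crosses of a left-aligned row involve the pipe that exits in that row. It does not
  occur in lower rows, which separates the rows; within a row the top labels differ.\<close>

lemma inj_crossing_aligned: "inj_on (crossing D) D"
proof -
  have less: "crossing D (i, j) \<noteq> crossing D (i', j')"
    if "(i, j) \<in> D" "(i', j') \<in> D" "i < i'" for i j i' j'
  proof -
    have pos: "1 \<le> i" "1 \<le> j'" using that posD by (auto simp: positive_cells_def)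
    have "j \<in> row D i" using that by simp
    then have "right_label D i j = right_label D i 0" by (simp add: right_label_def next_elbow_row)
    moreover have "top_label D i' j' \<noteq> right_label D i 0" using top_label_not_exit[OF posD] that pos by simp
    moreover have "right_label D i' j' \<noteq> right_label D i 0"
      unfolding right_label_def[of D i' j']
      using top_label_not_exit[OF posD pos(1) that(3)] next_elbow_props(1)[OF positive_cells_row(1)[OF posD], of j' i'] by simp
    ultimately show ?thesis unfolding crossing_def fst_conv snd_conv by (metis insert_iff singletonD)
  qed
  show ?thesis
  proof (rule inj_onI)
    fix c c' assume c: "c \<in> D" "c' \<in> D" "crossing D c = crossing D c'"
    obtain i j i' j' where ij: "c = (i, j)" "c' = (i', j')" by fastforce
    have "i = i'" using less c ij by (metis linorder_neqE_nat)
    moreover have "j \<in> row D i" "j' \<in> row D i'" "1 \<le> i" using c ij posD by (auto simp: positive_cells_def)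
    ultimately have "{top_label D i j, right_label D i 0} = {top_label D i j', right_label D i 0}"
      using c ij by (simp add: crossing_def right_label_def next_elbow_row)
    then have "top_label D i j = top_label D i j'" by (auto simp: doubleton_eq_iff)
    then show "c = c'" using top_label_eq_iff[OF posD \<open>1 \<le> i\<close>] ij \<open>i = i'\<close> by simp
  qed
qed

text \<open>The pipe exiting in row \<open>i\<close> enters it in column \<open>Suc (b i)\<close> by
  alignment and in column \<open>Suc (code u i)\<close> by \<open>exit_label\<close>.\<close>

lemma pipe_dream_imp_bottom:
  assumes u: "u permutes {1..n}" and D: "pipe_dream n u D"
  shows "D = bottom u"
proof -
  have "b i = code u i" for i
  proof (cases "1 \<le> i \<and> i \<le> n")
    case True
    then have "right_label D r 0 = u r" if "1 \<le> r" "r \<le> i" for r using D that by (auto simp: pipe_dream_def)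
    then have "top_label D i (Suc (code u i)) = top_label D i (Suc (b i))"
      using True exit_label[OF u, of i] exit_eq[of i] by simp
    then show ?thesis using top_label_eq_iff[OF posD] True by simp
  next
    case False
    then have "b i \<notin> row D i" using D by (auto simp: pipe_dream_def)
    then have "b i = 0" unfolding row_eq by simp
    then show ?thesis using False code_outside[OF u, of i] by (simp add: not_le)
  qed
  then have "row D i = row (bottom u) i" for i by (simp add: row_eq row_bottom)
  then show ?thesis by (auto simp: set_eq_iff simp flip: mem_row)
qed

end

lemma pipe_dream_bottom:
  assumes u: "u permutes {1..n}"
  shows "pipe_dream n u (bottom u)"
proof -
  have small: "1 \<le> i \<and> 1 \<le> j \<and> i + j \<le> n" if "(i, j) \<in> bottom u" for i j
  proof -
    have j: "1 \<le> j" "j \<le> code u i" using that by (auto simp: bottom_def)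
    then have "1 \<le> i" "i \<le> n" using code_outside[OF u, of i] by (auto intro: gr0I simp: Suc_le_eq not_less[symmetric])
    then show ?thesis using j code_bound[OF u, of i] by simp
  qed
  then have "bottom u \<subseteq> {1..n} \<times> {1..n}" by fastforce
  then have "finite (bottom u)" by (rule finite_subset) simp
  then interpret left_aligned "bottom u" "code u"
    using small by unfold_locales (auto simp: positive_cells_def row_bottom)
  have "1 \<le> i \<Longrightarrow> i \<le> n \<Longrightarrow> right_label (bottom u) i 0 = u i" for i
  proof (induction i rule: less_induct)
    case (less i)
    then show ?case using exit_label[OF u, of i] exit_eq[of i] by simp
  qed
  then show ?thesis using small inj_crossing_aligned by (auto simp: pipe_dream_def)
qed


subsection \<open>Rounds of the encoding\<close>

definition patch :: "nat \<Rightarrow> nat \<Rightarrow> nat \<Rightarrow> cell set" where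
  "patch i a w = {(r, c). r = i \<and> a < c \<and> c \<le> a + w}"

lemma mem_patch [simp]: "(r, c) \<in> patch i a w \<longleftrightarrow> r = i \<and> a < c \<and> c \<le> a + w"
  by (simp add: patch_def)

lemma finite_patch [simp]: "finite (patch i a w)"
proof -
  have "patch i a w = {i} \<times> {a<..a + w}" by (auto simp: patch_def)
  then show ?thesis by simp
qed

lemma card_patch [simp]: "card (patch i a w) = w"
proof -
  have "patch i a w = {i} \<times> {a<..a + w}" by (auto simp: patch_def)
  then show ?thesis by (simp add: card_cartesian_product_singleton)
qed

lemma patch_Suc: "patch i a (Suc w) = insert (i, Suc a) (patch i (Suc a) w)"
  by (auto simp: patch_def)

lemma patch_0 [simp]: "patch i a 0 = {}"
  by (auto simp: patch_def)

text \<open>The crosses are moved from left to right: each move vacates the cell that must be an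
  elbow for the next one, and the hypotheses on the rows give all moves the same depth. This is why
  the induction shifts \<open>a\<close>.\<close>

lemma inv_ladder_moves_patch:
  assumes "positive_cells E" "(i, Suc a) \<notin> E" "patch i (Suc a) w \<subseteq> E" "1 \<le> m"
    and "\<And>r c. i < r \<Longrightarrow> r < i + m \<Longrightarrow> Suc a \<le> c \<Longrightarrow> c \<le> Suc a + w \<Longrightarrow> (r, c) \<in> E"
    and "\<And>c. Suc a \<le> c \<Longrightarrow> c \<le> Suc a + w \<Longrightarrow> (i + m, c) \<notin> E"
    and "\<And>c. c \<in> patch i (Suc a) w \<Longrightarrow> h c = (i0, ks)"
  shows "\<exists>h'. inv_ladder_moves i [Suc a + 1..<Suc a + w + 1] (E, h)
      (E - patch i (Suc a) w \<union> patch (i + m) a w, h') \<and>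
    (\<forall>c. c \<notin> patch (i + m) a w \<longrightarrow> h' c = h c) \<and>
    (\<forall>c\<in>patch (i + m) a w. h' c = (i0, ks @ [m])) \<and>
    (pipe_dream n u (E - patch i (Suc a) w \<union> patch (i + m) a w) \<longleftrightarrow> pipe_dream n u E)"
  using assms
proof (induction w arbitrary: E h a)
  case 0
  then show ?case by auto
next
  case (Suc w)
  let ?E = "E - {(i, Suc (Suc a))} \<union> {(i + m, Suc a)}"
  let ?h = "h((i + m, Suc a) := (i0, ks @ [m]))"
  have depth: "inv_ladder_depth E i (Suc (Suc a)) m"
    using Suc.prems by (auto simp: inv_ladder_depth_def)
  have hs: "h (i, Suc (Suc a)) = (i0, ks)" using Suc.prems(7) by simp
  interpret ladder_pair E ?E i "Suc a" m
    using depth Suc.prems(1) by unfold_locales auto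
  have move: "inv_ladder_move i (Suc (Suc a)) (E, h) (?E, ?h)"
    unfolding inv_ladder_move_def prod.case by (rule exI[of _ m]) (simp add: depth hs)
  have "\<exists>h'. inv_ladder_moves i [Suc (Suc a) + 1..<Suc (Suc a) + w + 1] (?E, ?h)
      (?E - patch i (Suc (Suc a)) w \<union> patch (i + m) (Suc a) w, h') \<and>
    (\<forall>c. c \<notin> patch (i + m) (Suc a) w \<longrightarrow> h' c = ?h c) \<and>
    (\<forall>c\<in>patch (i + m) (Suc a) w. h' c = (i0, ks @ [m])) \<and>
    (pipe_dream n u (?E - patch i (Suc (Suc a)) w \<union> patch (i + m) (Suc a) w) \<longleftrightarrow> pipe_dream n u ?E)"
  proof (rule Suc.IH)
    show "positive_cells ?E" by (rule posD')
    show "(i, Suc (Suc a)) \<notin> ?E" using Suc.prems(4) by simp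
    show "patch i (Suc (Suc a)) w \<subseteq> ?E" using Suc.prems(3) by (auto simp: patch_Suc)
    show "1 \<le> m" by (rule Suc.prems(4))
    show "(r, c) \<in> ?E" if "i < r" "r < i + m" "Suc (Suc a) \<le> c" "c \<le> Suc (Suc a) + w" for r c
      using Suc.prems(5)[of r c] that by simp
    show "(i + m, c) \<notin> ?E" if "Suc (Suc a) \<le> c" "c \<le> Suc (Suc a) + w" for c
      using Suc.prems(6)[of c] that by simp
    show "?h c = (i0, ks)" if "c \<in> patch i (Suc (Suc a)) w" for c
      using Suc.prems(7)[of c] Suc.prems(4) that by (auto simp: patch_Suc)
  qed
  then obtain h' where h': "inv_ladder_moves i [Suc (Suc a) + 1..<Suc (Suc a) + w + 1] (?E, ?h)
      (?E - patch i (Suc (Suc a)) w \<union> patch (i + m) (Suc a) w, h')"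
    "\<And>c. c \<notin> patch (i + m) (Suc a) w \<Longrightarrow> h' c = ?h c"
    "\<And>c. c \<in> patch (i + m) (Suc a) w \<Longrightarrow> h' c = (i0, ks @ [m])"
    "pipe_dream n u (?E - patch i (Suc (Suc a)) w \<union> patch (i + m) (Suc a) w) \<longleftrightarrow> pipe_dream n u ?E"
    by blast
  have eq: "E - patch i (Suc a) (Suc w) \<union> patch (i + m) a (Suc w) =
      ?E - patch i (Suc (Suc a)) w \<union> patch (i + m) (Suc a) w"
    using Suc.prems(4) by (auto simp: patch_def)
  have upt: "[Suc a + 1..<Suc a + Suc w + 1] = Suc (Suc a) # [Suc (Suc a) + 1..<Suc (Suc a) + w + 1]"
    by (simp add: upt_rec)
  have "inv_ladder_moves i [Suc a + 1..<Suc a + Suc w + 1] (E, h)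
      (E - patch i (Suc a) (Suc w) \<union> patch (i + m) a (Suc w), h')"
    unfolding eq upt inv_ladder_moves.simps(2) using move h'(1) by (intro exI conjI)
  moreover have "h' c = h c" if "c \<notin> patch (i + m) a (Suc w)" for c
    using h'(2)[of c] that by (auto simp: patch_Suc)
  moreover have "h' c = (i0, ks @ [m])" if "c \<in> patch (i + m) a (Suc w)" for c
    using h'(2,3)[of c] that by (auto simp: patch_Suc)
  moreover have "pipe_dream n u (E - patch i (Suc a) (Suc w) \<union> patch (i + m) a (Suc w)) \<longleftrightarrow> pipe_dream n u E"
    unfolding eq h'(4) by (rule pipe_dream_iff)
  ultimately show ?case by blast
qed

text \<open>The patch that the next round moves. The elbow before it is in column
  \<open>Suc a\<close>, so that the landing columns start at \<open>a + 1\<close> and always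
  exist.\<close>

definition last_patch :: "cell set \<Rightarrow> (nat \<Rightarrow> nat) \<Rightarrow> nat \<Rightarrow> nat \<Rightarrow> nat \<Rightarrow> bool" where
  "last_patch D f i a w \<longleftrightarrow> 1 \<le> w \<and> (i, Suc a) \<notin> D \<and> patch i (Suc a) w \<subseteq> D \<and>
     (\<forall>c. Suc a + w < c \<longrightarrow> (i, c) \<notin> D) \<and> (\<forall>r>i. row D r = {1..f r})"

lemma last_patch_gap:
  assumes "last_patch D f i a w"
  shows "gap D i (Suc a)" "gap D i' j' \<Longrightarrow> i' \<le> i" "gap D i j' \<Longrightarrow> j' \<le> Suc a"
proof -
  note l = assms[unfolded last_patch_def]
  show "gap D i (Suc a)" using l by (auto simp: gap_def)
  show "i' \<le> i" if "gap D i' j'"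
  proof (rule ccontr)
    assume "\<not> i' \<le> i"
    then have "row D i' = {1..f i'}" using l by simp
    moreover have "Suc j' \<in> row D i'" "j' \<notin> row D i'" "1 \<le> j'" using that by (auto simp: gap_def)
    ultimately show False by simp
  qed
  show "j' \<le> Suc a" if "gap D i j'"
  proof (rule ccontr)
    assume n: "\<not> j' \<le> Suc a"
    have g: "(i, j' + 1) \<in> D" "(i, j') \<notin> D" using that by (auto simp: gap_def)
    then have "j' + 1 \<le> Suc a + w" using l by (meson not_le)
    then have "(i, j') \<in> patch i (Suc a) w" using n by simp
    then show False using g l by blast
  qed
qed

text \<open>The bound on \<open>f (i + m)\<close> frees every landing cell at once; this keeps the
  patch in one piece.\<close>

lemma encoding_round_patch:
  assumes E: "positive_cells E" and l: "last_patch E f i a w" and m: "1 \<le> m"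
    and mid: "\<And>r. i < r \<Longrightarrow> r < i + m \<Longrightarrow> Suc a + w \<le> f r" and last: "f (i + m) \<le> a"
    and h: "\<And>c. c \<in> patch i (Suc a) w \<Longrightarrow> h c = (i0, ks)"
  shows "\<exists>h'. encoding_round (E, h) (E - patch i (Suc a) w \<union> patch (i + m) a w, h') \<and>
    (\<forall>c. c \<notin> patch (i + m) a w \<longrightarrow> h' c = h c) \<and>
    (\<forall>c\<in>patch (i + m) a w. h' c = (i0, ks @ [m])) \<and>
    (pipe_dream n u (E - patch i (Suc a) w \<union> patch (i + m) a w) \<longleftrightarrow> pipe_dream n u E)"
proof -
  note lp = l[unfolded last_patch_def]
  have rows: "(r, c) \<in> E \<longleftrightarrow> 1 \<le> c \<and> c \<le> f r" if "i < r" for r c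
  proof -
    have "row E r = {1..f r}" using lp that by simp
    then have "c \<in> row E r \<longleftrightarrow> 1 \<le> c \<and> c \<le> f r" by (simp del: mem_row)
    then show ?thesis by simp
  qed
  have moves: "\<exists>h'. inv_ladder_moves i [Suc a + 1..<Suc a + w + 1] (E, h)
      (E - patch i (Suc a) w \<union> patch (i + m) a w, h') \<and>
    (\<forall>c. c \<notin> patch (i + m) a w \<longrightarrow> h' c = h c) \<and>
    (\<forall>c\<in>patch (i + m) a w. h' c = (i0, ks @ [m])) \<and>
    (pipe_dream n u (E - patch i (Suc a) w \<union> patch (i + m) a w) \<longleftrightarrow> pipe_dream n u E)"
  proof (rule inv_ladder_moves_patch[OF E _ _ m])
    show "(r, c) \<in> E" if "i < r" "r < i + m" "Suc a \<le> c" "c \<le> Suc a + w" for r c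
      using rows[of r c] mid[of r] that by simp
    show "(i + m, c) \<notin> E" if "Suc a \<le> c" "c \<le> Suc a + w" for c
      using rows[of "i + m" c] last m that by simp
  qed (use lp h in auto)
  have least: "(LEAST k. Suc a < k \<and> (i, k + 1) \<notin> E) = Suc a + w"
  proof (rule Least_equality)
    show "Suc a < Suc a + w \<and> (i, Suc a + w + 1) \<notin> E" using lp by auto
    show "Suc a + w \<le> k" if k: "Suc a < k \<and> (i, k + 1) \<notin> E" for k
    proof (rule ccontr)
      assume "\<not> Suc a + w \<le> k"
      then have "(i, k + 1) \<in> patch i (Suc a) w" using k by simp
      then show False using k lp by blast
    qed
  qed
  have round: "encoding_round (E, h) S" if "inv_ladder_moves i [Suc a + 1..<Suc a + w + 1] (E, h) S" for S
    unfolding encoding_round_def fst_conv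
  proof (intro exI conjI allI impI)
    show "Suc a + w = (LEAST k. Suc a < k \<and> (i, k + 1) \<notin> E)" using least by simp
  qed (use last_patch_gap[OF l] that in auto)
  show ?thesis using moves round by blast
qed

lemma row_no_gap:
  assumes D: "positive_cells D" and g: "\<And>j. \<not> gap D r j"
  shows "row D r = {1..Max (insert 0 (row D r))}"
proof -
  let ?M = "Max (insert 0 (row D r))"
  have fin: "finite (insert 0 (row D r))" using positive_cells_row(1)[OF D] by simp
  have down: "(r, c - d) \<in> D" if "(r, c) \<in> D" "d < c" for c d
    using that(2)
  proof (induction d)
    case (Suc d)
    then have "\<not> gap D r (c - Suc d)" "(r, c - Suc d + 1) \<in> D" "1 \<le> c - Suc d" using g by (auto simp: Suc_diff_Suc)
    then show ?case by (auto simp: gap_def)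
  qed (use that in simp)
  show ?thesis
  proof
    have "1 \<le> c \<and> c \<le> ?M" if "c \<in> row D r" for c using that D Max_ge[OF fin, of c] by (auto simp: positive_cells_def)
    then show "row D r \<subseteq> {1..?M}" by auto
    show "{1..?M} \<subseteq> row D r"
    proof
      fix c assume c: "c \<in> {1..?M}"
      have "?M \<in> insert 0 (row D r)" using Max_in[OF fin] by blast
      then have "(r, ?M) \<in> D" using c by auto
      then have "(r, ?M - (?M - c)) \<in> D" using c by (intro down) auto
      moreover have "?M - (?M - c) = c" using c by simp
      ultimately show "c \<in> row D r" by simp
    qed
  qed
qed

lemma last_patch_exists:
  assumes D: "positive_cells D" and g: "gap D i0 j0"
  shows "\<exists>f i a w. last_patch D f i a w"
proof -
  have fin: "finite D" using D by (simp add: positive_cells_def)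
  have "finite {i. \<exists>j. gap D i j}"
    by (rule finite_subset[of _ "fst ` D"]) (use fin in \<open>force simp: gap_def\<close>)+
  then obtain i where i: "\<exists>j. gap D i j" "\<And>i'. \<exists>j. gap D i' j \<Longrightarrow> i' \<le> i"
    using Max_in[of "{i. \<exists>j. gap D i j}"] Max_ge[of "{i. \<exists>j. gap D i j}"] g by blast
  have "finite {j. gap D i j}"
    by (rule finite_subset[of _ "(\<lambda>c. c - 1) ` row D i"])
      (use positive_cells_row(1)[OF D] in \<open>force simp: gap_def\<close>)+
  then obtain j where j: "gap D i j" "\<And>j'. gap D i j' \<Longrightarrow> j' \<le> j"
    using Max_in[of "{j. gap D i j}"] Max_ge[of "{j. gap D i j}"] i(1) by blast
  have fr: "finite (row D i)" using positive_cells_row(1)[OF D] .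
  define k where "k = Max (row D i)"
  have jr: "Suc j \<in> row D i" "1 \<le> j" "(i, j) \<notin> D" using j(1) by (auto simp: gap_def)
  then have "row D i \<noteq> {}" by blast
  from Max_in[OF fr this] have "k \<in> row D i" unfolding k_def .
  then have k: "(i, k) \<in> D" "Suc j \<le> k" "\<And>c. (i, c) \<in> D \<Longrightarrow> c \<le> k"
    using Max_ge[OF fr] jr(1) unfolding k_def by simp_all
  have down: "(i, k - d) \<in> D" if "j < k - d" for d
    using that
  proof (induction d)
    case (Suc d)
    then have "(i, k - Suc d + 1) \<in> D" "1 \<le> k - Suc d" by (auto simp: Suc_diff_Suc)
    moreover have "\<not> gap D i (k - Suc d)" using j(2)[of "k - Suc d"] Suc.prems by auto
    ultimately show ?case by (auto simp: gap_def)
  qed (use k in simp)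
  have "last_patch D (\<lambda>r. Max (insert 0 (row D r))) i (j - 1) (k - j)"
    unfolding last_patch_def
  proof (intro conjI allI impI)
    show "1 \<le> k - j" using k by simp
    show "(i, Suc (j - 1)) \<notin> D" using jr by simp
    show "patch i (Suc (j - 1)) (k - j) \<subseteq> D"
    proof
      fix c assume "c \<in> patch i (Suc (j - 1)) (k - j)"
      then obtain d where d: "c = (i, d)" "j < d" "d \<le> k" using jr k by (cases c) auto
      then show "c \<in> D" using down[of "k - d"] by simp
    qed
    show "(i, c) \<notin> D" if "Suc (j - 1) + (k - j) < c" for c using that k jr by fastforce
    show "row D r = {1..Max (insert 0 (row D r))}" if "i < r" for r
      using row_no_gap[OF D, of r] i(2)[of r] that by (meson not_le)
  qed
  then show ?thesis by blast
qed

text \<open>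
  Let \<open>i + m\<close> be the first row below row \<open>i\<close> that is shorter than \<open>Suc a + w\<close>. If it reached column
  \<open>Suc a\<close>, then the pipe turning down at \<open>(i, Suc a)\<close> and the pipe descending through column
  \<open>Suc (f (i + m))\<close> would cross in row \<open>i\<close> and again in row \<open>i + m\<close>.
\<close>

lemma last_patch_depth:
  assumes D: "pipe_dream n u D" and l: "last_patch D f i a w"
  shows "\<exists>m\<ge>1. (\<forall>r. i < r \<and> r < i + m \<longrightarrow> Suc a + w \<le> f r) \<and> f (i + m) \<le> a"
proof -
  have pos: "positive_cells D" using positive_cells_pipe_dream[OF D] .
  note lp = l[unfolded last_patch_def]
  have rows: "(r, c) \<in> D \<longleftrightarrow> 1 \<le> c \<and> c \<le> f r" if "i < r" for r c
  proof -
    have "row D r = {1..f r}" using lp that by simp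
    then have "c \<in> row D r \<longleftrightarrow> 1 \<le> c \<and> c \<le> f r" by (simp del: mem_row)
    then show ?thesis by simp
  qed
  have ip: "(i, Suc a + w) \<in> patch i (Suc a) w" using lp by simp
  then have "(i, Suc a + w) \<in> D" using lp by blast
  then have i1: "1 \<le> i" using pos by (auto simp: positive_cells_def)
  \<comment> \<open>Row \<open>i + Suc n\<close> is off the board and hence empty, so some lower row
    is shorter than the patch reaches.\<close>
  have "\<not> f (i + Suc n) \<ge> 1"
    using rows[of "i + Suc n" 1] D by (auto simp: pipe_dream_def)
  then have ex: "1 \<le> Suc n \<and> f (i + Suc n) < Suc a + w" by simp
  define m where "m = (LEAST m. 1 \<le> m \<and> f (i + m) < Suc a + w)"
  have m: "1 \<le> m" "f (i + m) < Suc a + w"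
    using LeastI[where P = "\<lambda>m. 1 \<le> m \<and> f (i + m) < Suc a + w", OF ex] by (auto simp: m_def)
  have mid: "Suc a + w \<le> f r" if "i < r" "r < i + m" for r
  proof (rule ccontr)
    assume "\<not> Suc a + w \<le> f r"
    then have "1 \<le> r - i \<and> f (i + (r - i)) < Suc a + w" using that by simp
    then have "m \<le> r - i" unfolding m_def by (rule Least_le)
    then show False using that by simp
  qed
  have "f (i + m) \<le> a"
  proof (rule ccontr)
    assume "\<not> f (i + m) \<le> a"
    define s where "s = Suc (f (i + m))"
    have s: "Suc a < s" "s \<le> Suc a + w" using m \<open>\<not> f (i + m) \<le> a\<close> by (auto simp: s_def)
    have sD: "(i, c) \<in> D" if "Suc a < c" "c \<le> Suc a + w" for c
      using that lp by (meson mem_patch subsetD)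
    have nx: "next_elbow (row D i) c = Suc (Suc a + w)" if "Suc a \<le> c" "c \<le> Suc a + w" for c
      unfolding next_elbow_eq_iff[OF positive_cells_row(1)[OF pos]] using that sD lp by auto
    \<comment> \<open>The rows between reach beyond both columns, so the two pipes descend straight:
      one through \<open>s\<close>, the other through \<open>Suc a\<close> after coming from the
      right along the whole patch.\<close>
    have down: "Suc i \<le> r \<Longrightarrow> r \<le> i + m \<Longrightarrow>
        top_label D r s = top_label D i s \<and> top_label D r (Suc a) = top_label D i (Suc (Suc a + w))" for r
    proof (induction r rule: dec_induct)
      case base
      have "(i, Suc a) \<notin> D" "(i, s) \<in> D" using lp sD[OF s] by auto
      then show ?case using i1 nx[of "Suc a"] by (simp add: top_label_step column_above_def)
    next
      case (step r)
      then have "(r, s) \<in> D" "(r, Suc a) \<in> D" using rows[of r] mid[of r] s by auto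
      then show ?case using step i1 by (simp add: top_label_step column_above_def)
    qed
    have c1: "(i, s) \<in> D" "(i + m, Suc a) \<in> D" using sD[OF s] rows[of "i + m"] m s by (auto simp: s_def)
    have "next_elbow (row D (i + m)) (Suc a) = s"
      unfolding next_elbow_eq_iff[OF positive_cells_row(1)[OF pos]] using rows[of "i + m"] m s by (auto simp: s_def)
    then have "crossing D (i + m, Suc a) = crossing D (i, s)"
      using down[of "i + m"] m nx[of s] s by (auto simp: crossing_def right_label_def)
    then have "(i + m, Suc a) = (i, s)" using D c1 unfolding pipe_dream_def by (meson inj_onD)
    then show False using m by simp
  qed
  then show ?thesis using m mid by blast
qed


subsection \<open>Runs of patch moves\<close>

text \<open>
  \<open>path f w r ks a\<close>: the patch in columns \<open>a + 1, \<dots>, a + w\<close> of row \<open>r\<close> descends by the entries of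
  \<open>ks\<close> when row \<open>r'\<close> has length \<open>f r'\<close>; for the last row, \<open>f\<close> includes the patch.
\<close>

fun path :: "(nat \<Rightarrow> nat) \<Rightarrow> nat \<Rightarrow> nat \<Rightarrow> nat list \<Rightarrow> nat \<Rightarrow> bool" where
  "path f w r [] a \<longleftrightarrow> f r = a + w"
| "path f w r (m # ks) a \<longleftrightarrow> f r < a \<and> 1 \<le> m \<and> (\<forall>q. 1 \<le> q \<and> q < m \<longrightarrow> a + w \<le> f (r + q)) \<and>
     path f w (r + m) ks (a - 1)"

text \<open>Each move costs one column, and \<open>f r < a\<close> ensures that there is one to
  give.\<close>

lemma path_end: "path f w r ks a \<Longrightarrow> f (r + sum_list ks) + length ks = a + w \<and> length ks \<le> a"
proof (induction ks arbitrary: r a)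
  case (Cons m ks)
  then have "f (r + m + sum_list ks) + length ks = a - 1 + w \<and> length ks \<le> a - 1" "0 < a" by auto
  then show ?case by (auto simp: add.assoc)
qed auto

lemma path_pos: "path f w r ks a \<Longrightarrow> k \<in> set ks \<Longrightarrow> 1 \<le> k"
  by (induction ks arbitrary: r a) auto

lemma path_cong: "(\<And>r'. r \<le> r' \<Longrightarrow> f r' = g r') \<Longrightarrow> path f w r ks a \<longleftrightarrow> path g w r ks a"
proof (induction ks arbitrary: r a)
  case (Cons m ks)
  have "path f w (r + m) ks (a - 1) \<longleftrightarrow> path g w (r + m) ks (a - 1)"
    by (rule Cons.IH) (use Cons.prems in auto)
  then show ?case using Cons.prems by auto
qed auto

text \<open>
  A run lists the indices and sizes of the patches in the order in which they are moved. After the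
  moves preceding \<open>L\<close>, \<open>rowlen u L j\<close> is the length of a left-aligned row \<open>j\<close>, and \<open>lastcol u L i\<close>
  is the last column occupied in a row \<open>i\<close> in which the moves of \<open>L\<close> may start. For the tail \<open>L\<close>
  following a patch with index \<open>I\<close> in row \<open>i\<close>, \<open>profile u L i\<close> is \<open>c_seq\<close> at \<open>I\<close>.
\<close>

type_synonym run = "(index \<times> nat) list"

definition landed :: "run \<Rightarrow> nat \<Rightarrow> nat" where
  "landed L j = (\<Sum>(I, w)\<leftarrow>L. if index_size I = j then w else 0)"

definition rowlen :: "(nat \<Rightarrow> nat) \<Rightarrow> run \<Rightarrow> nat \<Rightarrow> nat" where
  "rowlen u L j = code u j - landed L j"

fun lastcol :: "(nat \<Rightarrow> nat) \<Rightarrow> run \<Rightarrow> nat \<Rightarrow> nat" where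
  "lastcol u [] i = rowlen u [] i"
| "lastcol u ((I, w) # L) i =
    (if fst I = i then rowlen u L (index_size I) + length (snd I) else rowlen u ((I, w) # L) i)"

text \<open>The column of the elbow before the patch at its start. The patch ends up as the last
  \<open>w\<close> cells of row \<open>index_size I\<close> and has lost one column per move; adding
  \<open>length (snd I)\<close> undoes this.\<close>

definition startcol :: "(nat \<Rightarrow> nat) \<Rightarrow> index \<Rightarrow> nat \<Rightarrow> run \<Rightarrow> nat" where
  "startcol u I w L = rowlen u L (index_size I) + length (snd I) - w"

definition profile :: "(nat \<Rightarrow> nat) \<Rightarrow> run \<Rightarrow> nat \<Rightarrow> nat \<Rightarrow> nat" where
  "profile u L i = (rowlen u L)(i := lastcol u L i)"

text \<open>Only the starting rows are ordered explicitly. The order of patches starting in the same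
  row follows from the path condition, see \<open>step_ok_ladder_less\<close>.\<close>

definition step_ok :: "(nat \<Rightarrow> nat) \<Rightarrow> index \<Rightarrow> nat \<Rightarrow> run \<Rightarrow> bool" where
  "step_ok u I w L \<longleftrightarrow> 1 \<le> fst I \<and> 1 \<le> w \<and> snd I \<noteq> [] \<and> (\<forall>J\<in>fst ` set L. fst J \<le> fst I) \<and>
     path (profile u L (fst I)) w (fst I) (snd I) (startcol u I w L)"

fun valid :: "(nat \<Rightarrow> nat) \<Rightarrow> run \<Rightarrow> bool" where
  "valid u [] \<longleftrightarrow> True"
| "valid u ((I, w) # L) \<longleftrightarrow> step_ok u I w L \<and> valid u L"

text \<open>Decoding. The head is the patch moved first and is therefore put back last.\<close>

fun diagram :: "(nat \<Rightarrow> nat) \<Rightarrow> run \<Rightarrow> cell set" where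
  "diagram u [] = bottom u"
| "diagram u ((I, w) # L) =
     diagram u L - patch (index_size I) (rowlen u L (index_size I) - w) w
       \<union> patch (fst I) (startcol u I w L) w"

lemma rowlen_Cons: "rowlen u ((I, w) # L) j = rowlen u L j - (if index_size I = j then w else 0)"
  by (simp add: rowlen_def landed_def)

lemma step_okD:
  assumes "step_ok u I w L"
  defines "b \<equiv> rowlen u L (index_size I)"
  shows "fst I < index_size I" "w \<le> b" "startcol u I w L + w = b + length (snd I)"
    "length (snd I) \<le> startcol u I w L" "startcol u I w L - length (snd I) = b - w"
    "lastcol u L (fst I) < startcol u I w L" "\<forall>k\<in>set (snd I). 1 \<le> k"
proof -
  note s = assms(1)[unfolded step_ok_def]
  let ?a = "startcol u I w L"
  have p: "path (profile u L (fst I)) w (fst I) (snd I) ?a" using s by blast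
  show pos: "\<forall>k\<in>set (snd I). 1 \<le> k" using path_pos[OF p] by blast
  obtain k ks where ks: "snd I = k # ks" using s by (cases "snd I") auto
  then show lt: "fst I < index_size I" using pos by (auto simp: index_size_def)
  have "profile u L (fst I) (index_size I) = b" using lt by (simp add: profile_def b_def)
  then have "b + length (snd I) = ?a + w \<and> length (snd I) \<le> ?a"
    using path_end[OF p] unfolding index_size_def[symmetric] by simp
  then show "w \<le> b" "?a + w = b + length (snd I)" "length (snd I) \<le> ?a" "?a - length (snd I) = b - w"
    by auto
  show "lastcol u L (fst I) < ?a" using s ks by (auto simp: profile_def)
qed

lemma step_ok_le: "step_ok u I w L \<Longrightarrow> J \<in> fst ` set L \<Longrightarrow> fst J \<le> fst I"
  unfolding step_ok_def by blast

section \<open>The shape of the diagram of a run\<close>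

lemma run_induct [case_names Nil Cons]:
  fixes P :: "run \<Rightarrow> bool"
  assumes "P []" "\<And>I w L. P L \<Longrightarrow> P ((I, w) # L)"
  shows "P L"
proof (induction L)
  case (Cons a L)
  then show ?case using assms(2)[of L "fst a" "snd a"] by simp
qed (rule assms(1))

lemma interval_diff: "w \<le> b \<Longrightarrow> {1..b} - {b - w<..b - w + w} = {1..b - w}" for b w :: nat
  by auto

lemma row_diff_patch: "row (D - patch i a w) r = (if r = i then row D r - {a<..a + w} else row D r)"
  by (auto simp: row_def)

lemma row_un_patch: "row (D \<union> patch i a w) r = (if r = i then row D r \<union> {a<..a + w} else row D r)"
  by (auto simp: row_def)

text \<open>Putting patches back adds crosses only in their starting rows; in a row below all of
  these it only cuts off the end.\<close>

lemma diagram_rows: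
  assumes "valid u L" "\<And>J. J \<in> fst ` set L \<Longrightarrow> fst J < r"
  shows "row (diagram u L) r = {1..rowlen u L r} \<and> lastcol u L r = rowlen u L r"
  using assms
proof (induction L rule: run_induct)
  case Nil
  then show ?case by (simp add: row_bottom rowlen_def landed_def)
next
  case (Cons I w L)
  have ok: "step_ok u I w L" "valid u L" using Cons by auto
  have r: "fst I < r" using Cons.prems(2)[of I] by simp
  have IH: "row (diagram u L) r = {1..rowlen u L r}"
    using Cons by auto
  have "w \<le> rowlen u L (index_size I)" using step_okD[OF ok(1)] by simp
  then show ?case using r IH interval_diff
    by (cases "r = index_size I") (simp_all add: row_un_patch row_diff_patch rowlen_Cons)
qed

lemma diagram_last:
  assumes "valid u L" "\<And>J. J \<in> fst ` set L \<Longrightarrow> fst J \<le> r"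
  shows "((r, c) \<in> diagram u L \<longrightarrow> c \<le> lastcol u L r) \<and>
    (lastcol u L r = 0 \<or> (r, lastcol u L r) \<in> diagram u L)"
proof (cases "\<forall>J\<in>fst ` set L. fst J < r")
  case True
  then have *: "row (diagram u L) r = {1..rowlen u L r}" "lastcol u L r = rowlen u L r"
    using diagram_rows[OF assms(1), of r] by blast+
  have "(r, d) \<in> diagram u L \<longleftrightarrow> 1 \<le> d \<and> d \<le> rowlen u L r" for d
    using *(1) by (metis atLeastAtMost_iff mem_row)
  from this[of c] this[of "lastcol u L r"] show ?thesis unfolding *(2) by linarith
next
  case False
  show ?thesis
    using assms False
  proof (induction L arbitrary: c rule: run_induct)
    case Nil
    then show ?case by simp
  next
    case (Cons I w L)
    have ok: "step_ok u I w L" "valid u L" using Cons by auto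
    note d = step_okD[OF ok(1)]
    have w: "1 \<le> w" using ok by (simp add: step_ok_def)
    have leI: "fst J \<le> fst I" if "J \<in> fst ` set L" for J using step_ok_le[OF ok(1) that] .
    \<comment> \<open>Starting rows decrease weakly along a run and none exceeds \<open>r\<close>,
      so if some patch starts in row \<open>r\<close>, the head does.\<close>
    have r: "fst I = r"
    proof (rule ccontr)
      assume "fst I \<noteq> r"
      then have "fst I < r" using Cons.prems(2)[of I] by simp
      then show False using Cons.prems(3) leI by fastforce
    qed
    have IH: "c \<le> lastcol u L r" if "(r, c) \<in> diagram u L" for c
    proof (cases "\<forall>J\<in>fst ` set L. fst J < r")
      case True
      then have *: "row (diagram u L) r = {1..rowlen u L r}" "lastcol u L r = rowlen u L r"
        using diagram_rows[OF ok(2), of r] by blast+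
      then show ?thesis using that by (metis atLeastAtMost_iff mem_row)
    next
      case False
      then show ?thesis using Cons.IH[of c] ok leI r that by auto
    qed
    have "index_size I \<noteq> r" using d(1) r by simp
    then show ?case using IH[of c] d(3,6) r w by auto
  qed
qed

text \<open>One round per entry of \<open>ks\<close>. As long as moves remain, the patch is again
  the last one of its row with left-aligned rows below, so the next round picks it.\<close>

lemma rounds_path:
  assumes "path f w r ks a" "ks \<noteq> []" "1 \<le> w" "1 \<le> r" "positive_cells B"
    and "\<And>c. (r, c) \<in> B \<Longrightarrow> c < a"
    and "\<And>r'. r < r' \<Longrightarrow> row B r' = {1..if r' = r + sum_list ks then f r' - w else f r'}"
    and "\<And>c. c \<in> patch r a w \<Longrightarrow> h c = (i0, ks0)"
  shows "\<exists>h'. encoding_round\<^sup>*\<^sup>* (B \<union> patch r a w, h)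
      (B \<union> patch (r + sum_list ks) (a - length ks) w, h') \<and>
    (\<forall>c\<in>B. h' c = h c) \<and>
    (\<forall>c\<in>patch (r + sum_list ks) (a - length ks) w. h' c = (i0, ks0 @ ks)) \<and>
    (pipe_dream n u (B \<union> patch (r + sum_list ks) (a - length ks) w) \<longleftrightarrow> pipe_dream n u (B \<union> patch r a w))"
  using assms
proof (induction ks arbitrary: r a h ks0)
  case Nil
  then show ?case by simp
next
  case (Cons m ks)
  obtain a' where a: "a = Suc a'" using Cons.prems(1) by (cases a) auto
  \<comment> \<open>\<open>f\<close> counts the patch in its final row; \<open>g\<close> gives the
    row lengths of \<open>B\<close> alone.\<close>
  define g where "g = (\<lambda>r'. if r' = r + sum_list (m # ks) then f r' - w else f r')"
  have m: "1 \<le> m" and tail: "path f w (r + m) ks a'" using Cons.prems(1) a by auto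
  \<comment> \<open>If no move is left, the patch continues row \<open>r + m\<close>. Otherwise that
    row ends before column \<open>a'\<close>, whose elbow keeps the patch separate.\<close>
  have g: "g (r + m) \<le> a'" "ks \<noteq> [] \<Longrightarrow> g (r + m) < a'"
    using tail by (cases ks; auto simp: g_def)+
  have rows: "row B r' = {1..g r'}" if "r < r'" for r' using Cons.prems(7)[OF that] by (simp add: g_def)
  let ?E = "B \<union> patch r a w"
  have disj: "B \<inter> patch r a w = {}" using Cons.prems(6) by fastforce
  have posE: "positive_cells ?E" using Cons.prems(4,5) by (auto simp: positive_cells_def)
  have lp: "last_patch ?E g r a' w"
    unfolding last_patch_def
  proof (intro conjI allI impI)
    show "(r, Suc a') \<notin> ?E" using Cons.prems(6)[of a] a by auto
    show "(r, c) \<notin> ?E" if "Suc a' + w < c" for c using Cons.prems(6)[of c] a that by auto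
    show "row ?E r' = {1..g r'}" if "r < r'" for r' using rows[OF that] that by (simp add: row_un_patch)
  qed (use Cons.prems(3) a in auto)
  have "\<exists>h'. encoding_round (?E, h) (?E - patch r (Suc a') w \<union> patch (r + m) a' w, h') \<and>
    (\<forall>c. c \<notin> patch (r + m) a' w \<longrightarrow> h' c = h c) \<and>
    (\<forall>c\<in>patch (r + m) a' w. h' c = (i0, ks0 @ [m])) \<and>
    (pipe_dream n u (?E - patch r (Suc a') w \<union> patch (r + m) a' w) \<longleftrightarrow> pipe_dream n u ?E)"
  proof (rule encoding_round_patch[OF posE lp m _ g(1)])
    show "Suc a' + w \<le> g r'" if "r < r'" "r' < r + m" for r'
    proof -
      have "1 \<le> r' - r \<and> r' - r < m" using that by auto
      then have "a + w \<le> f (r + (r' - r))" using Cons.prems(1) by simp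
      then show ?thesis using that a by (simp add: g_def)
    qed
  qed (use Cons.prems(8) a in auto)
  moreover have "?E - patch r (Suc a') w \<union> patch (r + m) a' w = B \<union> patch (r + m) a' w"
    using disj a by auto
  ultimately obtain h1 where h1: "encoding_round (?E, h) (B \<union> patch (r + m) a' w, h1)"
    "\<And>c. c \<notin> patch (r + m) a' w \<Longrightarrow> h1 c = h c"
    "\<And>c. c \<in> patch (r + m) a' w \<Longrightarrow> h1 c = (i0, ks0 @ [m])"
    "pipe_dream n u (B \<union> patch (r + m) a' w) \<longleftrightarrow> pipe_dream n u ?E" by auto
  have below: "c \<le> g (r + m)" if "(r + m, c) \<in> B" for c
  proof -
    have "c \<in> row B (r + m)" using that by simp
    then show ?thesis using rows[of "r + m"] m by auto
  qed
  have B1: "h1 c = h c" if "c \<in> B" for c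
  proof -
    have "c \<notin> patch (r + m) a' w" using below[of "snd c"] g(1) that by (cases c) auto
    then show ?thesis by (rule h1(2))
  qed
  show ?case
  proof (cases "ks = []")
    case True
    then show ?thesis using h1 B1 a by (intro exI[of _ h1]) auto
  next
    case False
    have "\<exists>h'. encoding_round\<^sup>*\<^sup>* (B \<union> patch (r + m) a' w, h1)
        (B \<union> patch (r + m + sum_list ks) (a' - length ks) w, h') \<and>
      (\<forall>c\<in>B. h' c = h1 c) \<and>
      (\<forall>c\<in>patch (r + m + sum_list ks) (a' - length ks) w. h' c = (i0, (ks0 @ [m]) @ ks)) \<and>
      (pipe_dream n u (B \<union> patch (r + m + sum_list ks) (a' - length ks) w) \<longleftrightarrow>
        pipe_dream n u (B \<union> patch (r + m) a' w))"
    proof (rule Cons.IH[OF tail False])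
      show "c < a'" if "(r + m, c) \<in> B" for c using below[OF that] g(2)[OF False] by simp
      show "row B r' = {1..if r' = r + m + sum_list ks then f r' - w else f r'}" if "r + m < r'" for r'
        using rows[of r'] that by (simp add: g_def add.assoc)
    qed (use Cons.prems h1 in auto)
    then obtain h' where h': "encoding_round\<^sup>*\<^sup>* (B \<union> patch (r + m) a' w, h1)
        (B \<union> patch (r + m + sum_list ks) (a' - length ks) w, h')"
      "\<forall>c\<in>B. h' c = h1 c"
      "\<forall>c\<in>patch (r + m + sum_list ks) (a' - length ks) w. h' c = (i0, (ks0 @ [m]) @ ks)"
      "pipe_dream n u (B \<union> patch (r + m + sum_list ks) (a' - length ks) w) \<longleftrightarrow>
        pipe_dream n u (B \<union> patch (r + m) a' w)" by blast
    show ?thesis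
      using converse_rtranclp_into_rtranclp[OF h1(1) h'(1)] h'(2-) h1(4) B1 a
      by (intro exI[of _ h']) (auto simp: add.assoc)
  qed
qed

definition fixed_part :: "(nat \<Rightarrow> nat) \<Rightarrow> index \<Rightarrow> nat \<Rightarrow> run \<Rightarrow> cell set" where
  "fixed_part u I w L = diagram u L - patch (index_size I) (rowlen u L (index_size I) - w) w"

lemma diagram_split:
  assumes "valid u ((I, w) # L)"
  defines "B \<equiv> fixed_part u I w L"
  shows "diagram u ((I, w) # L) = B \<union> patch (fst I) (startcol u I w L) w"
    "B \<inter> patch (fst I) (startcol u I w L) w = {}"
    "diagram u L = B \<union> patch (index_size I) (rowlen u L (index_size I) - w) w"
    "B \<inter> patch (index_size I) (rowlen u L (index_size I) - w) w = {}"
    "(fst I, c) \<in> B \<Longrightarrow> c < startcol u I w L"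
    "fst I < r \<Longrightarrow> row B r = {1..if r = index_size I then rowlen u L r - w else rowlen u L r}"
proof -
  have ok: "step_ok u I w L" "valid u L" using assms by auto
  note d = step_okD[OF ok(1)]
  have le: "fst J \<le> fst I" if "J \<in> fst ` set L" for J using step_ok_le[OF ok(1) that] .
  show "diagram u ((I, w) # L) = B \<union> patch (fst I) (startcol u I w L) w"
    by (simp add: B_def fixed_part_def)
  have lt: "c < startcol u I w L" if "(fst I, c) \<in> B" for c
    using diagram_last[OF ok(2) le, of c] d(6) that by (simp add: B_def fixed_part_def)
  then show "(fst I, c) \<in> B \<Longrightarrow> c < startcol u I w L" .
  show "B \<inter> patch (fst I) (startcol u I w L) w = {}" using lt by fastforce
  have row: "row (diagram u L) r = {1..rowlen u L r}" if "fst I < r" for r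
    using diagram_rows[OF ok(2), of r] le that by fastforce
  have "patch (index_size I) (rowlen u L (index_size I) - w) w \<subseteq> diagram u L"
  proof
    fix c assume c: "c \<in> patch (index_size I) (rowlen u L (index_size I) - w) w"
    then have "snd c \<in> row (diagram u L) (index_size I)"
      unfolding row[OF d(1)] using d(2) by (cases c) auto
    then show "c \<in> diagram u L" using c by (cases c) auto
  qed
  then show "diagram u L = B \<union> patch (index_size I) (rowlen u L (index_size I) - w) w"
    by (auto simp: B_def fixed_part_def)
  show "B \<inter> patch (index_size I) (rowlen u L (index_size I) - w) w = {}"
    by (auto simp: B_def fixed_part_def)
  show "row B r = {1..if r = index_size I then rowlen u L r - w else rowlen u L r}" if "fst I < r"
    using row[OF that] interval_diff[OF d(2)]
    by (cases "r = index_size I") (simp_all add: B_def fixed_part_def row_diff_patch)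
qed

lemma step_rounds:
  assumes v: "valid u ((I, w) # L)" and D: "pipe_dream n u (diagram u L)"
    and h: "\<And>c. c \<in> patch (fst I) (startcol u I w L) w \<Longrightarrow> h c = (fst I, [])"
  shows "\<exists>h'. encoding_round\<^sup>*\<^sup>* (diagram u ((I, w) # L), h) (diagram u L, h') \<and>
    (\<forall>c\<in>fixed_part u I w L. h' c = h c) \<and>
    (\<forall>c\<in>patch (index_size I) (rowlen u L (index_size I) - w) w. h' c = I) \<and>
    pipe_dream n u (diagram u ((I, w) # L))"
proof -
  have ok: "step_ok u I w L" "valid u L" using v by auto
  note s = ok(1)[unfolded step_ok_def] and d = step_okD[OF ok(1)] and split = diagram_split[OF v]
  have "positive_cells (fixed_part u I w L)"
    using positive_cells_pipe_dream[OF D] by (auto simp: positive_cells_def fixed_part_def)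
  then have "\<exists>h'. encoding_round\<^sup>*\<^sup>* (fixed_part u I w L \<union> patch (fst I) (startcol u I w L) w, h)
      (fixed_part u I w L \<union> patch (fst I + sum_list (snd I)) (startcol u I w L - length (snd I)) w, h') \<and>
    (\<forall>c\<in>fixed_part u I w L. h' c = h c) \<and>
    (\<forall>c\<in>patch (fst I + sum_list (snd I)) (startcol u I w L - length (snd I)) w. h' c = (fst I, [] @ snd I)) \<and>
    (pipe_dream n u (fixed_part u I w L \<union> patch (fst I + sum_list (snd I)) (startcol u I w L - length (snd I)) w)
      \<longleftrightarrow> pipe_dream n u (fixed_part u I w L \<union> patch (fst I) (startcol u I w L) w))"
  proof (rule rounds_path[where f = "profile u L (fst I)", rotated 4])
    show "row (fixed_part u I w L) r =
        {1..if r = fst I + sum_list (snd I) then profile u L (fst I) r - w else profile u L (fst I) r}"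
      if "fst I < r" for r
    proof -
      have "profile u L (fst I) r = rowlen u L r" using that by (simp add: profile_def)
      then show ?thesis using split(6)[OF that] unfolding index_size_def[symmetric]
        by (cases "r = index_size I") simp_all
    qed
  qed (use s split(5) h in auto)
  then show ?thesis
    unfolding d(5) index_size_def[symmetric] split(1,3)[symmetric] using D by simp
qed

text \<open>A valid run contains an index at most once, so this is the size of its patch, or 0. As a
  sum it is additive along the run.\<close>

definition width :: "run \<Rightarrow> index \<Rightarrow> nat" where
  "width L J = (\<Sum>(I, w)\<leftarrow>L. if I = J then w else 0)"

lemma card_history:
  assumes "finite A" "A \<inter> patch r a w = {}" "\<And>c. c \<in> patch r a w \<Longrightarrow> h c = I"
  shows "card {c \<in> A \<union> patch r a w. h c = J} = card {c \<in> A. h c = J} + (if I = J then w else 0)"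
proof -
  have "{c \<in> A \<union> patch r a w. h c = J} = {c \<in> A. h c = J} \<union> (if I = J then patch r a w else {})"
    using assms(3) by auto
  moreover have "{c \<in> A. h c = J} \<inter> (if I = J then patch r a w else {}) = {}" using assms(2) by auto
  ultimately show ?thesis using assms(1) by (auto simp: card_Un_disjoint)
qed

text \<open>The histories are generalised for the induction: only crosses in or above the starting
  row of some remaining patch must be unmoved. Patches that have landed keep arbitrary histories,
  and their counts are carried along additively.\<close>

lemma valid_rounds:
  assumes u: "u permutes {1..n}" and "valid u L"
  shows "pipe_dream n u (diagram u L) \<and> (\<forall>h.
    (\<forall>c\<in>diagram u L. (\<exists>J\<in>fst ` set L. fst c \<le> fst J) \<longrightarrow> h c = (fst c, [])) \<longrightarrow>
    (\<exists>h'. encoding_round\<^sup>*\<^sup>* (diagram u L, h) (bottom u, h') \<and>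
      (\<forall>J. snd J \<noteq> [] \<longrightarrow> card {c \<in> bottom u. h' c = J} = card {c \<in> diagram u L. h c = J} + width L J)))"
  using assms
proof (induction L rule: run_induct)
  case Nil
  then show ?case using pipe_dream_bottom by (auto simp: width_def)
next
  case (Cons I w L)
  have ok: "step_ok u I w L" "valid u L" using Cons by auto
  note split = diagram_split[OF Cons.prems(2)] and d = step_okD[OF ok(1)]
  have D: "pipe_dream n u (diagram u L)" and IH: "\<And>h.
    (\<forall>c\<in>diagram u L. (\<exists>J\<in>fst ` set L. fst c \<le> fst J) \<longrightarrow> h c = (fst c, [])) \<Longrightarrow>
    (\<exists>h'. encoding_round\<^sup>*\<^sup>* (diagram u L, h) (bottom u, h') \<and>
      (\<forall>J. snd J \<noteq> [] \<longrightarrow> card {c \<in> bottom u. h' c = J} = card {c \<in> diagram u L. h c = J} + width L J))"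
    using Cons by auto
  have fin: "finite (fixed_part u I w L)"
    using positive_cells_pipe_dream[OF D] by (auto simp: positive_cells_def fixed_part_def)
  let ?p = "patch (fst I) (startcol u I w L) w"
  let ?q = "patch (index_size I) (rowlen u L (index_size I) - w) w"
  have "pipe_dream n u (diagram u ((I, w) # L))"
    using step_rounds[OF Cons.prems(2) D, of "\<lambda>_. (fst I, [])"] by blast
  moreover have "\<exists>h'. encoding_round\<^sup>*\<^sup>* (diagram u ((I, w) # L), h) (bottom u, h') \<and>
      (\<forall>J. snd J \<noteq> [] \<longrightarrow> card {c \<in> bottom u. h' c = J} =
         card {c \<in> diagram u ((I, w) # L). h c = J} + width ((I, w) # L) J)"
    if h: "\<forall>c\<in>diagram u ((I, w) # L). (\<exists>J\<in>fst ` set ((I, w) # L). fst c \<le> fst J) \<longrightarrow> h c = (fst c, [])" for h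
  proof -
    have h0: "h c = (fst I, [])" if c: "c \<in> ?p" for c
    proof -
      have "c \<in> diagram u ((I, w) # L)" "fst c = fst I" using c unfolding split(1) by (auto simp: patch_def)
      then show ?thesis using h by simp
    qed
    obtain h1 where h1: "encoding_round\<^sup>*\<^sup>* (diagram u ((I, w) # L), h) (diagram u L, h1)"
      "\<And>c. c \<in> fixed_part u I w L \<Longrightarrow> h1 c = h c" "\<And>c. c \<in> ?q \<Longrightarrow> h1 c = I"
      using step_rounds[OF Cons.prems(2) D, of h] h0 by blast
    \<comment> \<open>The head patch has landed below its starting row, hence below every row in
      which a remaining patch starts.\<close>
    have "h1 c = (fst c, [])" if c: "c \<in> diagram u L" "J \<in> fst ` set L" "fst c \<le> fst J" for c J
    proof -
      have le: "fst c \<le> fst I" using step_ok_le[OF ok(1) c(2)] c(3) by simp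
      then have "c \<notin> ?q" using d(1) by (cases c) auto
      then have f: "c \<in> fixed_part u I w L" using c split(3) by auto
      then show ?thesis using h1(2) h le split(1) by auto
    qed
    then obtain h' where h': "encoding_round\<^sup>*\<^sup>* (diagram u L, h1) (bottom u, h')"
      "\<And>J. snd J \<noteq> [] \<Longrightarrow> card {c \<in> bottom u. h' c = J} = card {c \<in> diagram u L. h1 c = J} + width L J"
      using IH[of h1] by blast
    have "card {c \<in> diagram u L. h1 c = J} =
        card {c \<in> diagram u ((I, w) # L). h c = J} + (if I = J then w else 0)" if J: "snd J \<noteq> []" for J
    proof -
      have "card {c \<in> diagram u L. h1 c = J} =
          card {c \<in> fixed_part u I w L. h1 c = J} + (if I = J then w else 0)"
        unfolding split(3) by (rule card_history[OF fin split(4) h1(3)])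
      also have "{c \<in> fixed_part u I w L. h1 c = J} = {c \<in> fixed_part u I w L. h c = J}"
        using h1(2) by auto
      \<comment> \<open>Before its first move the patch has an empty history list and does not count
        for \<open>J\<close>.\<close>
      also have "card {c \<in> fixed_part u I w L. h c = J} = card {c \<in> diagram u ((I, w) # L). h c = J}"
        unfolding split(1) using card_history[OF fin split(2), of h "(fst I, [])" J] h0 J by auto
      finally show ?thesis .
    qed
    then show ?thesis using rtranclp_trans[OF h1(1) h'(1)] h'(2)
      by (intro exI[of _ h']) (auto simp: width_def)
  qed
  ultimately show ?case by blast
qed


subsection \<open>Every pipe dream comes from a run\<close>

lemma inv_ladder_depth_unique:
  assumes "inv_ladder_depth D r s m" "inv_ladder_depth D r s m'"
  shows "m = m'"
proof -
  have "\<not> m < m'" if "inv_ladder_depth D r s m" "inv_ladder_depth D r s m'" for m m'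
    using that by (auto simp: inv_ladder_depth_def)
  then show ?thesis using assms by (meson linorder_neqE_nat)
qed

lemma inv_ladder_move_unique: "inv_ladder_move r s S T \<Longrightarrow> inv_ladder_move r s S T' \<Longrightarrow> T = T'"
  by (cases S) (auto simp: inv_ladder_move_def dest: inv_ladder_depth_unique)

lemma inv_ladder_moves_unique: "inv_ladder_moves r ss S T \<Longrightarrow> inv_ladder_moves r ss S T' \<Longrightarrow> T = T'"
proof (induction ss arbitrary: S)
  case (Cons s ss)
  then show ?case using inv_ladder_move_unique unfolding inv_ladder_moves.simps by blast
qed simp

lemma encoding_round_unique:
  assumes "encoding_round S T" "encoding_round S T'"
  shows "T = T'"
proof -
  obtain i j where 1: "gap (fst S) i j" "\<And>i' j'. gap (fst S) i' j' \<Longrightarrow> i' \<le> i"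
    "\<And>j'. gap (fst S) i j' \<Longrightarrow> j' \<le> j"
    "inv_ladder_moves i [j + 1..<(LEAST k. k > j \<and> (i, k + 1) \<notin> fst S) + 1] S T"
    using assms(1) unfolding encoding_round_def by blast
  obtain i' j' where 2: "gap (fst S) i' j'" "\<And>i'' j''. gap (fst S) i'' j'' \<Longrightarrow> i'' \<le> i'"
    "\<And>j''. gap (fst S) i' j'' \<Longrightarrow> j'' \<le> j'"
    "inv_ladder_moves i' [j' + 1..<(LEAST k. k > j' \<and> (i', k + 1) \<notin> fst S) + 1] S T'"
    using assms(2) unfolding encoding_round_def by blast
  have "i = i'" using 1(1,2) 2(1,2) by (meson le_antisym)
  moreover from this have "j = j'" using 1(1,3) 2(1,3) by (meson le_antisym)
  ultimately show ?thesis using 1(4) 2(4) inv_ladder_moves_unique by blast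
qed

lemma rtranclp_normal_form_unique:
  assumes "\<And>x y z. r x y \<Longrightarrow> r x z \<Longrightarrow> y = z" "r\<^sup>*\<^sup>* a b" "\<And>y. \<not> r b y" "r\<^sup>*\<^sup>* a c" "\<And>y. \<not> r c y"
  shows "b = c"
  using assms(2,4)
proof (induction rule: converse_rtranclp_induct)
  case base
  then show ?case using assms(3) by (metis converse_rtranclpE)
next
  case (step x y)
  from step.prems step.hyps(1) assms(5) obtain z where "r x z" "r\<^sup>*\<^sup>* z c"
    by (metis converse_rtranclpE)
  then show ?case using assms(1)[OF step.hyps(1)] step.IH by blast
qed

lemma no_round_without_gap: "(\<nexists>i j. gap (fst S) i j) \<Longrightarrow> \<not> encoding_round S T"
  unfolding encoding_round_def by blast

lemma no_gap_bottom: "\<not> gap (bottom u) i j"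
  by (auto simp: gap_def bottom_def)

lemma width_eq_0: "valid u L \<Longrightarrow> snd J = [] \<Longrightarrow> width L J = 0"
  by (induction L rule: run_induct) (auto simp: width_def step_ok_def)

text \<open>Initially all history lists are empty, so the final counts are the widths alone;
  determinism makes this the only value that \<open>THE\<close> can choose.\<close>

lemma encoding_diagram:
  assumes u: "u permutes {1..n}" and v: "valid u L"
  shows "encoding (diagram u L) = width L"
proof -
  let ?h = "\<lambda>(r, s). (r, []) :: index"
  have "\<forall>c\<in>diagram u L. (\<exists>J\<in>fst ` set L. fst c \<le> fst J) \<longrightarrow> ?h c = (fst c, [])" by auto
  then obtain h' where h': "encoding_round\<^sup>*\<^sup>* (diagram u L, ?h) (bottom u, h')"
    "\<And>J. snd J \<noteq> [] \<Longrightarrow> card {c \<in> bottom u. h' c = J} = card {c \<in> diagram u L. ?h c = J} + width L J"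
    using valid_rounds[OF u v] by blast
  have count: "count_histories (bottom u, h') = width L"
  proof
    fix J
    show "count_histories (bottom u, h') J = width L J"
    proof (cases "snd J = []")
      case True
      then show ?thesis using width_eq_0[OF v] by (simp add: count_histories_def)
    next
      case False
      then have "{c \<in> diagram u L. ?h c = J} = {}" by auto
      then have "card {c \<in> diagram u L. ?h c = J} = 0" by (simp only: card.empty)
      then show ?thesis using False h'(2)[OF False] by (simp add: count_histories_def)
    qed
  qed
  show ?thesis
    unfolding encoding_def
  proof (rule the_equality)
    show "\<exists>S. encoding_round\<^sup>*\<^sup>* (diagram u L, ?h) S \<and> (\<nexists>i j. gap (fst S) i j) \<and>
        width L = count_histories S"
      using h'(1) count no_gap_bottom by (intro exI[of _ "(bottom u, h')"]) simp
    fix x assume "\<exists>S. encoding_round\<^sup>*\<^sup>* (diagram u L, ?h) S \<and> (\<nexists>i j. gap (fst S) i j) \<and>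
        x = count_histories S"
    then obtain S where S: "encoding_round\<^sup>*\<^sup>* (diagram u L, ?h) S" "\<nexists>i j. gap (fst S) i j"
      "x = count_histories S" by blast
    have "S = (bottom u, h')"
      using encoding_round_unique S(1) no_round_without_gap[OF S(2)] h'(1)
      by (rule rtranclp_normal_form_unique) (use no_round_without_gap no_gap_bottom in \<open>auto\<close>)
    then show "x = width L" using S(3) count by simp
  qed
qed

text \<open>The measure for decomposing a pipe dream: moving a patch lowers the sum of all columns
  by its size.\<close>

lemma sum_snd_patch: "sum snd (patch i (Suc a) w) = sum snd (patch i' a w) + w"
proof (induction w arbitrary: a)
  case (Suc w)
  have "(i, Suc (Suc a)) \<notin> patch i (Suc (Suc a)) w" "(i', Suc a) \<notin> patch i' (Suc a) w" by auto
  then show ?case using Suc[of "Suc a"] by (simp add: patch_Suc)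
qed simp

lemma gap_diagram:
  assumes "valid u ((I, w) # L)"
  shows "gap (diagram u ((I, w) # L)) (fst I) (startcol u I w L)"
proof -
  note split = diagram_split[OF assms]
  have ok: "step_ok u I w L" using assms by simp
  then have "length (snd I) \<ge> 1" "w \<ge> 1" by (auto simp: step_ok_def Suc_le_eq)
  then show ?thesis using split(5)[of "startcol u I w L"] step_okD(4)[OF ok]
    unfolding gap_def split(1) by auto
qed

text \<open>The head patch starts in a row with a gap, and no other patch starts below it.\<close>

lemma diagram_fst_le:
  assumes v: "valid u L" and g: "\<And>r j. gap (diagram u L) r j \<Longrightarrow> r \<le> i" and J: "J \<in> fst ` set L"
  shows "fst J \<le> i"
proof (cases L)
  case (Cons a L')
  obtain I w where a: "a = (I, w)" by fastforce
  have "fst I \<le> i" using gap_diagram g v Cons a by blast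
  moreover have "fst J \<le> fst I"
    using J Cons a v step_ok_le[of u I w L' J] by auto
  ultimately show ?thesis by simp
qed (use J in simp)

lemma no_gap_interval: "row D r = {1..b} \<Longrightarrow> \<not> gap D r j"
proof
  assume r: "row D r = {1..b}" and "gap D r j"
  then have "Suc j \<in> row D r" "j \<notin> row D r" "1 \<le> j" by (auto simp: gap_def)
  then show False unfolding r by simp
qed

lemma interval_eq: "{1..a} = {1..b} \<Longrightarrow> a = b" for a b :: nat
  by (metis card_atLeastAtMost diff_Suc_1)

lemma interval_un: "a = f \<Longrightarrow> {1..f} \<union> {a<..a + w} = {1..a + w}" for a f w :: nat
  by auto

text \<open>One round is performed, and the run of the result is extended. If the patch has become
  left-aligned, it is a new head entry; otherwise it is already the head entry, and the depth
  \<open>m\<close> is prepended to its path.\<close>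

lemma pipe_dream_imp_diagram:
  assumes u: "u permutes {1..n}" and "pipe_dream n u D"
  shows "\<exists>L. valid u L \<and> D = diagram u L"
  using assms(2)
proof (induction "sum snd D" arbitrary: D rule: less_induct)
  case less
  have pos: "positive_cells D" using positive_cells_pipe_dream[OF less.prems] .
  have fin: "finite D" using pos by (simp add: positive_cells_def)
  show ?case
  proof (cases "\<exists>i j. gap D i j")
    case False
    have "row D r = {1..Max (insert 0 (row D r))}" for r
      by (rule row_no_gap[OF pos]) (use False in blast)
    then interpret left_aligned D "\<lambda>r. Max (insert 0 (row D r))"
      by unfold_locales (rule pos)
    have "D = bottom u" using pipe_dream_imp_bottom[OF u less.prems] .
    then show ?thesis by (intro exI[of _ "[]"]) simp
  next
    case True
    then obtain f i a w where lp: "last_patch D f i a w" using last_patch_exists[OF pos] by blast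
    from last_patch_depth[OF less.prems lp] obtain m where
      m: "1 \<le> m" "\<And>r. i < r \<Longrightarrow> r < i + m \<Longrightarrow> Suc a + w \<le> f r" "f (i + m) \<le> a" by blast
    note l = lp[unfolded last_patch_def]
    define B where "B = D - patch i (Suc a) w"
    define E where "E = B \<union> patch (i + m) a w"
    have w: "1 \<le> w" and DB: "D = B \<union> patch i (Suc a) w" using l by (auto simp: B_def)
    have i1: "1 \<le> i"
    proof -
      have "(i, Suc (Suc a)) \<in> patch i (Suc a) w" using w by simp
      then have "(i, Suc (Suc a)) \<in> D" using l by blast
      then show ?thesis using pos by (auto simp: positive_cells_def)
    qed
    have Bi: "c \<le> a" if "(i, c) \<in> B" for c
    proof (rule ccontr)
      assume "\<not> c \<le> a"
      moreover have "c \<noteq> Suc a" using that l by (auto simp: B_def)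
      moreover have "c \<le> Suc a + w" using that l unfolding B_def by (meson DiffD1 not_le)
      ultimately have "(i, c) \<in> patch i (Suc a) w" by simp
      then show False using that by (simp add: B_def)
    qed
    have rowB: "row B r = {1..f r}" if "i < r" for r
      using l that by (simp add: B_def row_diff_patch)
    have disj: "B \<inter> patch (i + m) a w = {}"
    proof -
      have "c \<le> a" if "(i + m, c) \<in> B" for c
      proof -
        have "c \<in> row B (i + m)" using that by simp
        then show ?thesis using rowB[of "i + m"] m by simp
      qed
      then show ?thesis by fastforce
    qed
    have E: "pipe_dream n u E"
    proof -
      have "\<exists>h'. encoding_round (D, \<lambda>_. (i, [])) (D - patch i (Suc a) w \<union> patch (i + m) a w, h') \<and>
        (\<forall>c. c \<notin> patch (i + m) a w \<longrightarrow> h' c = (i, [])) \<and>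
        (\<forall>c\<in>patch (i + m) a w. h' c = (i, [] @ [m])) \<and>
        (pipe_dream n u (D - patch i (Suc a) w \<union> patch (i + m) a w) \<longleftrightarrow> pipe_dream n u D)"
        by (rule encoding_round_patch[OF pos lp m]) simp_all
      then show ?thesis using less.prems by (auto simp: E_def B_def)
    qed
    have "finite B" using fin by (simp add: B_def)
    moreover have "B \<inter> patch i (Suc a) w = {}" by (auto simp: B_def)
    ultimately have "sum snd D = sum snd E + w"
      unfolding DB E_def using disj by (simp add: sum.union_disjoint sum_snd_patch[of i a w "i + m"])
    then have "sum snd E < sum snd D" using w by simp
    then obtain L1 where L1: "valid u L1" "E = diagram u L1" using less.hyps[OF _ E] by blast
    have rowE: "row E r = (if r = i + m then {1..f r} \<union> {a<..a + w} else {1..f r})" if "i < r" for r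
      using rowB[OF that] unfolding E_def row_un_patch by (cases "r = i + m") simp_all
    show ?thesis
    proof (cases "f (i + m) = a")
      case True
      \<comment> \<open>The patch has become the end of row \<open>i + m\<close>, so its whole path
        is \<open>[m]\<close>.\<close>
      have rowE1: "row E r = {1..if r = i + m then a + w else f r}" if "i < r" for r
        using rowE[OF that] interval_un[of a "f (i + m)" w] True by (cases "r = i + m") simp_all
      have le: "fst J \<le> i" if "J \<in> fst ` set L1" for J
        using diagram_fst_le[OF L1(1) _ that, of i] no_gap_interval[OF rowE1]
        unfolding L1(2)[symmetric] by (meson not_le)
      have rl: "rowlen u L1 r = (if r = i + m then a + w else f r)" if "i < r" for r
      proof -
        have "row E r = {1..rowlen u L1 r}"
          using diagram_rows[OF L1(1), of r] le that unfolding L1(2) by fastforce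
        then show ?thesis using rowE1[OF that] interval_eq by (metis (full_types))
      qed
      have lc: "lastcol u L1 i \<le> a"
      proof -
        have "lastcol u L1 i = 0 \<or> (i, lastcol u L1 i) \<in> E"
          using diagram_last[OF L1(1) le] unfolding L1(2) by blast
        then show ?thesis using Bi m by (auto simp: E_def)
      qed
      have sc: "startcol u (i, [m]) w L1 = Suc a"
        using rl[of "i + m"] m by (simp add: startcol_def index_size_def)
      have "path (profile u L1 i) w i [m] (Suc a)"
        using lc m rl by (auto simp: profile_def)
      then have "step_ok u (i, [m]) w L1"
        unfolding step_ok_def using i1 w le sc by simp
      moreover have "diagram u (((i, [m]), w) # L1) = D"
      proof -
        have "E - patch (i + m) a w = B" using disj by (auto simp: E_def)
        then show ?thesis using sc rl[of "i + m"] m DB L1(2) by (simp add: index_size_def)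
      qed
      ultimately show ?thesis using L1(1) by (intro exI[of _ "((i, [m]), w) # L1"]) simp
    next
      case False
      then have fa: "f (i + m) < a" using m by simp
      have rim: "row E (i + m) = {1..f (i + m)} \<union> {a<..a + w}" using rowE[of "i + m"] m by simp
      \<comment> \<open>The patch is still preceded by an elbow. As \<open>i + m\<close> is the
        lowest row with a gap, the run of \<open>E\<close> must begin with a patch of this
        row.\<close>
      have gapE: "gap E (i + m) a"
      proof -
        have "Suc a \<in> row E (i + m)" "a \<notin> row E (i + m)" unfolding rim using fa w by auto
        then show ?thesis using fa by (simp add: gap_def)
      qed
      then have "L1 \<noteq> []" using no_gap_bottom L1(2) by auto
      then obtain I1 w1 L2 where L1c: "L1 = (I1, w1) # L2" by (metis list.exhaust surj_pair)
      have v1: "valid u ((I1, w1) # L2)" using L1(1) L1c by simp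
      then have ok1: "step_ok u I1 w1 L2" and v2: "valid u L2" by auto
      note split = diagram_split[OF v1] and d = step_okD[OF ok1]
      note s = ok1[unfolded step_ok_def]
      define b where "b = rowlen u L2 (index_size I1)"
      have r1: "fst I1 = i + m"
      proof (rule antisym)
        have "gap E (fst I1) (startcol u I1 w1 L2)"
          using gap_diagram[OF v1] L1(2) L1c by simp
        then show "fst I1 \<le> i + m"
          using no_gap_interval[of E "fst I1" "f (fst I1)"] rowE[of "fst I1"] m by fastforce
        show "i + m \<le> fst I1"
        proof (rule ccontr)
          assume "\<not> i + m \<le> fst I1"
          then have "\<And>J. J \<in> fst ` set L1 \<Longrightarrow> fst J < i + m"
            using step_ok_le[OF ok1] unfolding L1c by fastforce
          then have "row E (i + m) = {1..rowlen u L1 (i + m)}"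
            using diagram_rows[OF L1(1), of "i + m"] L1(2) by blast
          then show False using no_gap_interval gapE by blast
        qed
      qed
      define a1 where "a1 = startcol u I1 w1 L2"
      have E1: "E = fixed_part u I1 w1 L2 \<union> patch (i + m) a1 w1"
        using split(1) L1(2) L1c r1 by (simp add: a1_def)
      have mem: "(i + m, c) \<in> E \<longleftrightarrow> 1 \<le> c \<and> c \<le> f (i + m) \<or> a < c \<and> c \<le> a + w" for c
      proof -
        have "c \<in> row E (i + m) \<longleftrightarrow> 1 \<le> c \<and> c \<le> f (i + m) \<or> a < c \<and> c \<le> a + w"
          unfolding rim by auto
        then show ?thesis by simp
      qed
      have w1: "1 \<le> w1" using s by simp
      have fx: "(i + m, c) \<in> fixed_part u I1 w1 L2 \<Longrightarrow> c < a1" for c using split(5)[of c] r1 by (simp add: a1_def)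
      have top: "c \<le> a1 + w1" if "(i + m, c) \<in> E" for c
        using that fx[of c] unfolding E1 by auto
      \<comment> \<open>The moved patch and the head patch both end in the last occupied column of
        the row and have an elbow just before them, so they coincide.\<close>
      have "(i + m, a1 + w1) \<in> E" "(i + m, a + w) \<in> E" using w1 w unfolding E1 mem[of "a + w", unfolded E1] by auto
      then have "a + w = a1 + w1" using top[of "a + w"] mem[of "a1 + w1"] fa w w1 by auto
      moreover have "\<not> a1 < a"
      proof
        assume "a1 < a"
        then have "(i + m, a) \<in> E" using \<open>a + w = a1 + w1\<close> unfolding E1 by simp
        then show False using mem[of a] fa by simp
      qed
      moreover have "\<not> a < a1"
      proof
        assume "a < a1"
        then have "(i + m, a1) \<in> E" using \<open>a + w = a1 + w1\<close> w1 mem[of a1] by simp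
        then show False using fx[of a1] unfolding E1 by auto
      qed
      ultimately have aw: "a1 = a" "w1 = w" by auto
      have fpB: "fixed_part u I1 w L2 = B"
      proof -
        have "fixed_part u I1 w L2 = E - patch (i + m) a w"
          using split(2) E1 r1 aw by (auto simp: a1_def)
        then show ?thesis using disj by (auto simp: E_def)
      qed
      have D2: "diagram u L2 = B \<union> patch (index_size I1) (b - w) w"
        using split(3) fpB aw by (simp add: b_def)
      have row2: "\<exists>b'. row (diagram u L2) r = {1..b'} \<and> (r \<noteq> index_size I1 \<longrightarrow> b' = f r)" if "i < r" for r
      proof (cases "r = index_size I1")
        case True
        have "row B r = {1..b - w}" using split(6)[OF d(1)] fpB aw True by (simp add: b_def)
        then have "row (diagram u L2) r = {1..b - w + w}"
          unfolding D2 using True interval_un[of "b - w" "b - w" w] by (simp add: row_un_patch)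
        then show ?thesis using True by blast
      next
        case False
        then show ?thesis using rowB[OF that] unfolding D2 by (simp add: row_un_patch)
      qed
      \<comment> \<open>Once the head patch has landed, all rows below \<open>i\<close> are
        left-aligned, so no later patch starts there.\<close>
      have le: "fst J \<le> i" if "J \<in> fst ` set L2" for J
      proof (rule diagram_fst_le[OF v2 _ that])
        show "r \<le> i" if "gap (diagram u L2) r j" for r j
        proof (rule ccontr)
          assume "\<not> r \<le> i"
          then obtain b' where "row (diagram u L2) r = {1..b'}" using row2[of r] by auto
          then show False using no_gap_interval that by blast
        qed
      qed
      have rows2: "row (diagram u L2) r = {1..rowlen u L2 r} \<and> lastcol u L2 r = rowlen u L2 r" if "i < r" for r
        using diagram_rows[OF v2, of r] le that by fastforce
      have rl: "rowlen u L2 r = f r" if "i < r" "r \<noteq> index_size I1" for r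
        using rows2[OF that(1)] row2[OF that(1)] that(2) interval_eq by metis
      let ?I = "(i, m # snd I1)"
      have size: "index_size ?I = index_size I1" using r1 by (simp add: index_size_def)
      have sc: "startcol u ?I w L2 = Suc a"
        using d(2,3,4) aw by (simp add: startcol_def size a1_def b_def)
      have lc: "lastcol u L2 i \<le> a"
      proof -
        have "lastcol u L2 i = 0 \<or> (i, lastcol u L2 i) \<in> diagram u L2"
          using diagram_last[OF v2 le] by blast
        then show ?thesis using Bi d(1) r1 m unfolding D2 by auto
      qed
      \<comment> \<open>No later patch starts in row \<open>i + m\<close>, so \<open>lastcol\<close>
        and \<open>rowlen\<close> agree there and the rest of the path carries over to the profile
        of row \<open>i\<close>.\<close>
      have "path (profile u L2 i) w (i + m) (snd I1) a"
      proof -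
        have "path (profile u L2 (i + m)) w (i + m) (snd I1) a" using s r1 aw by (simp add: a1_def)
        moreover have "profile u L2 i r = profile u L2 (i + m) r" if "i + m \<le> r" for r
          using that rows2[of "i + m"] m by (simp add: profile_def)
        ultimately show ?thesis using path_cong[of "i + m" "profile u L2 i" "profile u L2 (i + m)"] by blast
      qed
      moreover have "Suc a + w \<le> profile u L2 i (i + q)" if "1 \<le> q" "q < m" for q
        using m(2)[of "i + q"] rl[of "i + q"] that d(1) r1 by (simp add: profile_def)
      ultimately have "path (profile u L2 i) w i (m # snd I1) (Suc a)"
        using lc m by (simp add: profile_def)
      then have "step_ok u ?I w L2"
        unfolding step_ok_def using i1 w le sc by simp
      moreover have "diagram u ((?I, w) # L2) = D"
        using fpB sc DB by (simp add: size fixed_part_def)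
      ultimately show ?thesis using v2 by (intro exI[of _ "(?I, w) # L2"]) simp
    qed
  qed
qed


subsection \<open>The ladder order\<close>

text \<open>The ladder order within one starting row, in a form suited to induction along two
  paths.\<close>

fun path_less :: "nat list \<Rightarrow> nat list \<Rightarrow> bool" where
  "path_less [] ys \<longleftrightarrow> False"
| "path_less (x # xs) [] \<longleftrightarrow> True"
| "path_less (x # xs) (y # ys) \<longleftrightarrow> x < y \<or> x = y \<and> path_less xs ys"

lemma path_less_iff:
  "path_less xs ys \<longleftrightarrow>
    (\<exists>t < min (length xs) (length ys). (\<forall>s<t. xs ! s = ys ! s) \<and> xs ! t < ys ! t) \<or>
    (length xs > length ys \<and> (\<forall>s < length ys. xs ! s = ys ! s))"
proof (induction xs ys rule: path_less.induct)
  case (3 x xs y ys)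
  then show ?case by (auto simp: Ex_less_Suc2 All_less_Suc2)
qed auto

lemma ladder_less_iff: "ladder_less I J \<longleftrightarrow> fst J < fst I \<or> fst I = fst J \<and> path_less (snd I) (snd J)"
  by (cases I; cases J) (auto simp: path_less_iff)

lemma path_less_irrefl: "\<not> path_less xs xs"
  by (induction xs) auto

lemma path_less_trans: "path_less xs ys \<Longrightarrow> path_less ys zs \<Longrightarrow> path_less xs zs"
proof (induction xs zs arbitrary: ys rule: path_less.induct)
  case (3 x xs z zs)
  then show ?case by (cases ys) auto
qed auto

lemma path_less_total: "xs \<noteq> ys \<Longrightarrow> path_less xs ys \<or> path_less ys xs"
proof (induction xs ys rule: path_less.induct)
  case (1 ys)
  then show ?case by (cases ys) auto
qed auto

lemma ladder_less_irrefl: "\<not> ladder_less I I"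
  by (simp add: ladder_less_iff path_less_irrefl)

lemma ladder_less_trans: "ladder_less I J \<Longrightarrow> ladder_less J M \<Longrightarrow> ladder_less I M"
  by (auto simp: ladder_less_iff intro: path_less_trans)

lemma ladder_less_total: "I \<noteq> J \<Longrightarrow> ladder_less I J \<or> ladder_less J I"
  using path_less_total by (auto simp: ladder_less_iff prod_eq_iff)

lemma ladder_less_asym: "ladder_less I J \<Longrightarrow> \<not> ladder_less J I"
  using ladder_less_trans ladder_less_irrefl by blast

text \<open>
  At the first difference of the two paths, the left patch cannot stop in a row passed over by the
  right patch, because that row is longer than the columns of the left patch reach.
\<close>

lemma path_imp_less:
  assumes "path f w r ks a" "path f' w' r ks' a'" "a' + w' < a"
    and "\<And>r'. r \<le> r' \<Longrightarrow> f r' \<le> f' r' - (if r' = r + sum_list ks' then w' else 0)"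
  shows "path_less ks ks'"
  using assms
proof (induction ks ks' arbitrary: r a a' rule: path_less.induct)
  case (1 ks')
  show ?case
  proof (cases ks')
    case Nil
    then show ?thesis using 1(4)[of r] 1(1-3) by simp
  next
    case (Cons m' ks'')
    then have "f' r < a'" "f r = a + w" using 1 by auto
    moreover have "f r \<le> f' r" using 1(4)[of r] by (simp split: if_splits)
    ultimately show ?thesis using 1(3) by simp
  qed
next
  case (2 m ks)
  then show ?case by simp
next
  case (3 m ks m' ks')
  have p: "f r < a" "1 \<le> m" "\<And>q. 1 \<le> q \<Longrightarrow> q < m \<Longrightarrow> a + w \<le> f (r + q)" "path f w (r + m) ks (a - 1)"
    "f' r < a'" "1 \<le> m'" "path f' w' (r + m') ks' (a' - 1)"
    using 3 by auto
  have "\<not> m' < m"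
  proof
    assume "m' < m"
    then have "a + w \<le> f (r + m')" using p by simp
    moreover have "f (r + m') < a'"
    proof (cases ks')
      case Nil
      then show ?thesis using 3(5)[of "r + m'"] p(5,7) by simp
    next
      case (Cons k ks'')
      then have "f' (r + m') < a' - 1" using p(7) by simp
      moreover have "f (r + m') \<le> f' (r + m')" using 3(5)[of "r + m'"] by (simp split: if_splits)
      ultimately show ?thesis by simp
    qed
    ultimately show False using 3(4) by simp
  qed
  moreover have "path_less ks ks'" if "m = m'"
  proof (rule 3(1)[OF p(4)])
    show "path f' w' (r + m) ks' (a' - 1)" using p(7) that by simp
    show "a' - 1 + w' < a - 1" using 3(4) p(5) by simp
    show "f r' \<le> f' r' - (if r' = r + m + sum_list ks' then w' else 0)" if "r + m \<le> r'" for r'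
      using 3(5)[of r'] that \<open>m = m'\<close> by (simp add: add.assoc)
  qed
  ultimately show ?case by auto
qed

lemma step_ok_ladder_less:
  assumes I: "step_ok u I w ((J, w') # L)" and J: "step_ok u J w' L"
  shows "ladder_less I J"
proof (cases "fst J = fst I")
  case True
  note dI = step_okD[OF I] and dJ = step_okD[OF J]
  have "path_less (snd I) (snd J)"
  proof (rule path_imp_less)
    obtain k ks where ks: "snd I = k # ks" using I by (cases "snd I") (auto simp: step_ok_def)
    have pI: "path (profile u ((J, w') # L) (fst I)) w (fst I) (snd I) (startcol u I w ((J, w') # L))"
      using I unfolding step_ok_def by blast
    \<comment> \<open>In row \<open>fst I\<close> the profile for \<open>I\<close> is the right end
      of patch \<open>J\<close>, too large for the comparison in \<open>path_imp_less\<close>. It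
      may be replaced by 0, since \<open>path\<close> only asks for an upper bound there and then
      leaves this row.\<close>
    have cong: "path ((profile u ((J, w') # L) (fst I))(fst I := 0)) w (fst I + k) ks (startcol u I w ((J, w') # L) - 1)
       \<longleftrightarrow> path (profile u ((J, w') # L) (fst I)) w (fst I + k) ks (startcol u I w ((J, w') # L) - 1)"
      by (rule path_cong) (use pI ks in auto)
    show "path ((profile u ((J, w') # L) (fst I))(fst I := 0)) w (fst I) (snd I) (startcol u I w ((J, w') # L))"
      using pI cong unfolding ks by auto
    show "path (profile u L (fst I)) w' (fst I) (snd J) (startcol u J w' L)"
      using J True unfolding step_ok_def by auto
    show "startcol u J w' L + w' < startcol u I w ((J, w') # L)"
      using dI(6) dJ(3) True by simp
    show "((profile u ((J, w') # L) (fst I))(fst I := 0)) r'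
        \<le> profile u L (fst I) r' - (if r' = fst I + sum_list (snd J) then w' else 0)" for r'
      using True by (auto simp: profile_def rowlen_Cons index_size_def)
  qed
  then show ?thesis using True by (simp add: ladder_less_iff)
next
  case False
  have "fst J \<le> fst I" using I unfolding step_ok_def by auto
  then show ?thesis using False by (simp add: ladder_less_iff)
qed

lemma valid_sorted: "valid u L \<Longrightarrow> sorted_wrt ladder_less (map fst L)"
proof (induction L rule: run_induct)
  case (Cons I w L)
  show ?case
  proof (cases L)
    case (Cons Jw L')
    obtain J w' where J: "Jw = (J, w')" by fastforce
    have ok: "step_ok u I w ((J, w') # L')" "step_ok u J w' L'" using Cons.prems Cons J by auto
    have s: "sorted_wrt ladder_less (map fst L)" using Cons.IH Cons.prems by simp
    have IJ: "ladder_less I J" using step_ok_ladder_less[OF ok] .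
    have "ladder_less I M" if "M \<in> set (map fst L)" for M
    proof (cases "M = J")
      case False
      then have "ladder_less J M" using that s unfolding Cons J by auto
      then show ?thesis using IJ ladder_less_trans by blast
    qed (use IJ in simp)
    then show ?thesis using s by simp
  qed simp
qed simp

section \<open>Sorted lists of indices\<close>

lemma sorted_wrt_ladder_unique:
  "sorted_wrt ladder_less xs \<Longrightarrow> sorted_wrt ladder_less ys \<Longrightarrow> set xs = set ys \<Longrightarrow> xs = ys"
proof (induction xs arbitrary: ys)
  case (Cons x xs)
  obtain y ys' where ys: "ys = y # ys'" using Cons.prems(3) by (cases ys) auto
  have xy: "x = y"
  proof (rule ccontr)
    assume "x \<noteq> y"
    then have "x \<in> set ys'" "y \<in> set xs" using Cons.prems(3) ys by auto
    then have "ladder_less y x" "ladder_less x y" using Cons.prems(1,2) ys by auto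
    then show False using ladder_less_asym by blast
  qed
  have "x \<notin> set xs"
  proof
    assume "x \<in> set xs"
    then have "ladder_less x x" using Cons.prems(1) by simp
    then show False using ladder_less_irrefl by blast
  qed
  moreover have "x \<notin> set ys'"
  proof
    assume "x \<in> set ys'"
    then have "ladder_less x x" using Cons.prems(2) ys xy by simp
    then show False using ladder_less_irrefl by blast
  qed
  ultimately have "set xs = set ys'" using Cons.prems(3) ys xy by auto
  then have "xs = ys'" using Cons.IH[of ys'] Cons.prems(1,2) ys by simp
  then show ?case using ys xy by simp
qed simp

lemma sorted_list_exists: "finite K \<Longrightarrow> \<exists>xs. sorted_wrt ladder_less xs \<and> set xs = K"
proof (induction "card K" arbitrary: K)
  case 0
  then show ?case by (intro exI[of _ "[]"]) simp
next
  case (Suc k)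
  have ex: "\<exists>m\<in>K. \<forall>x\<in>K. x \<noteq> m \<longrightarrow> ladder_less m x" if "finite K" "K \<noteq> {}" for K
    using that
  proof (induction rule: finite_ne_induct)
    case (insert y F)
    then obtain m where m: "m \<in> F" "\<And>x. x \<in> F \<Longrightarrow> x \<noteq> m \<Longrightarrow> ladder_less m x" by blast
    show ?case
    proof (cases "ladder_less m y")
      case True
      then show ?thesis using m by (intro bexI[of _ m]) auto
    next
      case False
      then have "ladder_less y m" using ladder_less_total[of y m] insert m by blast
      then have "ladder_less y x" if "x \<in> F" for x
        using m(2)[OF that] ladder_less_trans by (cases "x = m") auto
      then show ?thesis by (intro bexI[of _ y]) auto
    qed
  qed simp
  have "K \<noteq> {}" using Suc.hyps(2) by auto
  from ex[OF Suc.prems this]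
  obtain m where m: "m \<in> K" "\<And>x. x \<in> K \<Longrightarrow> x \<noteq> m \<Longrightarrow> ladder_less m x" by blast
  have "k = card (K - {m})" using Suc.hyps(2) m(1) by simp
  from Suc.hyps(1)[OF this] Suc.prems
  obtain xs where "sorted_wrt ladder_less xs" "set xs = K - {m}" by auto
  then show ?case using m by (intro exI[of _ "m # xs"]) auto
qed

section \<open>Sums and inequalities along a run\<close>

lemma sum_width:
  assumes "finite K" "fst ` set L \<subseteq> K"
  shows "(\<Sum>(I, w)\<leftarrow>L. if P I then w else 0) = (\<Sum>I\<in>{I \<in> K. P I}. width L I)"
  using assms(2)
proof (induction L rule: run_induct)
  case Nil
  then show ?case by (simp add: width_def)
next
  case (Cons I w L)
  have "(\<Sum>J\<in>{J \<in> K. P J}. width ((I, w) # L) J) =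
      (\<Sum>J\<in>{J \<in> K. P J}. if I = J then w else 0) + (\<Sum>J\<in>{J \<in> K. P J}. width L J)"
    by (simp add: width_def sum.distrib)
  also have "(\<Sum>J\<in>{J \<in> K. P J}. if I = J then w else 0) = (if P I then w else 0)"
    using assms(1) Cons.prems by (simp add: sum.delta')
  finally show ?case using Cons by simp
qed

lemma width_notin: "J \<notin> fst ` set L \<Longrightarrow> width L J = 0"
  by (induction L rule: run_induct) (auto simp: width_def)

lemma width_ne_0: "width L J \<noteq> 0 \<Longrightarrow> J \<in> fst ` set L"
  using width_notin by metis

lemma width_append: "width (L1 @ L2) J = width L1 J + width L2 J"
  by (simp add: width_def)

lemma landed_append: "landed (L1 @ L2) j = landed L1 j + landed L2 j"
  by (simp add: landed_def)

lemma valid_append: "valid u (L1 @ L2) \<Longrightarrow> valid u L2"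
  by (induction L1 rule: run_induct) auto

text \<open>On a valid run the subtraction in \<open>rowlen\<close> is therefore never truncated: a
  patch is at most as long as the row that it ends.\<close>

lemma landed_le_code: "valid u L \<Longrightarrow> landed L j \<le> code u j"
proof (induction L rule: run_induct)
  case Nil
  then show ?case by (simp add: landed_def)
next
  case (Cons I w L)
  then have "w \<le> rowlen u L (index_size I)" "1 \<le> w" using step_okD(2)[of u I w L] by (auto simp: step_ok_def)
  then show ?case using Cons by (auto simp: rowlen_def landed_def)
qed

lemma ball_Suc_split: "(\<forall>p\<in>{1..Suc l}. P p) \<longleftrightarrow> P 1 \<and> (\<forall>p\<in>{1..l}. P (Suc p))"
proof -
  have "p \<in> {1..Suc l} \<longleftrightarrow> p = 1 \<or> (\<exists>p'\<in>{1..l}. p = Suc p')" for p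
    by (cases p) auto
  then show ?thesis unfolding Ball_def by metis
qed

text \<open>The start column is forced by \<open>path_end\<close>. With \<open>F\<close> the length
  of the final row, the elbow before the patch is in column
  \<open>F + length ks - w - (p - 1)\<close> ahead of the \<open>p\<close>-th move; substituting
  this for \<open>a\<close> in the clauses of \<open>path\<close> gives the two
  inequalities.\<close>

lemma path_iff:
  assumes "\<forall>k\<in>set ks. 1 \<le> k" "w \<le> f (r + sum_list ks)"
  shows "path f w r ks (f (r + sum_list ks) + length ks - w) \<longleftrightarrow>
    (\<forall>p\<in>{1..length ks}. \<forall>q\<in>{1..ks ! (p - 1)}.
      (q = ks ! (p - 1) \<longrightarrow> int (f (r + sum_list (take (p - 1) ks))) \<le>
         int (f (r + sum_list ks)) - int w + int (length ks) - int p) \<and>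
      (q \<noteq> ks ! (p - 1) \<longrightarrow> int (f (r + sum_list (take (p - 1) ks) + q)) \<ge>
         int (f (r + sum_list ks)) + int (length ks) - int p + 1))"
  using assms
proof (induction ks arbitrary: r)
  case Nil
  then show ?case by simp
next
  case (Cons m ks)
  let ?F = "f (r + m + sum_list ks)" and ?l = "length ks"
  let ?Q = "\<lambda>p q. (q = (m # ks) ! (p - 1) \<longrightarrow> int (f (r + sum_list (take (p - 1) (m # ks)))) \<le>
         int ?F - int w + int (Suc ?l) - int p) \<and>
      (q \<noteq> (m # ks) ! (p - 1) \<longrightarrow> int (f (r + sum_list (take (p - 1) (m # ks)) + q)) \<ge>
         int ?F + int (Suc ?l) - int p + 1)"
  have w: "w \<le> ?F" and m: "1 \<le> m" using Cons.prems by (auto simp: add.assoc)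
  have 1: "(\<forall>q\<in>{1..(m # ks) ! (1 - 1)}. ?Q 1 q) \<longleftrightarrow>
      f r < ?F + Suc ?l - w \<and> 1 \<le> m \<and> (\<forall>q. 1 \<le> q \<and> q < m \<longrightarrow> ?F + Suc ?l - w + w \<le> f (r + q))"
    (is "?A \<longleftrightarrow> ?B")
  proof
    assume A: ?A
    have "int (f r) \<le> int ?F - int w + int (Suc ?l) - 1" using bspec[OF A, of m] m by simp
    then have "f r < ?F + Suc ?l - w" using w by linarith
    moreover have "?F + Suc ?l - w + w \<le> f (r + q)" if "1 \<le> q" "q < m" for q
      using bspec[OF A, of q] that w by simp
    ultimately show ?B using m by blast
  next
    assume B: ?B
    show ?A
    proof
      fix q assume q: "q \<in> {1..(m # ks) ! (1 - 1)}"
      show "?Q 1 q"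
      proof (cases "q = m")
        case True
        then show ?thesis using B w by simp linarith
      next
        case False
        then have "?F + Suc ?l - w + w \<le> f (r + q)" using B q by simp
        then show ?thesis using False w by simp
      qed
    qed
  qed
  have 2: "path f w (r + m) ks (?F + ?l - w) \<longleftrightarrow>
      (\<forall>p\<in>{1..?l}. \<forall>q\<in>{1..(m # ks) ! (Suc p - 1)}. ?Q (Suc p) q)"
  proof -
    have IH: "path f w (r + m) ks (?F + ?l - w) \<longleftrightarrow>
      (\<forall>p\<in>{1..?l}. \<forall>q\<in>{1..ks ! (p - 1)}.
        (q = ks ! (p - 1) \<longrightarrow> int (f (r + m + sum_list (take (p - 1) ks))) \<le>
           int ?F - int w + int ?l - int p) \<and>
        (q \<noteq> ks ! (p - 1) \<longrightarrow> int (f (r + m + sum_list (take (p - 1) ks) + q)) \<ge>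
           int ?F + int ?l - int p + 1))"
      by (rule Cons.IH) (use Cons.prems w in auto)
    show ?thesis
      unfolding IH
    proof (intro ball_cong refl, goal_cases)
      case (1 p)
      then obtain p' where "p = Suc p'" by (cases p) auto
      then show ?case by simp
    next
      case (2 p q)
      then obtain p' where "p = Suc p'" by (cases p) auto
      then show ?case by (simp add: add.assoc) linarith
    qed
  qed
  have "path f w r (m # ks) (?F + Suc ?l - w) \<longleftrightarrow>
      (f r < ?F + Suc ?l - w \<and> 1 \<le> m \<and> (\<forall>q. 1 \<le> q \<and> q < m \<longrightarrow> ?F + Suc ?l - w + w \<le> f (r + q))) \<and>
      path f w (r + m) ks (?F + ?l - w)"
    using w by auto
  also have "\<dots> \<longleftrightarrow> (\<forall>p\<in>{1..Suc ?l}. \<forall>q\<in>{1..(m # ks) ! (p - 1)}. ?Q p q)"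
    unfolding ball_Suc_split[of ?l] 1 2 ..
  finally show ?case by (simp add: add.assoc)
qed


subsection \<open>Compatible sequences and runs\<close>

lemma finite_indices: "finite (indices \<mu>)"
proof (rule finite_subset)
  show "indices \<mu> \<subseteq> {..\<mu>} \<times> {ks. set ks \<subseteq> {..\<mu>} \<and> length ks \<le> \<mu>}"
  proof
    fix I assume "I \<in> indices \<mu>"
    then obtain i ks where I: "I = (i, ks)" "\<forall>k\<in>set ks. 1 \<le> k" "i + sum_list ks \<le> \<mu>"
      by (auto simp: indices_def index_size_def)
    have "length ks \<le> sum_list ks" using I(2) by (induction ks) auto
    moreover have "k \<le> sum_list ks" if "k \<in> set ks" for k using member_le_sum_list[OF that] by simp
    ultimately show "I \<in> {..\<mu>} \<times> {ks. set ks \<subseteq> {..\<mu>} \<and> length ks \<le> \<mu>}"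
      using I by fastforce
  qed
  show "finite ({..\<mu>} \<times> {ks. set ks \<subseteq> {..\<mu>} \<and> length ks \<le> \<mu>})"
    by (intro finite_cartesian_product finite_lists_length_le) auto
qed

lemma le_code_length:
  assumes u: "u permutes {1..n}" and j: "0 < code u j"
  shows "j \<le> code_length u"
proof -
  have "i \<le> n" if "0 < code u i" for i using code_outside[OF u, of i] that by (cases "n < i") auto
  then have "{i. 0 < code u i} \<subseteq> {..n}" by auto
  then have "finite {i. 0 < code u i}" by (rule finite_subset) simp
  then have "finite (insert 0 {i. 0 < code u i})" by simp
  then show ?thesis unfolding code_length_def by (rule Max_ge) (use j in simp)
qed

text \<open>What a valid run and the sorted support of a compatible sequence have in common before
  validity is known; under these assumptions condition (3) is equivalent to validity.\<close>

locale sorted_run =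
  fixes u :: "nat \<Rightarrow> nat" and L :: run
  assumes sorted: "sorted_wrt ladder_less (map fst L)"
    and widths: "\<And>I w. (I, w) \<in> set L \<Longrightarrow> 1 \<le> w"
    and good: "\<And>I. I \<in> fst ` set L \<Longrightarrow> 1 \<le> fst I \<and> snd I \<noteq> [] \<and> (\<forall>k\<in>set (snd I). 1 \<le> k)"
    and landed_le: "\<And>j. landed L j \<le> code u j"
begin

definition K :: "index set" where "K = fst ` set L"

context
  fixes L1 I w L2
  assumes L: "L = L1 @ (I, w) # L2"
begin

lemma before_after:
  "M \<in> fst ` set L1 \<Longrightarrow> ladder_less M I" "M \<in> fst ` set L2 \<Longrightarrow> ladder_less I M"
  "M \<in> fst ` set L1 \<Longrightarrow> N \<in> fst ` set L2 \<Longrightarrow> ladder_less M N"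
  using sorted unfolding L by (auto simp: sorted_wrt_append)

lemma K_eq: "K = insert I (fst ` set L1 \<union> fst ` set L2)"
  unfolding K_def by (subst L) auto

lemma after: "{J \<in> K. ladder_less I J} = fst ` set L2"
proof
  show "{J \<in> K. ladder_less I J} \<subseteq> fst ` set L2"
  proof
    fix J assume J: "J \<in> {J \<in> K. ladder_less I J}"
    then have "J \<in> fst ` set L1 \<or> J = I \<or> J \<in> fst ` set L2" unfolding K_eq by auto
    then show "J \<in> fst ` set L2"
      using J before_after(1) ladder_less_asym ladder_less_irrefl by blast
  qed
  show "fst ` set L2 \<subseteq> {J \<in> K. ladder_less I J}"
    using before_after(2) unfolding K_eq by auto
qed

lemma width_after: "J \<in> fst ` set L2 \<Longrightarrow> width L J = width L2 J"
proof -
  assume J: "J \<in> fst ` set L2"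
  have "J \<notin> fst ` set L1" using before_after(3)[of J J] J ladder_less_irrefl by blast
  moreover have "J \<noteq> I" using before_after(2)[OF J] ladder_less_irrefl by blast
  ultimately show ?thesis using width_notin[of J L1] by (simp add: L width_append) (simp add: width_def)
qed

lemma width_this: "width L I = w"
proof -
  have "I \<notin> fst ` set L1" using before_after(1)[of I] ladder_less_irrefl by blast
  moreover have "I \<notin> fst ` set L2" using before_after(2)[of I] ladder_less_irrefl by blast
  ultimately have "width L1 I = 0" "width L2 I = 0" using width_notin by auto
  then show ?thesis by (simp add: L width_append) (simp add: width_def)
qed

lemma landed_rest: "landed ((I, w) # L2) j \<le> code u j" "landed L2 j \<le> code u j"
  using landed_le[of j] by (auto simp: L landed_append) (auto simp: landed_def)

lemma width_le: "w \<le> rowlen u L2 (index_size I)"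
  using landed_rest(1)[of "index_size I"] by (auto simp: landed_def rowlen_def)

text \<open>The indices of \<open>K\<close> above \<open>I\<close> in ladder order are exactly those
  of the entries that follow it.\<close>

lemma c_generic_eq: "c_generic u K (width L) I j = int (rowlen u L2 j)"
proof -
  have "{J \<in> K. ladder_less I J \<and> index_size J = j} = {J \<in> fst ` set L2. index_size J = j}"
    using after by blast
  then have "(\<Sum>J\<in>{J \<in> K. ladder_less I J \<and> index_size J = j}. int (width L J)) =
      (\<Sum>J\<in>{J \<in> fst ` set L2. index_size J = j}. int (width L2 J))"
    using width_after by (intro sum.cong) auto
  also have "\<dots> = int (landed L2 j)"
    unfolding landed_def using sum_width[of "fst ` set L2" L2 "\<lambda>J. index_size J = j"] by simp
  finally show ?thesis using landed_rest(2)[of j] by (simp add: c_generic_def rowlen_def)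
qed

lemma rest_row_le: "J \<in> fst ` set L2 \<Longrightarrow> fst J \<le> fst I"
  using before_after(2)[of J] by (auto simp: ladder_less_iff)

text \<open>The ladder-minimal later index in the row of \<open>I\<close> is the next entry of the
  run, and the exceptional clause computes the right end of its patch, that is,
  \<open>lastcol\<close>.\<close>

lemma c_seq_eq: "c_seq u K (width L) I j = int (profile u L2 (fst I) j)"
proof (cases "j = fst I")
  case False
  then show ?thesis by (simp add: c_seq_def c_generic_eq profile_def)
next
  case j: True
  have later: "later_in_row K I = {J \<in> fst ` set L2. fst J = fst I}"
    unfolding later_in_row_def using after by blast
  show ?thesis
  proof (cases L2)
    case Nil
    then show ?thesis using j later by (simp add: c_seq_def c_generic_eq profile_def)
  next
    case (Cons a L3)
    obtain J w' where a: "a = (J, w')" by fastforce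
    have L': "L = (L1 @ [(I, w)]) @ (J, w') # L3" using L Cons a by simp
    have J2: "J \<in> fst ` set L2" using Cons a by simp
    have sJ: "ladder_less J M" if "M \<in> fst ` set L2" "M \<noteq> J" for M
      using sorted that unfolding L Cons a by (auto simp: sorted_wrt_append)
    show ?thesis
    proof (cases "fst J = fst I")
      case True
      have ne: "later_in_row K I \<noteq> {}" using later J2 True by blast
      have "ladder_minimal (later_in_row K I) = J"
        unfolding ladder_minimal_def
      proof (rule the_equality)
        have J: "J \<in> later_in_row K I" using J2 True unfolding later by simp
        have sub: "later_in_row K I \<subseteq> fst ` set L2" unfolding later by (rule Collect_restrict)
        have "\<not> ladder_less M J" if "M \<in> later_in_row K I" for M
        proof (cases "M = J")
          case False
          have "M \<in> fst ` set L2" using subsetD[OF sub that] .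
          then show ?thesis using sJ[OF _ False] ladder_less_asym[of J M] by simp
        qed (use ladder_less_irrefl[of J] in simp)
        then show "J \<in> later_in_row K I \<and> (\<forall>I'\<in>later_in_row K I. \<not> ladder_less I' J)"
          using J by blast
        show "M = J" if M: "M \<in> later_in_row K I \<and> (\<forall>I'\<in>later_in_row K I. \<not> ladder_less I' M)" for M
        proof (rule ccontr)
          assume "M \<noteq> J"
          have "M \<in> fst ` set L2" using subsetD[OF sub M[THEN conjunct1]] .
          then have "ladder_less J M" using sJ \<open>M \<noteq> J\<close> by simp
          then show False using M J by simp
        qed
      qed
      \<comment> \<open>\<open>c_generic\<close> has already subtracted \<open>w'\<close>; by this
        bound, adding the size of \<open>J\<close> back gives \<open>rowlen u L3\<close> in spite of
        truncation.\<close>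
      moreover have "w' \<le> rowlen u L3 (index_size J)"
        using landed_rest(2)[of "index_size J"] unfolding Cons a by (auto simp: landed_def rowlen_def)
      moreover have "width L J = w'"
      proof -
        have "J \<notin> fst ` set L3"
          using sorted ladder_less_irrefl[of J] unfolding L' by (auto simp: sorted_wrt_append)
        then have "width L2 J = w'" using width_notin[of J L3] by (simp add: Cons a width_def)
        then show ?thesis using width_after[OF J2] by simp
      qed
      ultimately show ?thesis using j ne True
        by (simp add: c_seq_def c_generic_eq Let_def profile_def Cons a rowlen_Cons)
    next
      case False
      \<comment> \<open>Starting rows decrease weakly, so once the next patch starts in another row,
        all later ones do.\<close>
      have "fst M \<noteq> fst I" if "M \<in> fst ` set L2" for M
      proof (cases "M = J")
        case False
        have "fst J < fst I" using rest_row_le[OF J2] \<open>fst J \<noteq> fst I\<close> by simp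
        moreover have "fst M \<le> fst J" using sJ[OF that False] by (auto simp: ladder_less_iff)
        ultimately show ?thesis by simp
      qed (use \<open>fst J \<noteq> fst I\<close> in simp)
      then have "later_in_row K I = {}" using later by blast
      then show ?thesis using j False by (simp add: c_seq_def c_generic_eq profile_def Cons a)
    qed
  qed
qed

lemma step_ok_iff: "step_ok u I w L2 \<longleftrightarrow>
    (\<forall>p\<in>{1..length (snd I)}. \<forall>q\<in>{1..snd I ! (p - 1)}.
        (q = snd I ! (p - 1) \<longrightarrow>
          c_seq u K (width L) I (fst I + sum_list (take (p - 1) (snd I)))
            \<le> c_seq u K (width L) I (index_size I) - int (width L I) + int (length (snd I)) - int p) \<and>
        (q \<noteq> snd I ! (p - 1) \<longrightarrow>
          c_seq u K (width L) I (fst I + sum_list (take (p - 1) (snd I)) + q)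
            \<ge> c_seq u K (width L) I (index_size I) + int (length (snd I)) - int p + 1))"
proof -
  have I: "1 \<le> fst I" "snd I \<noteq> []" "\<forall>k\<in>set (snd I). 1 \<le> k" and w: "1 \<le> w"
    using good[of I] widths[of I w] unfolding L by auto
  have "fst I < index_size I" using I by (cases "snd I") (auto simp: index_size_def)
  then have p: "profile u L2 (fst I) (fst I + sum_list (snd I)) = rowlen u L2 (index_size I)"
    unfolding index_size_def[symmetric] by (simp add: profile_def)
  then have w': "w \<le> profile u L2 (fst I) (fst I + sum_list (snd I))" using width_le by simp
  have "step_ok u I w L2 \<longleftrightarrow> path (profile u L2 (fst I)) w (fst I) (snd I) (startcol u I w L2)"
    using I w rest_row_le by (auto simp: step_ok_def)
  also have "\<dots> \<longleftrightarrow> path (profile u L2 (fst I)) w (fst I) (snd I)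
      (profile u L2 (fst I) (fst I + sum_list (snd I)) + length (snd I) - w)"
    unfolding p startcol_def ..
  also note path_iff[OF I(3), of w "profile u L2 (fst I)" "fst I", OF w']
  finally show ?thesis unfolding c_seq_eq width_this index_size_def .
qed

end

lemma cond_iff_valid:
  "(\<forall>(i, ks)\<in>K. \<forall>p\<in>{1..length ks}. \<forall>q\<in>{1..ks ! (p - 1)}.
        let I = (i, ks);
            c = c_seq u K (width L) I;
            r = i + sum_list (take (p - 1) ks)
        in (q = ks ! (p - 1) \<longrightarrow>
              c r \<le> c (index_size I) - int (width L I) + int (length ks) - int p) \<and>
           (q \<noteq> ks ! (p - 1) \<longrightarrow>
              c (r + q) \<ge> c (index_size I) + int (length ks) - int p + 1)) \<longleftrightarrow> valid u L"
proof -
  have "?thesis \<longleftrightarrow> ((\<forall>L1 I w L2. L = L1 @ (I, w) # L2 \<longrightarrow> step_ok u I w L2) \<longleftrightarrow> valid u L)"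
  proof -
    have "(\<forall>I\<in>K. P I) \<longleftrightarrow> (\<forall>L1 I w L2. L = L1 @ (I, w) # L2 \<longrightarrow> P I)" for P
    proof
      assume "\<forall>I\<in>K. P I"
      then show "\<forall>L1 I w L2. L = L1 @ (I, w) # L2 \<longrightarrow> P I" by (auto simp: K_def)
    next
      assume r: "\<forall>L1 I w L2. L = L1 @ (I, w) # L2 \<longrightarrow> P I"
      show "\<forall>I\<in>K. P I"
      proof
        fix I assume "I \<in> K"
        then obtain w where "(I, w) \<in> set L" by (auto simp: K_def)
        then obtain L1 L2 where "L = L1 @ (I, w) # L2" by (meson split_list)
        then show "P I" using r by blast
      qed
    qed
    note this[of "\<lambda>I. \<forall>p\<in>{1..length (snd I)}. \<forall>q\<in>{1..snd I ! (p - 1)}.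
        (q = snd I ! (p - 1) \<longrightarrow>
          c_seq u K (width L) I (fst I + sum_list (take (p - 1) (snd I)))
            \<le> c_seq u K (width L) I (index_size I) - int (width L I) + int (length (snd I)) - int p) \<and>
        (q \<noteq> snd I ! (p - 1) \<longrightarrow>
          c_seq u K (width L) I (fst I + sum_list (take (p - 1) (snd I)) + q)
            \<ge> c_seq u K (width L) I (index_size I) + int (length (snd I)) - int p + 1)"]
    then show ?thesis using step_ok_iff by (simp add: Let_def case_prod_beta)
  qed
  moreover have "(\<forall>L1 I w L2. L' = L1 @ (I, w) # L2 \<longrightarrow> step_ok u I w L2) \<longleftrightarrow> valid u L'" for L'
  proof (induction L' rule: run_induct)
    case (Cons I w L')
    have "(\<forall>L1 J w' L2. (I, w) # L' = L1 @ (J, w') # L2 \<longrightarrow> step_ok u J w' L2) \<longleftrightarrow>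
        step_ok u I w L' \<and> (\<forall>L1 J w' L2. L' = L1 @ (J, w') # L2 \<longrightarrow> step_ok u J w' L2)"
      (is "?l \<longleftrightarrow> ?r")
    proof
      assume l: ?l
      have "step_ok u I w L'" using l[rule_format, of "[]" I w L'] by simp
      moreover have "step_ok u J w' L2" if "L' = L1 @ (J, w') # L2" for L1 J w' L2
        using l[rule_format, of "(I, w) # L1" J w' L2] that by simp
      ultimately show ?r by blast
    next
      assume r: ?r
      show ?l
      proof (intro allI impI)
        fix L1 J w' L2 assume e: "(I, w) # L' = L1 @ (J, w') # L2"
        show "step_ok u J w' L2"
        proof (cases L1)
          case Nil
          then show ?thesis using e r by simp
        next
          case (Cons a L3)
          then have "L' = L3 @ (J, w') # L2" using e by simp
          then show ?thesis using r by blast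
        qed
      qed
    qed
    then show ?case using Cons by simp
  qed simp
  ultimately show ?thesis by blast
qed

end

lemma sorted_run_valid:
  assumes "valid u L"
  shows "sorted_run u L"
proof
  show "sorted_wrt ladder_less (map fst L)" using valid_sorted[OF assms] .
  have ok: "\<exists>L2. step_ok u I w L2" if w: "(I, w) \<in> set L" for I w
  proof -
    obtain L1 L2 where "L = L1 @ (I, w) # L2" using split_list[OF w] by blast
    then have "valid u ((I, w) # L2)" using valid_append assms by blast
    then show ?thesis by auto
  qed
  show "1 \<le> w" if "(I, w) \<in> set L" for I w using ok[OF that] by (auto simp: step_ok_def)
  show "1 \<le> fst I \<and> snd I \<noteq> [] \<and> (\<forall>k\<in>set (snd I). 1 \<le> k)" if I: "I \<in> fst ` set L" for I
  proof -
    obtain w where "(I, w) \<in> set L" using I by auto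
    then obtain L2 where s: "step_ok u I w L2" using ok by blast
    show ?thesis using step_okD(7)[OF s] s unfolding step_ok_def by blast
  qed
  show "landed L j \<le> code u j" for j using landed_le_code[OF assms] .
qed

text \<open>A patch lands in a row with positive code entry, so the size of its index is at most
  \<open>code_length u\<close>.\<close>

lemma width_in_Phi:
  assumes u: "u permutes {1..n}" and v: "valid u L"
  shows "width L \<in> Phi (code_length u) u" "fst ` set L \<subseteq> indices (code_length u)"
proof -
  interpret sorted_run u L using sorted_run_valid[OF v] .
  let ?\<mu> = "code_length u"
  have pos: "width L I \<noteq> 0 \<and> index_size I \<le> ?\<mu>" if I: "I \<in> K" for I
  proof -
    obtain w where w: "(I, w) \<in> set L" using I by (auto simp: K_def)
    then obtain L1 L2 where L: "L = L1 @ (I, w) # L2" by (meson split_list)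
    have "1 \<le> w" using widths[OF w] .
    moreover from this have "0 < code u (index_size I)"
      using width_le[OF L] by (simp add: rowlen_def)
    ultimately show ?thesis using width_this[OF L] le_code_length[OF u] by simp
  qed
  show sub: "fst ` set L \<subseteq> indices ?\<mu>"
    using good pos by (fastforce simp: indices_def K_def)
  have iff: "I \<in> K \<longleftrightarrow> width L I \<noteq> 0" for I
    using pos[of I] width_ne_0[of L I] unfolding K_def by blast
  have "width L \<in> Phi_supp ?\<mu> K u"
    unfolding Phi_supp_def
  proof (intro CollectI conjI)
    show "width L \<in> Phi_all ?\<mu>" using iff sub by (auto simp: Phi_all_def K_def)
    show "\<forall>I\<in>indices ?\<mu>. I \<in> K \<longleftrightarrow> width L I \<noteq> 0" using iff by blast
    show "\<forall>j\<in>{1..?\<mu>}. (\<Sum>I\<in>{I \<in> K. index_size I = j}. width L I) \<le> code u j"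
      using landed_le sum_width[of K L] by (simp add: landed_def K_def)
  qed (use cond_iff_valid v in blast)
  moreover have "K \<in> Pow (indices ?\<mu>)" using sub by (simp add: K_def)
  ultimately show "width L \<in> Phi ?\<mu> u" unfolding Phi_def by blast
qed

text \<open>The run is the support of \<open>x\<close> sorted by the ladder order, the only order
  that a valid run admits.\<close>

lemma Phi_imp_valid:
  assumes "x \<in> Phi \<mu> u"
  shows "\<exists>L. valid u L \<and> width L = x"
proof -
  obtain K where K: "K \<subseteq> indices \<mu>" "x \<in> Phi_supp \<mu> K u" using assms unfolding Phi_def by blast
  note x = K(2)[unfolded Phi_supp_def mem_Collect_eq]
  have finK: "finite K" using finite_subset[OF K(1) finite_indices] .
  obtain xs where xs: "sorted_wrt ladder_less xs" "set xs = K" using sorted_list_exists[OF finK] by blast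
  define L where "L = map (\<lambda>I. (I, x I)) xs"
  have fstL: "map fst L = xs" by (simp add: L_def comp_def)
  have setL: "fst ` set L = K" using xs(2) by (force simp: L_def)
  have supp: "I \<in> K \<longleftrightarrow> x I \<noteq> 0" for I
    proof (cases "I \<in> indices \<mu>")
    case True
    then show ?thesis using x by blast
  next
    case False
    then have "x I = 0" using x unfolding Phi_all_def by blast
    then show ?thesis using False K(1) by blast
  qed
  have "distinct xs" using xs(1)
  proof (induction xs)
    case (Cons y ys)
    then show ?case using ladder_less_irrefl[of y] by auto
  qed simp
  then have width: "width L I = x I" if "I \<in> set xs" for I
    using that unfolding L_def
  proof (induction xs)
    case (Cons y ys)
    show ?case
    proof (cases "I = y")
      case True
      then have "width (map (\<lambda>I. (I, x I)) ys) I = 0" using Cons.prems by (intro width_notin) auto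
      then show ?thesis using True by (simp add: width_def)
    next
      case False
      then show ?thesis using Cons by (simp add: width_def)
    qed
  qed simp
  have width_x: "width L = x"
  proof
    fix I show "width L I = x I"
      using width[of I] width_notin[of I L] supp[of I] setL xs(2) by (cases "I \<in> K") auto
  qed
  have good: "1 \<le> fst I \<and> snd I \<noteq> [] \<and> (\<forall>k\<in>set (snd I). 1 \<le> k) \<and> index_size I \<le> \<mu>" if "I \<in> K" for I
    using K(1) that by (fastforce simp: indices_def)
  have landed: "landed L j = (\<Sum>I\<in>{I \<in> K. index_size I = j}. x I)" for j
    unfolding landed_def using sum_width[of K L "\<lambda>I. index_size I = j"] finK setL width_x by simp
  interpret sorted_run u L
  proof
    show "sorted_wrt ladder_less (map fst L)" using xs(1) fstL by simp
    show "1 \<le> w" if "(I, w) \<in> set L" for I w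
      using that supp[of I] xs(2) by (auto simp: L_def)
    show "1 \<le> fst I \<and> snd I \<noteq> [] \<and> (\<forall>k\<in>set (snd I). 1 \<le> k)" if "I \<in> fst ` set L" for I
      using good that setL by blast
    show "landed L j \<le> code u j" for j
    proof (cases "j \<in> {1..\<mu>}")
      case True
      then show ?thesis using x landed by simp
    next
      case False
      \<comment> \<open>Condition (2) covers only rows \<open>j\<close> in
        \<open>{1..\<mu>}\<close>; in the others no patch lands.\<close>
      have "index_size I \<in> {1..\<mu>}" if "I \<in> K" for I using good[OF that] by (simp add: index_size_def)
      then have "{I \<in> K. index_size I = j} = {}" using False by blast
      then have "landed L j = 0" unfolding landed by (simp only: sum.empty)
      then show ?thesis by simp
    qed
  qed
  have "sorted_run.K L = K" by (simp add: K_def setL)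
  then have "valid u L" using cond_iff_valid x width_x by simp
  then show ?thesis using width_x by blast
qed

text \<open>The support of the widths gives the set of indices, the ladder order their sequence, and
  the widths the sizes.\<close>

lemma valid_unique:
  assumes "valid u L" "valid u L'" "width L = width L'"
  shows "L = L'"
proof -
  have L: "L = map (\<lambda>I. (I, width L I)) (map fst L) \<and> set (map fst L) = {I. width L I \<noteq> 0}" if "valid u L" for L
  proof -
    interpret sorted_run u L using sorted_run_valid[OF that] .
    have m: "width L I = w" if w: "(I, w) \<in> set L" for I w
    proof -
      obtain L1 L2 where "L = L1 @ (I, w) # L2" using w by (meson split_list)
      then show ?thesis by (rule width_this)
    qed
    have "map (\<lambda>I. (I, width L I)) (map fst L) = map id L"
      unfolding map_map by (rule map_cong) (auto simp: m)
    moreover have "set (map fst L) = {I. width L I \<noteq> 0}"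
    proof
      show "set (map fst L) \<subseteq> {I. width L I \<noteq> 0}" 
      proof
        fix I assume "I \<in> set (map fst L)"
        then obtain w where "(I, w) \<in> set L" by auto
        then show "I \<in> {I. width L I \<noteq> 0}" using m[of I w] widths[of I w] by simp
      qed
      show "{I. width L I \<noteq> 0} \<subseteq> set (map fst L)" 
      proof
        fix I assume "I \<in> {I. width L I \<noteq> 0}"
        then show "I \<in> set (map fst L)" using width_ne_0[of L I] unfolding set_map by blast
      qed
    qed
    ultimately show ?thesis by simp
  qed
  have "map fst L = map fst L'"
    using sorted_wrt_ladder_unique[OF valid_sorted[OF assms(1)] valid_sorted[OF assms(2)]]
      L[OF assms(1)] L[OF assms(2)] assms(3) by simp
  then show ?thesis using L[OF assms(1)] L[OF assms(2)] assms(3) by metis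
qed

section \<open>Weights and the final bijection\<close>

lemma wt_eq_card_row: "wt D r = card (row D r)"
  by (simp add: wt_def row_def)

text \<open>Putting a patch back transfers \<open>w\<close> crosses from row
  \<open>index_size I\<close> to row \<open>fst I\<close>. The identity is kept additive to avoid
  truncated subtraction.\<close>

lemma wt_diagram:
  assumes "u permutes {1..n}" "valid u L"
  shows "wt (diagram u L) r + landed L r = code u r + (\<Sum>(I, w)\<leftarrow>L. if fst I = r then w else 0)"
  using assms(2)
proof (induction L rule: run_induct)
  case Nil
  then show ?case by (simp add: wt_eq_card_row row_bottom landed_def)
next
  case (Cons I w L)
  note split = diagram_split[OF Cons.prems]
  have "pipe_dream n u (diagram u L)" using valid_rounds[OF assms(1)] Cons.prems by simp
  then have "finite (row (diagram u L) r)" by (rule positive_cells_row(1)[OF positive_cells_pipe_dream])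
  then have fin: "finite (row (fixed_part u I w L) r)"
    by (rule finite_subset[rotated]) (simp add: fixed_part_def row_diff_patch)
  have wt: "wt (fixed_part u I w L \<union> patch i a w) r = card (row (fixed_part u I w L) r) + (if i = r then w else 0)"
    if "fixed_part u I w L \<inter> patch i a w = {}" for i a
  proof (cases "i = r")
    case True
    have "row (fixed_part u I w L) r \<inter> {a<..a + w} = {}" using that True by fastforce
    then show ?thesis using True fin by (simp add: wt_eq_card_row row_un_patch card_Un_disjoint)
  next
    case False
    then show ?thesis by (simp add: wt_eq_card_row row_un_patch)
  qed
  show ?case
    using Cons wt[OF split(2)] wt[OF split(4)] unfolding split(1) split(3) by (auto simp: landed_def)
qed

theorem theorem4p3:
  fixes n :: nat and u :: "nat \<Rightarrow> nat" and \<mu> :: nat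
  assumes "u permutes {1..n}"
    and "\<mu> = code_length u"
  shows "bij_betw encoding (PD n u) (Phi \<mu> u) \<and>
    (\<forall>D\<in>PD n u. \<forall>j\<ge>1. weight u \<mu> (encoding D) j = int (wt D j))"
proof (intro conjI ballI allI impI)
  note u = assms(1)
  have PD: "D \<in> PD n u \<longleftrightarrow> (\<exists>L. valid u L \<and> D = diagram u L)" for D
    unfolding PD_iff_pipe_dream[OF u] using pipe_dream_imp_diagram[OF u] valid_rounds[OF u] by blast
  show "bij_betw encoding (PD n u) (Phi \<mu> u)"
    unfolding bij_betw_def
  proof
    show "inj_on encoding (PD n u)"
    proof (rule inj_onI)
      fix D D' assume D: "D \<in> PD n u" "D' \<in> PD n u" "encoding D = encoding D'"
      from D(1) obtain L where L: "valid u L" "D = diagram u L" unfolding PD by blast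
      from D(2) obtain L' where L': "valid u L'" "D' = diagram u L'" unfolding PD by blast
      have "width L = width L'" using D(3) encoding_diagram[OF u] L L' by simp
      then have "L = L'" using valid_unique[OF L(1) L'(1)] by simp
      then show "D = D'" using L L' by simp
    qed
    show "encoding ` PD n u = Phi \<mu> u"
    proof
      show "encoding ` PD n u \<subseteq> Phi \<mu> u"
      proof
        fix x assume "x \<in> encoding ` PD n u"
        then obtain L where "valid u L" "x = encoding (diagram u L)" by (auto simp: PD)
        then show "x \<in> Phi \<mu> u" using encoding_diagram[OF u] width_in_Phi(1)[OF u] assms(2) by simp
      qed
      show "Phi \<mu> u \<subseteq> encoding ` PD n u"
      proof
        fix x assume "x \<in> Phi \<mu> u"
        from Phi_imp_valid[OF this] obtain L where L: "valid u L" "width L = x" by blast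
        then have "diagram u L \<in> PD n u" unfolding PD by blast
        moreover have "x = encoding (diagram u L)" using encoding_diagram[OF u] L by simp
        ultimately show "x \<in> encoding ` PD n u" by simp
      qed
    qed
  qed
  fix D j assume "D \<in> PD n u"
  then obtain L where v: "valid u L" and D: "D = diagram u L" unfolding PD by blast
  have sum: "(\<Sum>I\<in>{I \<in> indices \<mu>. P I}. int (width L I)) = int (\<Sum>(I, w)\<leftarrow>L. if P I then w else 0)" for P
    using sum_width[OF finite_indices, of L \<mu> P] width_in_Phi(2)[OF u v] assms(2) by simp
  show "weight u \<mu> (encoding D) j = int (wt D j)"
    using wt_diagram[OF u v, of j]
    unfolding weight_def D encoding_diagram[OF u v] sum landed_def by linarith
qed

end
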